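(* Let $\Omega\subset\mathbb R^N$ ($N>2$) be a bounded open set with Lipschitz boundary, let $\vec p=(p_1,\dots,p_N)$ with $p_i>1$ for every $i$, and let $\mathcal A_i,\mathcal B_i$ ($i=1,\dots,N$) satisfy the structure assumptions listed in the context, with constants $0<\alpha\le\beta_i$ and coefficients $b_i\in L^{\frac{Np_i'}{\bar p},\infty}(\Omega)$. Let $1<\bar p<N$ and let $\vec r=(r_1,\dots,r_N)$ be such that $$1<\mu<\frac N{\bar p},\qquad\mu=\min_i\left\{\frac{r_i}{p_i}\right\}.$$ There exists a positive constant $d=d(\vec r,N,\alpha,\vec p)$ such that if $$\max_i\left\{\mathrm{dist}_{L^{\frac{Np_i'}{\bar p},\infty}(\Omega)}(b_i,L^\infty(\Omega))\right\}<d$$ and $u\in W_0^{1,\vec p}(\Omega)$ is a weak solution to $$\sum_{i=1}^N\partial_{x_i}\big(\mathcal A_i(x,\nabla u)+\mathcal B_i(x,u)\big)=\sum_{i=1}^N\partial_{x_i}\big(|\mathcal F_i|^{p_i-2}\mathcal F_i\big)\quad\text{in }\Omega$$ with $\mathcal F_i\in L^{r_i}(\Omega)$ for $i=1,\dots,N$, then $$u\in L^s(\Omega)\quad\text{with } s=\max\{(\mu\bar p)^*,\ \mu p_{\max}\}.$$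
   Context: Notation: $\bar p$ is the harmonic mean, $\frac1{\bar p}=\frac1N\sum_{i=1}^N\frac1{p_i}$; $p_{\max}=\max_i p_i$; $p'=\frac{p}{p-1}$; $p^*=\frac{Np}{N-p}$ for $1\le p<N$, so $(\mu\bar p)^*=\frac{N\mu\bar p}{N-\mu\bar p}$. Structure assumptions, for every $i=1,\dots,N$: (1) $\mathcal A_i:\Omega\times\mathbb R^N\to\mathbb R$ is a Carathéodory function with $|\mathcal A_i(x,\xi)|\le\beta_i|\xi_i|^{p_i-1}$ and $\alpha\sum_{i=1}^N|\xi_i|^{p_i}\le\sum_{i=1}^N\mathcal A_i(x,\xi)\,\xi_i$ for a.e. $x\in\Omega$ and every $\xi\in\mathbb R^N$, where $0<\alpha\le\beta_i$ are constants. (2) $\mathcal B_i:\Omega\times\mathbb R\to\mathbb R$ is a Carathéodory function with $|\mathcal B_i(x,s)|\le b_i(x)|s|^{\bar p/p_i'}$ for a.e. $x\in\Omega$ and every $s\in\mathbb R$, where $b_i\ge0$ belongs to the Marcinkiewicz space $L^{\frac{Np_i'}{\bar p},\infty}(\Omega)$. Lorentz spaces: for measurable $v$ on $\Omega$, $\mu_v(\lambda)=|\{x\in\Omega:|v(x)|>\lambda\}|$ and $v^*(s)=\sup\{t\ge0:\mu_v(t)\ge s\}$. $L^{p,\infty}(\Omega)$ is the set of $v$ with $\|v\|_{L^{p,\infty}(\Omega)}=\sup_{t\in(0,|\Omega|)}t^{1/p}v^*(t)<\infty$. For $f\in L^{p,\infty}(\Omega)$, $\mathrm{dist}_{L^{p,\infty}(\Omega)}(f,L^\infty(\Omega))=\inf_{g\in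 L^\infty(\Omega)}\|f-g\|_{L^{p,\infty}(\Omega)}$. $W_0^{1,\vec p}(\Omega)$ is the closure of $C_0^\infty(\Omega)$ with respect to the norm $\sum_{i=1}^N\|\partial_{x_i}u\|_{L^{p_i}(\Omega)}$. A function $u\in W_0^{1,\vec p}(\Omega)$ is a weak solution (of the homogeneous Dirichlet problem) if for every $\varphi\in C_0^\infty(\Omega)$ $$\sum_{i=1}^N\int_\Omega\big(\mathcal A_i(x,\nabla u)+\mathcal B_i(x,u)\big)\partial_{x_i}\varphi\,dx=\sum_{i=1}^N\int_\Omega|\mathcal F_i|^{p_i-2}\mathcal F_i\,\partial_{x_i}\varphi\,dx.$$ *)

theory Defs
  imports "HOL-Analysis.Analysis"
begin

section \<open>Exponents\<close>

definition harmonic_mean :: "('n::finite \<Rightarrow> real) \<Rightarrow> real" where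
  "harmonic_mean p = 1 / ((1 / real CARD('n)) * (\<Sum>i\<in>UNIV. 1 / p i))"

definition conj_exponent :: "real \<Rightarrow> real" where
  "conj_exponent q = q / (q - 1)"

definition sobolev_exponent :: "nat \<Rightarrow> real \<Rightarrow> real" where
  "sobolev_exponent N q = real N * q / (real N - q)"


section \<open>Lebesgue and Marcinkiewicz spaces\<close>

definition Lp_space :: "real \<Rightarrow> (real^'n) set \<Rightarrow> (real^'n \<Rightarrow> real) set" where
  "Lp_space q \<Omega> = {v. v \<in> borel_measurable (lebesgue_on \<Omega>) \<and>
                      integrable (lebesgue_on \<Omega>) (\<lambda>x. \<bar>v x\<bar> powr q)}"

definition Lp_norm :: "real \<Rightarrow> (real^'n) set \<Rightarrow> (real^'n \<Rightarrow> real) \<Rightarrow> real" where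
  "Lp_norm q \<Omega> v = (\<integral>x. \<bar>v x\<bar> powr q \<partial>lebesgue_on \<Omega>) powr (1 / q)"

definition Linf_space :: "(real^'n) set \<Rightarrow> (real^'n \<Rightarrow> real) set" where
  "Linf_space \<Omega> = {v. v \<in> borel_measurable (lebesgue_on \<Omega>) \<and>
                      (\<exists>C. AE x in lebesgue_on \<Omega>. \<bar>v x\<bar> \<le> C)}"

definition distribution_fun :: "(real^'n) set \<Rightarrow> (real^'n \<Rightarrow> real) \<Rightarrow> real \<Rightarrow> ennreal" where
  "distribution_fun \<Omega> v t = emeasure lebesgue {x \<in> \<Omega>. t < \<bar>v x\<bar>}"

text \<open>The values below lie in \<^typ>\<open>ennreal\<close>, so a supremum over the empty set is 0 and an
  unbounded supremum is infinite.\<close>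

definition decr_rearrangement :: "(real^'n) set \<Rightarrow> (real^'n \<Rightarrow> real) \<Rightarrow> real \<Rightarrow> ennreal" where
  "decr_rearrangement \<Omega> v s = (SUP t\<in>{t. 0 \<le> t \<and> ennreal s \<le> distribution_fun \<Omega> v t}. ennreal t)"

definition weak_Lp_norm :: "real \<Rightarrow> (real^'n) set \<Rightarrow> (real^'n \<Rightarrow> real) \<Rightarrow> ennreal" where
  "weak_Lp_norm q \<Omega> v =
     (SUP t\<in>{t. 0 < t \<and> ennreal t < emeasure lebesgue \<Omega>}.
        ennreal (t powr (1 / q)) * decr_rearrangement \<Omega> v t)"

definition weak_Lp_space :: "real \<Rightarrow> (real^'n) set \<Rightarrow> (real^'n \<Rightarrow> real) set" where
  "weak_Lp_space q \<Omega> = {v. v \<in> borel_measurable (lebesgue_on \<Omega>) \<and> weak_Lp_norm q \<Omega> v < \<infinity>}"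

definition dist_to_Linf :: "real \<Rightarrow> (real^'n) set \<Rightarrow> (real^'n \<Rightarrow> real) \<Rightarrow> ennreal" where
  "dist_to_Linf q \<Omega> f = (INF g\<in>Linf_space \<Omega>. weak_Lp_norm q \<Omega> (\<lambda>x. f x - g x))"


section \<open>Lipschitz boundary\<close>

text \<open>Near each boundary point, in suitable orthonormal coordinates with last axis \<open>e\<close>, the set is
  the strict epigraph of a Lipschitz function \<open>\<gamma>\<close> of the remaining coordinates, that is, of the
  orthogonal projection of the point to the hyperplane normal to \<open>e\<close>.\<close>

definition lipschitz_boundary :: "(real^'n) set \<Rightarrow> bool" where
  "lipschitz_boundary \<Omega> \<longleftrightarrow>
     (\<forall>z\<in>frontier \<Omega>. \<exists>\<rho>>0. \<exists>e \<gamma> L. norm e = 1 \<and> L-lipschitz_on {y. y \<bullet> e = 0} \<gamma> \<and>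
        \<Omega> \<inter> ball z \<rho> = {x \<in> ball z \<rho>. \<gamma> (x - (x \<bullet> e) *\<^sub>R e) < x \<bullet> e})"


section \<open>Test functions, weak gradients and the anisotropic Sobolev space\<close>

definition partial_deriv :: "'n \<Rightarrow> (real^'n \<Rightarrow> real) \<Rightarrow> real^'n \<Rightarrow> real" where
  "partial_deriv i f x = frechet_derivative f (at x) (axis i 1)"

primrec Ck_fun :: "nat \<Rightarrow> (real^'n \<Rightarrow> real) \<Rightarrow> bool" where
  "Ck_fun 0 f \<longleftrightarrow> continuous_on UNIV f"
| "Ck_fun (Suc k) f \<longleftrightarrow> (\<forall>x. f differentiable (at x)) \<and> (\<forall>i. Ck_fun k (partial_deriv i f))"

definition test_functions :: "(real^'n) set \<Rightarrow> (real^'n \<Rightarrow> real) set" where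
  "test_functions \<Omega> = {\<phi>. (\<forall>k. Ck_fun k \<phi>) \<and> compact (closure {x. \<phi> x \<noteq> 0}) \<and>
                           closure {x. \<phi> x \<noteq> 0} \<subseteq> \<Omega>}"

definition locally_integrable_on :: "(real^'n) set \<Rightarrow> (real^'n \<Rightarrow> real) \<Rightarrow> bool" where
  "locally_integrable_on \<Omega> v \<longleftrightarrow> (\<forall>K. compact K \<and> K \<subseteq> \<Omega> \<longrightarrow> integrable (lebesgue_on K) v)"

definition has_weak_gradient ::
    "(real^'n) set \<Rightarrow> (real^'n \<Rightarrow> real) \<Rightarrow> (real^'n \<Rightarrow> real^'n) \<Rightarrow> bool" where
  "has_weak_gradient \<Omega> u Du \<longleftrightarrow> locally_integrable_on \<Omega> u \<and>
     (\<forall>i. locally_integrable_on \<Omega> (\<lambda>x. Du x $ i) \<and>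
       (\<forall>\<phi>\<in>test_functions \<Omega>.
          (\<integral>x. u x * partial_deriv i \<phi> x \<partial>lebesgue_on \<Omega>) = - (\<integral>x. Du x $ i * \<phi> x \<partial>lebesgue_on \<Omega>)))"

text \<open>Closure of the test functions for the norm given by the sum of the norms of the partial
  derivatives. On bounded \<open>\<Omega>\<close>, Poincare's inequality makes every sequence of test functions that is
  Cauchy for this norm converge in \<open>L\<^sup>1\<close>, and that limit is the function represented by the abstract
  limit. Convergence of the gradients alone would not determine \<open>u\<close>: it would, for instance,
  admit all constants.\<close>

definition W0_space :: "('n::finite \<Rightarrow> real) \<Rightarrow> (real^'n) set \<Rightarrow> (real^'n \<Rightarrow> real) set" where
  "W0_space p \<Omega> = {u. u \<in> Lp_space 1 \<Omega> \<and>
     (\<exists>Du. has_weak_gradient \<Omega> u Du \<and> (\<forall>i. (\<lambda>x. Du x $ i) \<in> Lp_space (p i) \<Omega>) \<and>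
       (\<exists>\<phi>. (\<forall>k::nat. \<phi> k \<in> test_functions \<Omega>) \<and>
          (\<lambda>k. \<Sum>i\<in>UNIV. Lp_norm (p i) \<Omega> (\<lambda>x. partial_deriv i (\<phi> k) x - Du x $ i)) \<longlonglongrightarrow> 0 \<and>
          (\<lambda>k. Lp_norm 1 \<Omega> (\<lambda>x. \<phi> k x - u x)) \<longlonglongrightarrow> 0))}"


section \<open>Structure assumptions and weak solutions\<close>

definition caratheodory :: "(real^'n) set \<Rightarrow> (real^'n \<Rightarrow> 'b::topological_space \<Rightarrow> real) \<Rightarrow> bool" where
  "caratheodory \<Omega> f \<longleftrightarrow> (\<forall>\<xi>. (\<lambda>x. f x \<xi>) \<in> borel_measurable (lebesgue_on \<Omega>)) \<and>
     (AE x in lebesgue_on \<Omega>. continuous_on UNIV (f x))"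

definition structure_A :: "(real^'n) set \<Rightarrow> ('n::finite \<Rightarrow> real) \<Rightarrow> real \<Rightarrow> ('n \<Rightarrow> real) \<Rightarrow>
    ('n \<Rightarrow> real^'n \<Rightarrow> real^'n \<Rightarrow> real) \<Rightarrow> bool" where
  "structure_A \<Omega> p \<alpha> \<beta> A \<longleftrightarrow>
     (\<forall>i. 0 < \<alpha> \<and> \<alpha> \<le> \<beta> i) \<and>
     (\<forall>i. caratheodory \<Omega> (A i)) \<and>
     (\<forall>i. AE x in lebesgue_on \<Omega>. \<forall>\<xi>. \<bar>A i x \<xi>\<bar> \<le> \<beta> i * \<bar>\<xi> $ i\<bar> powr (p i - 1)) \<and>
     (AE x in lebesgue_on \<Omega>. \<forall>\<xi>. \<alpha> * (\<Sum>i\<in>UNIV. \<bar>\<xi> $ i\<bar> powr p i) \<le> (\<Sum>i\<in>UNIV. A i x \<xi> * \<xi> $ i))"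

definition structure_B :: "(real^'n) set \<Rightarrow> ('n::finite \<Rightarrow> real) \<Rightarrow> ('n \<Rightarrow> real^'n \<Rightarrow> real) \<Rightarrow>
    ('n \<Rightarrow> real^'n \<Rightarrow> real \<Rightarrow> real) \<Rightarrow> bool" where
  "structure_B \<Omega> p b B \<longleftrightarrow>
     (\<forall>i. caratheodory \<Omega> (B i) \<and>
       (AE x in lebesgue_on \<Omega>. 0 \<le> b i x) \<and>
       b i \<in> weak_Lp_space (real CARD('n) * conj_exponent (p i) / harmonic_mean p) \<Omega> \<and>
       (AE x in lebesgue_on \<Omega>. \<forall>s. \<bar>B i x s\<bar> \<le> b i x * \<bar>s\<bar> powr (harmonic_mean p / conj_exponent (p i))))"

text \<open>Weak gradients are unique almost everywhere, so the choice of \<open>Du\<close> is immaterial. All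
  integrands are integrable under the structure assumptions when \<open>\<Omega>\<close> is bounded, \<open>harmonic_mean p < N\<close> and each
  \<open>F i\<close> lies in \<open>L\<^sup>q\<close> with \<open>q = p i > 1\<close>.\<close>

definition weak_solution :: "(real^'n) set \<Rightarrow> ('n::finite \<Rightarrow> real) \<Rightarrow>
    ('n \<Rightarrow> real^'n \<Rightarrow> real^'n \<Rightarrow> real) \<Rightarrow> ('n \<Rightarrow> real^'n \<Rightarrow> real \<Rightarrow> real) \<Rightarrow>
    ('n \<Rightarrow> real^'n \<Rightarrow> real) \<Rightarrow> (real^'n \<Rightarrow> real) \<Rightarrow> bool" where
  "weak_solution \<Omega> p A B F u \<longleftrightarrow> u \<in> W0_space p \<Omega> \<and>
     (\<exists>Du. has_weak_gradient \<Omega> u Du \<and>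
       (\<forall>\<phi>\<in>test_functions \<Omega>.
          (\<Sum>i\<in>UNIV. \<integral>x. (A i x (Du x) + B i x (u x)) * partial_deriv i \<phi> x \<partial>lebesgue_on \<Omega>) =
          (\<Sum>i\<in>UNIV. \<integral>x. \<bar>F i x\<bar> powr (p i - 2) * F i x * partial_deriv i \<phi> x \<partial>lebesgue_on \<Omega>)))"

end

theory Submission
  imports Defs "HOL-Real_Asymp.Real_Asymp"
begin

text \<open>
The proof tests the equation with \<open>u * w (u)\<close>, where \<open>w = wt \<gamma> \<epsilon>\<close> is a smooth bounded
substitute for \<open>\<bar>t\<bar> powr \<gamma>\<close> that increases with \<open>\<bar>t\<bar>\<close>, and lets \<open>\<epsilon>\<close> tend to 0 in estimates that do not depend on \<open>\<epsilon>\<close>.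
Let \<open>q\<close> be the harmonic mean of the \<open>p i\<close>, \<open>N\<close> the dimension, and let \<open>D\<close> be the weighted energy,
the sum of the integrals of \<open>w (u) * \<bar>Du i\<bar> powr p i\<close>.

Coercivity and Young's inequality bound \<open>D\<close> by the integrals of \<open>\<bar>F i\<bar> powr p i * w (u)\<close> and
of \<open>V * \<bar>u\<bar> powr q * w (u)\<close>, where \<open>V\<close> is \<open>b i\<close> to the conjugate power of \<open>p i\<close>, a function in the
Marcinkiewicz space of exponent \<open>N / q\<close> (\<open>energy_inequality\<close>). The second integral is at most a
constant times the norm of \<open>V\<close> times \<open>1 + D\<close>, by the Hardy-Sobolev inequality \<open>Hardy_W0\<close>. If \<open>b i\<close>
is close to a bounded function, this is absorbed into \<open>D\<close>: the remainder has small norm, and the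
bounded part has small norm on the set where \<open>\<bar>u\<bar>\<close> is large and contributes a constant on the rest
(\<open>energy_estimate\<close>).

The Hardy-Sobolev inequality is the point where anisotropy and weight meet. A weight cannot be moved
inside the derivatives, because the exponents \<open>p i\<close> differ, but it is essentially constant on each
slice \<open>2 ^ k \<le> \<bar>u\<bar> < 2 ^ (k + 1)\<close>. On a line parallel to an axis that meets the upper level set, the
derivative has integral at least \<open>2 ^ k\<close> over the slice, so Gagliardo's inequality bounds the measure of the level set of height \<open>2 ^ (k + 1)\<close>
by the energy of the slice and the measure of the level set of height \<open>2 ^ k\<close> (\<open>dyadic_level\<close>). If
the latter is much larger than the former, the level contributes a geometrically small amount, otherwise
it can be eliminated; summation over \<open>k\<close> gives the result for smooth functions (\<open>Hardy_test\<close>).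

Finally, for \<open>F i\<close> with \<open>\<bar>F i\<bar> powr p i\<close> in the space of exponent \<open>\<mu>\<close>, Hoelder's inequality turns the
energy estimate into \<open>D \<le> C * (1 + Y powr (1 - 1 / \<mu>))\<close>, where \<open>Y\<close> is the integral of
\<open>w (u) powr (\<mu> / (\<mu> - 1))\<close>. Conversely, \<open>Y powr (1 - q / N) \<le> C * (1 + D)\<close> for one value of \<open>\<gamma>\<close>, by
Sobolev's inequality, and \<open>Y \<le> C * (1 + D)\<close> for another one, by Poincare's inequality in the direction
with the largest exponent. Both powers exceed \<open>1 - 1 / \<mu>\<close>, hence \<open>Y\<close> is bounded, and the limit \<open>\<epsilon> = 0\<close>
yields the two exponents of the theorem (\<open>integrability_from_energy\<close>).
\<close>

section \<open>Hoelder's inequality for extended nonnegative functions\<close>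

definition epowr :: "ennreal \<Rightarrow> real \<Rightarrow> ennreal" where
  "epowr x a = (if x = \<infinity> then \<infinity> else ennreal (enn2real x powr a))"

lemma epowr_ennreal [simp]: "0 \<le> x \<Longrightarrow> epowr (ennreal x) a = ennreal (x powr a)"
  by (simp add: epowr_def)

lemma epowr_top [simp]: "epowr \<infinity> a = \<infinity>" "epowr top a = top"
  by (simp_all add: epowr_def)

lemma epowr_0 [simp]: "epowr 0 a = 0"
  by (simp add: epowr_def)

lemma epowr_1: "epowr 1 a = 1"
  using epowr_ennreal[of 1 a] by simp

lemma epowr_eq_0_iff [simp]: "epowr x a = 0 \<longleftrightarrow> x = 0"
  by (cases x) (auto simp: ennreal_eq_0_iff)

lemma epowr_eq_top_iff [simp]: "epowr x a = top \<longleftrightarrow> x = top"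
  by (cases x) auto

lemma epowr_mult: "epowr (x * y) a = epowr x a * epowr y a"
  by (cases x; cases y)
     (auto simp: powr_mult ennreal_mult_top ennreal_top_mult simp flip: ennreal_mult)

lemma epowr_mono: "0 \<le> a \<Longrightarrow> x \<le> y \<Longrightarrow> epowr x a \<le> epowr y a"
  by (cases x; cases y) (auto simp: powr_mono2 top_unique intro!: ennreal_leI)

lemma borel_measurable_epowr [measurable]:
  assumes [measurable]: "f \<in> borel_measurable M"
  shows "(\<lambda>x. epowr (f x) a) \<in> borel_measurable M"
  unfolding epowr_def by measurable

lemma powr_prod_exp: "finite I \<Longrightarrow> (\<And>i. i \<in> I \<Longrightarrow> 0 < y i) \<Longrightarrow>
    (\<Prod>i\<in>I. y i powr \<theta> i) = exp (\<Sum>i\<in>I. \<theta> i * ln (y i :: real))"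
  using less_irrefl by (fastforce simp: exp_sum powr_def intro!: prod.cong)

text \<open>Weighted arithmetic-geometric mean inequality: convexity of the exponential function.\<close>

lemma weighted_AM_GM:
  fixes y \<theta> :: "'i \<Rightarrow> real"
  assumes fin: "finite I" and \<theta>: "\<And>i. i \<in> I \<Longrightarrow> 0 < \<theta> i" and sum1: "(\<Sum>i\<in>I. \<theta> i) = 1"
    and y: "\<And>i. i \<in> I \<Longrightarrow> 0 \<le> y i"
  shows "(\<Prod>i\<in>I. y i powr \<theta> i) \<le> (\<Sum>i\<in>I. \<theta> i * y i)"
proof (cases "\<exists>i\<in>I. y i = 0")
  case True
  then have "(\<Prod>i\<in>I. y i powr \<theta> i) = 0"
    using fin by (auto intro!: prod_zero)
  moreover have "0 \<le> (\<Sum>i\<in>I. \<theta> i * y i)"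
    using \<theta> y by (intro sum_nonneg mult_nonneg_nonneg) (auto intro: less_imp_le)
  ultimately show ?thesis by simp
next
  case False
  then have pos: "\<And>i. i \<in> I \<Longrightarrow> 0 < y i" using y by (metis order_le_less)
  have "I \<noteq> {}" using sum1 by auto
  then have "exp (\<Sum>i\<in>I. \<theta> i *\<^sub>R ln (y i)) \<le> (\<Sum>i\<in>I. \<theta> i * exp (ln (y i)))"
    using fin \<theta> sum1 by (intro convex_on_sum[OF _ _ exp_convex]) (auto intro: less_imp_le)
  then show ?thesis
    using pos by (simp add: powr_prod_exp[OF fin] cong: sum.cong)
qed

lemma weighted_AM_GM_ennreal:
  fixes y :: "'i \<Rightarrow> ennreal" and \<theta> :: "'i \<Rightarrow> real"
  assumes fin: "finite I" and \<theta>: "\<And>i. i \<in> I \<Longrightarrow> 0 < \<theta> i" and sum1: "(\<Sum>i\<in>I. \<theta> i) = 1"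
  shows "(\<Prod>i\<in>I. epowr (y i) (\<theta> i)) \<le> (\<Sum>i\<in>I. ennreal (\<theta> i) * y i)"
proof (cases "\<exists>i\<in>I. y i = top")
  case True
  then obtain i where i: "i \<in> I" "y i = top" by auto
  then have "ennreal (\<theta> i) * y i = top"
    using \<theta>[of i] by (simp add: ennreal_mult_eq_top_iff ennreal_eq_0_iff)
  then have "(\<Sum>i\<in>I. ennreal (\<theta> i) * y i) = top"
    using i fin by (metis ennreal_sum_eq_top)
  then show ?thesis by simp
next
  case False
  define z where "z i = enn2real (y i)" for i
  have yz: "i \<in> I \<Longrightarrow> y i = ennreal (z i)" for i
    using False by (simp add: z_def less_top)
  have z0: "0 \<le> z i" for i by (simp add: z_def)
  have "(\<Prod>i\<in>I. epowr (y i) (\<theta> i)) = ennreal (\<Prod>i\<in>I. z i powr \<theta> i)"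
    by (simp add: yz z0 prod_ennreal cong: prod.cong)
  also have "\<dots> \<le> ennreal (\<Sum>i\<in>I. \<theta> i * z i)"
    by (intro ennreal_leI weighted_AM_GM assms z0)
  also have "\<dots> = (\<Sum>i\<in>I. ennreal (\<theta> i) * y i)"
    using \<theta> z0 by (simp add: yz ennreal_mult less_imp_le sum_ennreal[symmetric] cong: sum.cong)
  finally show ?thesis .
qed

text \<open>Dividing each factor by its integral reduces the inequality to the pointwise weighted
  arithmetic-geometric mean inequality.\<close>

lemma nn_integral_Holder:
  fixes f :: "'i \<Rightarrow> 'a \<Rightarrow> ennreal" and \<theta> :: "'i \<Rightarrow> real"
  assumes fin: "finite I" and \<theta>: "\<And>i. i \<in> I \<Longrightarrow> 0 < \<theta> i" and sum1: "(\<Sum>i\<in>I. \<theta> i) = 1"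
    and f [measurable]: "\<And>i. i \<in> I \<Longrightarrow> f i \<in> borel_measurable M"
  shows "(\<integral>\<^sup>+x. (\<Prod>i\<in>I. epowr (f i x) (\<theta> i)) \<partial>M) \<le> (\<Prod>i\<in>I. epowr (\<integral>\<^sup>+x. f i x \<partial>M) (\<theta> i))"
proof -
  define A where "A i = (\<integral>\<^sup>+x. f i x \<partial>M)" for i
  consider (zero) i where "i \<in> I" "A i = 0" | (top) i where "i \<in> I" "A i = top" "\<forall>j\<in>I. A j \<noteq> 0"
    | (reg) "\<forall>i\<in>I. A i \<noteq> 0 \<and> A i \<noteq> top" by metis
  then show ?thesis
  proof cases
    case zero
    then have "AE x in M. f i x = 0"
      using nn_integral_0_iff_AE[OF f[OF zero(1)]] by (simp add: A_def)
    then have "AE x in M. (\<Prod>i\<in>I. epowr (f i x) (\<theta> i)) = 0"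
      by eventually_elim (use zero(1) fin in \<open>auto intro!: prod_zero\<close>)
    then have "(\<integral>\<^sup>+x. (\<Prod>i\<in>I. epowr (f i x) (\<theta> i)) \<partial>M) = (\<integral>\<^sup>+x. 0 \<partial>M)"
      by (rule nn_integral_cong_AE)
    then show ?thesis by simp
  next
    case top
    then have "(\<Prod>i\<in>I. epowr (A i) (\<theta> i)) = top"
      by (subst ennreal_prod_eq_top) (use fin in auto)
    then show ?thesis by (simp add: A_def)
  next
    case reg
    define c where "c i = enn2real (A i)" for i
    have Ac: "A i = ennreal (c i)" "0 < c i" if "i \<in> I" for i
      using reg that by (auto simp: c_def less_top enn2real_positive_iff zero_less_iff_neq_zero)
    define h where "h i x = ennreal (1 / c i) * f i x" for i x
    have fh: "f i x = A i * h i x" if "i \<in> I" for i x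
      using Ac[OF that] by (simp add: h_def mult.assoc[symmetric] flip: ennreal_mult)
    have "(\<integral>\<^sup>+x. (\<Prod>i\<in>I. epowr (f i x) (\<theta> i)) \<partial>M)
        = (\<integral>\<^sup>+x. (\<Prod>i\<in>I. epowr (A i) (\<theta> i)) * (\<Prod>i\<in>I. epowr (h i x) (\<theta> i)) \<partial>M)"
      by (simp add: fh epowr_mult prod.distrib cong: prod.cong)
    also have "\<dots> \<le> (\<integral>\<^sup>+x. (\<Prod>i\<in>I. epowr (A i) (\<theta> i)) * (\<Sum>i\<in>I. ennreal (\<theta> i) * h i x) \<partial>M)"
      by (intro nn_integral_mono mult_left_mono weighted_AM_GM_ennreal assms) auto
    also have "\<dots> = (\<Prod>i\<in>I. epowr (A i) (\<theta> i)) * (\<Sum>i\<in>I. ennreal (\<theta> i) * (\<integral>\<^sup>+x. h i x \<partial>M))"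
      unfolding h_def by (simp add: nn_integral_cmult nn_integral_sum cong: sum.cong)
    also have "(\<Sum>i\<in>I. ennreal (\<theta> i) * (\<integral>\<^sup>+x. h i x \<partial>M)) = (\<Sum>i\<in>I. ennreal (\<theta> i))"
    proof (intro sum.cong refl)
      fix i assume i: "i \<in> I"
      have "(\<integral>\<^sup>+x. h i x \<partial>M) = ennreal (1 / c i) * A i"
        unfolding h_def A_def using i by (simp add: nn_integral_cmult)
      also have "\<dots> = 1" using Ac[OF i] by (simp flip: ennreal_mult)
      finally show "ennreal (\<theta> i) * (\<integral>\<^sup>+x. h i x \<partial>M) = ennreal (\<theta> i)" by simp
    qed
    also have "\<dots> = 1" using \<theta> sum1 by (simp add: sum_ennreal less_imp_le)
    finally show ?thesis by (simp add: A_def)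
  qed
qed

section \<open>The Gagliardo inequality\<close>

text \<open>Integration over a set \<open>J\<close> of coordinates is kept as an operator on functions of all
  coordinates, so that partial integrals over different sets can be multiplied and compared.\<close>

definition subst_coords :: "'n set \<Rightarrow> real^'n \<Rightarrow> ('n \<Rightarrow> real) \<Rightarrow> real^'n" where
  "subst_coords J x y = (\<chi> i. if i \<in> J then y i else x $ i)"

definition partial_int :: "'n set \<Rightarrow> (real^'n \<Rightarrow> ennreal) \<Rightarrow> real^'n \<Rightarrow> ennreal" where
  "partial_int J f x = (\<integral>\<^sup>+y. f (subst_coords J x y) \<partial>(\<Pi>\<^sub>M i\<in>J. (lborel::real measure)))"

abbreviation upd :: "real^'n \<Rightarrow> 'n \<Rightarrow> real \<Rightarrow> real^'n" where
  "upd x i t \<equiv> subst_coords {i} x (\<lambda>_. t)"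

interpretation lborel_prod: product_sigma_finite "\<lambda>_::'n::finite. lborel::real measure"
  by (simp add: product_sigma_finite_def sigma_finite_lborel)

lemma borel_measurable_vecI:
  fixes f :: "'a \<Rightarrow> real^'n"
  assumes "\<And>i. (\<lambda>x. f x $ i) \<in> borel_measurable M"
  shows "f \<in> borel_measurable M"
  using assms by (subst borel_measurable_euclidean_space) (auto simp: Basis_vec_def inner_axis)

lemma borel_measurable_vec_nth [measurable]: "(\<lambda>x::real^'n. x $ i) \<in> borel_measurable borel"
  by (intro borel_measurable_continuous_onI continuous_intros)

lemma measurable_subst_coords [measurable]:
  assumes [measurable]: "f \<in> M \<rightarrow>\<^sub>M borel" "g \<in> M \<rightarrow>\<^sub>M (\<Pi>\<^sub>M i\<in>J. (lborel::real measure))"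
  shows "(\<lambda>x. subst_coords J (f x) (g x)) \<in> M \<rightarrow>\<^sub>M (borel :: (real^'n) measure)"
proof (rule borel_measurable_vecI)
  fix i
  show "(\<lambda>x. subst_coords J (f x) (g x) $ i) \<in> borel_measurable M"
  proof (cases "i \<in> J")
    case True
    then have "(\<lambda>x. g x i) \<in> M \<rightarrow>\<^sub>M lborel"
      by (intro measurable_compose[OF assms(2) measurable_component_singleton])
    then show ?thesis using True by (simp add: subst_coords_def)
  next
    case False then show ?thesis by (simp add: subst_coords_def)
  qed
qed

lemma measurable_upd [measurable]:
  assumes [measurable]: "f \<in> M \<rightarrow>\<^sub>M borel" "g \<in> borel_measurable M"
  shows "(\<lambda>x. upd (f x) i (g x)) \<in> M \<rightarrow>\<^sub>M (borel :: (real^'n) measure)"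
  by (rule borel_measurable_vecI) (simp add: subst_coords_def)

lemma measurable_partial_int [measurable]:
  assumes [measurable]: "f \<in> borel_measurable borel"
  shows "partial_int J f \<in> borel_measurable (borel :: (real^'n) measure)"
proof -
  interpret sigma_finite_measure "\<Pi>\<^sub>M i\<in>J. (lborel::real measure)"
    by (rule lborel_prod.sigma_finite) simp
  show ?thesis unfolding partial_int_def[abs_def] by measurable
qed

lemma partial_int_empty [simp]: "partial_int {} f x = f x"
  by (simp add: partial_int_def PiM_empty subst_coords_def emeasure_count_space)

lemma partial_int_insert:
  fixes f :: "real^'n \<Rightarrow> ennreal"
  assumes [measurable]: "f \<in> borel_measurable borel" and j: "j \<notin> J"
  shows "partial_int (insert j J) f x = (\<integral>\<^sup>+t. partial_int J f (upd x j t) \<partial>lborel)"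
proof -
  have eq: "subst_coords (insert j J) x (y(j := t)) = subst_coords J (upd x j t) y" for y t
    using j by (auto simp: subst_coords_def vec_eq_iff)
  have "(\<lambda>y. f (subst_coords (insert j J) x y)) \<in> borel_measurable (Pi\<^sub>M (insert j J) (\<lambda>_. lborel))"
    by measurable
  from lborel_prod.product_nn_integral_insert_rev[OF _ j this] show ?thesis
    by (simp add: partial_int_def eq)
qed

lemma partial_int_indep:
  assumes "j \<in> J" shows "partial_int J f (upd x j t) = partial_int J f x"
proof -
  have "subst_coords J (upd x j t) y = subst_coords J x y" for y
    using assms by (auto simp: subst_coords_def vec_eq_iff)
  then show ?thesis by (simp add: partial_int_def)
qed

lemma partial_int_UNIV:
  fixes f :: "real^'n \<Rightarrow> ennreal"
  assumes [measurable]: "f \<in> borel_measurable borel"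
  shows "partial_int UNIV f x = (\<integral>\<^sup>+y. f y \<partial>lborel)"
proof -
  let ?P = "\<Pi>\<^sub>M i\<in>(UNIV::'n set). (lborel::real measure)"
  have eq: "subst_coords UNIV x y = (\<chi> i. y i)" for y by (simp add: subst_coords_def)
  have m [measurable]: "(\<lambda>y. \<chi> i. y i) \<in> ?P \<rightarrow>\<^sub>M (borel :: (real^'n) measure)"
    using measurable_subst_coords[of "\<lambda>_. x" ?P "\<lambda>y. y" UNIV] by (simp add: eq)
  have "lborel = distr ?P borel (\<lambda>y. \<chi> i. y i)"
  proof (rule lborel_eqI)
    fix l u :: "real^'n" assume le: "\<And>b. b \<in> Basis \<Longrightarrow> l \<bullet> b \<le> u \<bullet> b"
    then have le': "l $ i \<le> u $ i" for i
      using le[of "axis i 1"] by (simp add: inner_axis)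
    have "(\<lambda>y. \<chi> i. y i) -` box l u \<inter> space ?P = Pi\<^sub>E UNIV (\<lambda>i. {l $ i <..< u $ i})"
      by (auto simp: space_PiM mem_box_cart PiE_def Pi_def)
    then have "emeasure (distr ?P borel (\<lambda>y. \<chi> i. y i)) (box l u)
        = (\<Prod>i\<in>UNIV. emeasure lborel {l $ i <..< u $ i})"
      by (simp add: emeasure_distr lborel_prod.emeasure_PiM)
    also have "\<dots> = ennreal (\<Prod>i\<in>UNIV. u $ i - l $ i)"
      using le' by (simp add: prod_ennreal)
    also have "(\<Prod>i\<in>UNIV. u $ i - l $ i) = (\<Prod>b\<in>Basis. (u - l) \<bullet> b)"
      by (simp add: Basis_vec_def prod.UNION_disjoint inner_axis axis_eq_axis)
    finally show "emeasure (distr ?P borel (\<lambda>y. \<chi> i. y i)) (box l u) = (\<Prod>b\<in>Basis. (u - l) \<bullet> b)" .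
  qed simp
  then have "(\<integral>\<^sup>+y. f y \<partial>lborel) = (\<integral>\<^sup>+y. f y \<partial>distr ?P borel (\<lambda>y. \<chi> i. y i))" by simp
  also have "\<dots> = (\<integral>\<^sup>+y. f (\<chi> i. y i) \<partial>?P)" by (simp add: nn_integral_distr)
  finally show ?thesis by (simp add: partial_int_def eq)
qed

text \<open>The variables are integrated out one at a time. When \<open>x\<^sub>j\<close> is integrated, the factor with
  index \<open>j\<close> does not depend on it and the others, one fewer than the dimension, are handled by
  Hoelder's inequality with equal exponents.\<close>

lemma Gagliardo_partial:
  fixes g :: "'n::finite \<Rightarrow> real^'n \<Rightarrow> ennreal"
  assumes N: "CARD('n) > 1" and g [measurable]: "\<And>i. g i \<in> borel_measurable borel"
  defines "\<theta> \<equiv> 1 / (real CARD('n) - 1)"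
  shows "partial_int J (\<lambda>x. \<Prod>i\<in>UNIV. epowr (partial_int {i} (g i) x) \<theta>) x
     \<le> (\<Prod>i\<in>UNIV. epowr (partial_int (insert i J) (g i) x) \<theta>)"
proof -
  have "finite J" by simp
  then show ?thesis
  proof (induction J arbitrary: x rule: finite_induct)
    case empty then show ?case by simp
  next
    case (insert j J)
    have \<theta>: "0 < \<theta>" using N by (simp add: \<theta>_def)
    have sum\<theta>: "(\<Sum>i\<in>UNIV - {j}. \<theta>) = 1"
      using N by (simp add: \<theta>_def card_Diff_singleton of_nat_diff)
    have split: "(\<Prod>i\<in>UNIV. F i) = F j * (\<Prod>i\<in>UNIV - {j}. F i)" for F :: "'n \<Rightarrow> ennreal"
      by (simp add: prod.remove)
    have step: "(\<integral>\<^sup>+t. partial_int (insert i J) (g i) (upd x j t) \<partial>lborel)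
        = partial_int (insert i (insert j J)) (g i) x" if "i \<noteq> j" for i
      using that insert.hyps by (subst partial_int_insert[symmetric]) (auto simp: insert_commute)
    have "partial_int (insert j J) (\<lambda>x. \<Prod>i\<in>UNIV. epowr (partial_int {i} (g i) x) \<theta>) x
        = (\<integral>\<^sup>+t. partial_int J (\<lambda>x. \<Prod>i\<in>UNIV. epowr (partial_int {i} (g i) x) \<theta>) (upd x j t) \<partial>lborel)"
      using insert.hyps by (intro partial_int_insert) auto
    also have "\<dots> \<le> (\<integral>\<^sup>+t. (\<Prod>i\<in>UNIV. epowr (partial_int (insert i J) (g i) (upd x j t)) \<theta>) \<partial>lborel)"
      by (intro nn_integral_mono insert.IH)
    also have "\<dots> = (\<integral>\<^sup>+t. epowr (partial_int (insert j J) (g j) x) \<theta> *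
        (\<Prod>i\<in>UNIV - {j}. epowr (partial_int (insert i J) (g i) (upd x j t)) \<theta>) \<partial>lborel)"
      by (subst split) (simp add: partial_int_indep)
    also have "\<dots> = epowr (partial_int (insert j J) (g j) x) \<theta> *
        (\<integral>\<^sup>+t. (\<Prod>i\<in>UNIV - {j}. epowr (partial_int (insert i J) (g i) (upd x j t)) \<theta>) \<partial>lborel)"
      by (intro nn_integral_cmult) measurable
    also have "\<dots> \<le> epowr (partial_int (insert j J) (g j) x) \<theta> *
        (\<Prod>i\<in>UNIV - {j}. epowr (\<integral>\<^sup>+t. partial_int (insert i J) (g i) (upd x j t) \<partial>lborel) \<theta>)"
      by (intro mult_left_mono nn_integral_Holder \<theta> sum\<theta>) (simp_all, measurable)
    also have "\<dots> = (\<Prod>i\<in>UNIV. epowr (partial_int (insert i (insert j J)) (g i) x) \<theta>)"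
      by (subst split, intro arg_cong2[where f = "(*)"] prod.cong) (simp_all add: step)
    finally show ?case .
  qed
qed

lemma Gagliardo:
  fixes g :: "'n::finite \<Rightarrow> real^'n \<Rightarrow> ennreal"
  assumes N: "CARD('n) > 1" and g [measurable]: "\<And>i. g i \<in> borel_measurable borel"
  defines "\<theta> \<equiv> 1 / (real CARD('n) - 1)"
  shows "(\<integral>\<^sup>+x. (\<Prod>i\<in>UNIV. epowr (\<integral>\<^sup>+t. g i (upd x i t) \<partial>lborel) \<theta>) \<partial>lborel)
    \<le> (\<Prod>i\<in>UNIV. epowr (\<integral>\<^sup>+x. g i x \<partial>lborel) \<theta>)"
proof -
  have eq: "(\<integral>\<^sup>+t. g i (upd x i t) \<partial>lborel) = partial_int {i} (g i) x" for i x
    by (subst partial_int_insert) auto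
  have "partial_int UNIV (\<lambda>x. \<Prod>i\<in>UNIV. epowr (partial_int {i} (g i) x) \<theta>) 0
     \<le> (\<Prod>i\<in>UNIV. epowr (partial_int (insert i UNIV) (g i) 0) \<theta>)"
    unfolding \<theta>_def by (rule Gagliardo_partial[OF N g])
  then show ?thesis
    unfolding eq by (subst (asm) partial_int_UNIV) (simp_all add: partial_int_UNIV)
qed

lemma nn_integral_Holder_two:
  fixes f g :: "'a \<Rightarrow> ennreal"
  assumes "0 < a" "0 < b" "a + b = 1"
    and [measurable]: "f \<in> borel_measurable M" "g \<in> borel_measurable M"
  shows "(\<integral>\<^sup>+x. epowr (f x) a * epowr (g x) b \<partial>M) \<le> epowr (\<integral>\<^sup>+x. f x \<partial>M) a * epowr (\<integral>\<^sup>+x. g x \<partial>M) b"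
  using nn_integral_Holder[of UNIV "\<lambda>c. if c then a else b" "\<lambda>c. if c then f else g" M] assms
  by (simp add: UNIV_bool mult.commute add.commute)

section \<open>Test functions\<close>

lemma partial_deriv_eqI: "(f has_derivative f') (at x) \<Longrightarrow> partial_deriv i f x = f' (axis i 1)"
  unfolding partial_deriv_def by (metis frechet_derivative_at)

lemma Ck_fun_SucD: "Ck_fun (Suc k) f \<Longrightarrow> Ck_fun k f"
proof (induction k arbitrary: f)
  case 0
  then show ?case
    by (auto intro!: continuous_at_imp_continuous_on differentiable_imp_continuous_within)
next
  case (Suc k)
  then show ?case by (metis Ck_fun.simps(2))
qed

lemma test_functionsD:
  assumes "\<phi> \<in> test_functions \<Omega>"
  shows "continuous_on UNIV \<phi>" "continuous_on UNIV (partial_deriv i \<phi>)" "\<phi> differentiable (at x)"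
    "compact (closure {x. \<phi> x \<noteq> 0})" "closure {x. \<phi> x \<noteq> 0} \<subseteq> \<Omega>" "x \<notin> \<Omega> \<Longrightarrow> \<phi> x = 0"
proof -
  have C: "Ck_fun k \<phi>" for k using assms by (auto simp: test_functions_def)
  show "continuous_on UNIV \<phi>" using C[of 0] by simp
  show "continuous_on UNIV (partial_deriv i \<phi>)" using C[of "Suc 0"] by simp
  show "\<phi> differentiable (at x)" using C[of "Suc 0"] by simp
  show "compact (closure {x. \<phi> x \<noteq> 0})" and *: "closure {x. \<phi> x \<noteq> 0} \<subseteq> \<Omega>"
    using assms by (auto simp: test_functions_def)
  show "x \<notin> \<Omega> \<Longrightarrow> \<phi> x = 0" using * closure_subset[of "{x. \<phi> x \<noteq> 0}"] by auto
qed

lemma partial_deriv_outside: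
  assumes "\<phi> \<in> test_functions \<Omega>" "x \<notin> closure {x. \<phi> x \<noteq> 0}"
  shows "partial_deriv i \<phi> x = 0"
proof -
  let ?U = "- closure {x. \<phi> x \<noteq> 0}"
  have 0: "\<phi> y = 0" if "y \<in> ?U" for y
    using that closure_subset[of "{x. \<phi> x \<noteq> 0}"] by auto
  have "((\<lambda>_. 0::real) has_derivative (\<lambda>_. 0)) (at x)" by simp
  moreover have "open ?U" "x \<in> ?U" using assms(2) by auto
  ultimately have "(\<phi> has_derivative (\<lambda>_. 0)) (at x)"
    by (rule has_derivative_transform_within_open) (rule 0[symmetric])
  from partial_deriv_eqI[OF this] show ?thesis by simp
qed

lemma partial_deriv_outside':
  assumes "\<phi> \<in> test_functions \<Omega>" "x \<notin> \<Omega>"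
  shows "partial_deriv i \<phi> x = 0"
  using partial_deriv_outside[OF assms(1)] test_functionsD(5)[OF assms(1)] assms(2) by blast

lemma test_function_measurable:
  assumes "\<phi> \<in> test_functions \<Omega>"
  shows "\<phi> \<in> borel_measurable borel" "partial_deriv i \<phi> \<in> borel_measurable borel"
  using test_functionsD[OF assms] by (auto intro: borel_measurable_continuous_onI)

lemma test_function_bounded:
  fixes \<phi> :: "real^'n::finite \<Rightarrow> real"
  assumes "\<phi> \<in> test_functions \<Omega>"
  obtains C where "C > 0" "\<And>x. \<bar>\<phi> x\<bar> \<le> C" "\<And>x i. \<bar>partial_deriv i \<phi> x\<bar> \<le> C"
proof -
  let ?K = "closure {x. \<phi> x \<noteq> 0}"
  have K: "compact ?K" using test_functionsD(4)[OF assms] .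
  have bd: "bounded (f ` ?K)" if "continuous_on UNIV f" for f :: "real^'n \<Rightarrow> real"
    using K that by (intro compact_imp_bounded compact_continuous_image) (auto intro: continuous_on_subset)
  have B: "\<exists>C>0. \<forall>x\<in>?K. \<bar>f x\<bar> \<le> C" if "continuous_on UNIV f" for f :: "real^'n \<Rightarrow> real"
    using bd[OF that] by (auto simp: bounded_pos)
  obtain C0 where C0: "C0 > 0" "\<forall>x\<in>?K. \<bar>\<phi> x\<bar> \<le> C0"
    using B test_functionsD(1)[OF assms] by blast
  have "\<forall>i. \<exists>C>0. \<forall>x\<in>?K. \<bar>partial_deriv i \<phi> x\<bar> \<le> C"
    using B test_functionsD(2)[OF assms] by blast
  then obtain C1 where C1: "\<And>i. C1 i > 0" "\<And>i x. x \<in> ?K \<Longrightarrow> \<bar>partial_deriv i \<phi> x\<bar> \<le> C1 i"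
    by metis
  let ?C = "C0 + (\<Sum>i\<in>UNIV. C1 i)"
  have C1le: "C1 i \<le> (\<Sum>i\<in>UNIV. C1 i)" for i
    using C1(1) by (intro member_le_sum) (auto intro: less_imp_le)
  have pos: "0 \<le> (\<Sum>i\<in>UNIV. C1 i)" using C1(1) by (intro sum_nonneg) (auto intro: less_imp_le)
  show ?thesis
  proof (rule that[of ?C])
    show "0 < ?C" using C0 pos by linarith
    show "\<bar>\<phi> x\<bar> \<le> ?C" for x
    proof (cases "x \<in> ?K")
      case True then show ?thesis using C0 pos by fastforce
    next
      case False then have "\<phi> x = 0" using closure_subset[of "{x. \<phi> x \<noteq> 0}"] by auto
      then show ?thesis using C0 pos by simp
    qed
    show "\<bar>partial_deriv i \<phi> x\<bar> \<le> ?C" for i x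
    proof (cases "x \<in> ?K")
      case True then show ?thesis using C0 C1(2)[of x i] C1le[of i] by linarith
    next
      case False then show ?thesis using C0 pos partial_deriv_outside[OF assms] by simp
    qed
  qed
qed

lemma test_function_finite_level:
  assumes "\<phi> \<in> test_functions \<Omega>" "0 < b"
  shows "emeasure lborel {x. b \<le> \<bar>\<phi> x\<bar>} < \<infinity>"
proof -
  have "{x. b \<le> \<bar>\<phi> x\<bar>} \<subseteq> closure {x. \<phi> x \<noteq> 0}"
    using assms(2) closure_subset[of "{x. \<phi> x \<noteq> 0}"] by force
  then have "bounded {x. b \<le> \<bar>\<phi> x\<bar>}"
    using test_functionsD(4)[OF assms(1)] bounded_subset compact_imp_bounded by blast
  then show ?thesis by (rule emeasure_bounded_finite)
qed

lemma upd_conv: "upd x i t = x + (t - x $ i) *\<^sub>R axis i 1"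
  by (auto simp: subst_coords_def vec_eq_iff axis_def)

lemma test_function_line_deriv:
  assumes "\<phi> \<in> test_functions \<Omega>"
  shows "((\<lambda>t. \<phi> (upd x i t)) has_real_derivative partial_deriv i \<phi> (upd x i t)) (at t)"
proof -
  let ?D = "frechet_derivative \<phi> (at (upd x i t))"
  have D: "(\<phi> has_derivative ?D) (at (upd x i t))"
    using test_functionsD(3)[OF assms] frechet_derivative_works by blast
  have "((\<lambda>t. upd x i t) has_derivative (\<lambda>h. h *\<^sub>R axis i 1)) (at t)"
    unfolding upd_conv by (auto intro!: derivative_eq_intros)
  from has_derivative_compose[OF this D]
  have "((\<lambda>t. \<phi> (upd x i t)) has_derivative (\<lambda>h. ?D (h *\<^sub>R axis i 1))) (at t)" .
  moreover have "?D (h *\<^sub>R axis i 1) = partial_deriv i \<phi> (upd x i t) * h" for h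
    using linear_scale[OF has_derivative_linear[OF D]] by (simp add: partial_deriv_def)
  ultimately show ?thesis by (simp add: has_field_derivative_def)
qed

section \<open>Level sets of test functions\<close>

text \<open>Between a zero and a point where the value is at least \<open>2 * b\<close>, a function crosses the whole
  slice \<open>b \<le> h < 2 * b\<close>: from the last point with value \<open>b\<close> to the next one with value \<open>2 * b\<close>.\<close>

lemma crossing_aux:
  fixes h h' :: "real \<Rightarrow> real"
  assumes der: "\<And>t. (h has_real_derivative h' t) (at t)" and cont: "continuous_on UNIV h'"
    and b: "0 < b" and a: "a \<le> t0" "h a = 0" and t0: "2 * b \<le> h t0"
  shows "ennreal b \<le> (\<integral>\<^sup>+t. indicator {t. b \<le> \<bar>h t\<bar> \<and> \<bar>h t\<bar> < 2 * b} t * ennreal \<bar>h' t\<bar> \<partial>lborel)"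
proof -
  have ch: "continuous_on UNIV h"
    using der by (intro DERIV_continuous_on) (auto intro: has_field_derivative_at_within)
  have chS: "continuous_on S h" for S using ch continuous_on_subset by blast
  define A where "A = {a..t0} \<inter> h -` {..b}"
  have A: "compact A" unfolding A_def compact_eq_bounded_closed
    using ch by (auto intro: continuous_closed_vimage continuous_on_closed_vimage
        simp: bounded_Int closed_Int continuous_on_eq_continuous_at)
  have "a \<in> A" using a b by (auto simp: A_def)
  with A obtain t1 where t1: "t1 \<in> A" "\<And>t. t \<in> A \<Longrightarrow> t \<le> t1"
    using compact_attains_sup[of A] by blast
  define B where "B = {t1..t0} \<inter> h -` {2 * b..}"
  have B: "compact B" unfolding B_def compact_eq_bounded_closed
    using ch by (auto intro: continuous_closed_vimage
        simp: bounded_Int closed_Int continuous_on_eq_continuous_at)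
  have "t0 \<in> B" using t1 t0 by (auto simp: A_def B_def)
  with B obtain t2 where t2: "t2 \<in> B" "\<And>t. t \<in> B \<Longrightarrow> t2 \<le> t"
    using compact_attains_inf[of B] by blast
  have le: "t1 \<le> t2" "t2 \<le> t0" "a \<le> t1" using t1 t2 by (auto simp: A_def B_def)
  have h12: "h t1 \<le> b" "2 * b \<le> h t2" using t1 t2 by (auto simp: A_def B_def)
  have mid: "b \<le> \<bar>h t\<bar> \<and> \<bar>h t\<bar> < 2 * b" if "t1 < t" "t < t2" for t
  proof -
    have "t \<notin> A" "t \<notin> B" using t1(2)[of t] t2(2)[of t] that by auto
    then show ?thesis using that le b by (auto simp: A_def B_def)
  qed
  have int: "has_bochner_integral lborel (\<lambda>t. h' t * indicator {t1..t2} t) (h t2 - h t1)"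
    using der cont le
    by (intro has_bochner_integral_FTC_Icc_real) (auto simp: continuous_on_eq_continuous_at)
  have "ennreal b \<le> ennreal (norm (h t2 - h t1))" using h12 b by (intro ennreal_leI) auto
  also have "\<dots> \<le> (\<integral>\<^sup>+t. norm (h' t * indicator {t1..t2} t) \<partial>lborel)"
    using int integral_norm_bound_ennreal[of lborel "\<lambda>t. h' t * indicator {t1..t2} t"]
    by (simp add: has_bochner_integral_iff)
  also have "\<dots> \<le> (\<integral>\<^sup>+t. indicator {t. b \<le> \<bar>h t\<bar> \<and> \<bar>h t\<bar> < 2 * b} t * ennreal \<bar>h' t\<bar> \<partial>lborel)"
  proof (rule nn_integral_mono_AE)
    have "AE t in lborel. t \<noteq> t1" "AE t in lborel. t \<noteq> t2" by (rule AE_lborel_singleton)+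
    then show "AE t in lborel. ennreal (norm (h' t * indicator {t1..t2} t))
        \<le> indicator {t. b \<le> \<bar>h t\<bar> \<and> \<bar>h t\<bar> < 2 * b} t * ennreal \<bar>h' t\<bar>"
    proof eventually_elim
      case (elim t)
      then show ?case using mid[of t] by (cases "t \<in> {t1..t2}") (auto simp: indicator_def)
    qed
  qed
  finally show ?thesis .
qed

lemma crossing:
  fixes h h' :: "real \<Rightarrow> real"
  assumes der: "\<And>t. (h has_real_derivative h' t) (at t)" and cont: "continuous_on UNIV h'"
    and b: "0 < b" and a: "a \<le> t0" "h a = 0" and t0: "2 * b \<le> \<bar>h t0\<bar>"
  shows "ennreal b \<le> (\<integral>\<^sup>+t. indicator {t. b \<le> \<bar>h t\<bar> \<and> \<bar>h t\<bar> < 2 * b} t * ennreal \<bar>h' t\<bar> \<partial>lborel)"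
proof (cases "0 \<le> h t0")
  case True
  then show ?thesis using crossing_aux[OF der cont b a] t0 by auto
next
  case False
  have "((\<lambda>t. - h t) has_real_derivative - h' t) (at t)" for t
    using der by (auto intro: derivative_eq_intros)
  from crossing_aux[OF this _ b a(1)] show ?thesis
    using False t0 a cont by (auto intro: continuous_on_minus)
qed

lemma test_function_line_zero:
  assumes "\<phi> \<in> test_functions \<Omega>"
  obtains a where "a \<le> t" "\<phi> (upd x i a) = 0"
proof -
  have "bounded {x. \<phi> x \<noteq> 0}"
    using test_functionsD(4)[OF assms] by (meson bounded_subset closure_subset compact_imp_bounded)
  then obtain R where R: "\<And>y. \<phi> y \<noteq> 0 \<Longrightarrow> norm y \<le> R" by (auto simp: bounded_iff)
  define a where "a = min t (- \<bar>R\<bar> - 1)"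
  have "\<bar>upd x i a $ i\<bar> \<le> norm (upd x i a)" by (rule component_le_norm_cart)
  moreover have "upd x i a $ i = a" by (simp add: subst_coords_def)
  moreover have "a \<le> - \<bar>R\<bar> - 1" by (simp add: a_def)
  ultimately have "\<not> norm (upd x i a) \<le> R" by linarith
  then show ?thesis using R[of "upd x i a"] that[of a] by (auto simp: a_def)
qed

text \<open>On every axis-parallel line through a point of the upper level set, the derivative in that
  direction has integral at least \<open>b\<close> over the slice, so each factor in Gagliardo's inequality is at
  least \<open>b powr \<theta>\<close> there.\<close>

lemma Gagliardo_level:
  fixes \<phi> :: "real^'n::finite \<Rightarrow> real"
  assumes N: "CARD('n) > 1" and \<phi>: "\<phi> \<in> test_functions \<Omega>" and b: "0 < b"
  defines "S \<equiv> {x. b \<le> \<bar>\<phi> x\<bar> \<and> \<bar>\<phi> x\<bar> < 2 * b}"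
  defines "\<theta> \<equiv> 1 / (real CARD('n) - 1)"
  shows "ennreal (b powr (real CARD('n) * \<theta>)) * emeasure lborel {x. 2 * b \<le> \<bar>\<phi> x\<bar>}
     \<le> (\<Prod>i\<in>UNIV. epowr (\<integral>\<^sup>+x. indicator S x * ennreal \<bar>partial_deriv i \<phi> x\<bar> \<partial>lborel) \<theta>)"
proof -
  note [measurable] = test_function_measurable[OF \<phi>]
  define g where "g i x = indicator S x * ennreal \<bar>partial_deriv i \<phi> x\<bar>" for i x
  have [measurable]: "S \<in> sets borel" unfolding S_def by measurable
  have g [measurable]: "g i \<in> borel_measurable borel" for i unfolding g_def by measurable
  have \<theta>: "0 \<le> \<theta>" using N by (simp add: \<theta>_def)
  have line: "ennreal b \<le> (\<integral>\<^sup>+t. g i (upd x i t) \<partial>lborel)" if x: "2 * b \<le> \<bar>\<phi> x\<bar>" for i x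
  proof -
    obtain a where a: "a \<le> x $ i" "\<phi> (upd x i a) = 0" using test_function_line_zero[OF \<phi>] .
    have self: "upd x i (x $ i) = x" by (simp add: upd_conv)
    have "continuous_on UNIV (\<lambda>t. partial_deriv i \<phi> (upd x i t))"
      unfolding upd_conv using test_functionsD(2)[OF \<phi>]
      by (rule continuous_on_compose2) (auto intro!: continuous_intros)
    from crossing[OF test_function_line_deriv[OF \<phi>] this b a]
    show ?thesis using x by (simp add: self g_def S_def indicator_def cong: if_cong)
  qed
  have "ennreal (b powr (real CARD('n) * \<theta>)) * emeasure lborel {x. 2 * b \<le> \<bar>\<phi> x\<bar>}
      = (\<integral>\<^sup>+x. ennreal (b powr (real CARD('n) * \<theta>)) * indicator {x. 2 * b \<le> \<bar>\<phi> x\<bar>} x \<partial>lborel)"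
    by (simp add: nn_integral_cmult)
  also have "\<dots> \<le> (\<integral>\<^sup>+x. (\<Prod>i\<in>UNIV. epowr (\<integral>\<^sup>+t. g i (upd x i t) \<partial>lborel) \<theta>) \<partial>lborel)"
  proof (rule nn_integral_mono)
    fix x
    show "ennreal (b powr (real CARD('n) * \<theta>)) * indicator {x. 2 * b \<le> \<bar>\<phi> x\<bar>} x
        \<le> (\<Prod>i\<in>UNIV. epowr (\<integral>\<^sup>+t. g i (upd x i t) \<partial>lborel) \<theta>)"
    proof (cases "2 * b \<le> \<bar>\<phi> x\<bar>")
      case True
      have "ennreal (b powr (real CARD('n) * \<theta>)) = (\<Prod>i\<in>(UNIV::'n set). epowr (ennreal b) \<theta>)"
        using b by (simp add: ennreal_power powr_powr[symmetric] mult.commute[of "real _"] powr_realpow)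
      also have "\<dots> \<le> (\<Prod>i\<in>UNIV. epowr (\<integral>\<^sup>+t. g i (upd x i t) \<partial>lborel) \<theta>)"
        by (intro prod_mono_ennreal epowr_mono \<theta> line True)
      finally show ?thesis using True by simp
    qed auto
  qed
  also have "\<dots> \<le> (\<Prod>i\<in>UNIV. epowr (\<integral>\<^sup>+x. g i x \<partial>lborel) \<theta>)"
    unfolding \<theta>_def by (rule Gagliardo[OF N g])
  finally show ?thesis by (simp add: g_def)
qed

section \<open>The weighted Hardy-Sobolev inequality\<close>

lemma harmonic_mean_pos:
  fixes p :: "'n::finite \<Rightarrow> real"
  assumes "\<And>i. 1 < p i"
  shows "0 < harmonic_mean p" "(\<Sum>i\<in>UNIV. 1 / p i) = real CARD('n) / harmonic_mean p"
proof -
  have "0 < 1 / p i" for i using assms[of i] by simp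
  then have "0 < (\<Sum>i\<in>UNIV. 1 / p i)" by (intro sum_pos) auto
  then show "0 < harmonic_mean p" "(\<Sum>i\<in>UNIV. 1 / p i) = real CARD('n) / harmonic_mean p"
    by (simp_all add: harmonic_mean_def)
qed

lemma integrable_bounded_support:
  fixes f :: "'a \<Rightarrow> real"
  assumes "f \<in> borel_measurable M" "\<And>x. \<bar>f x\<bar> \<le> C" "A \<in> sets M" "emeasure M A < \<infinity>"
    "\<And>x. x \<notin> A \<Longrightarrow> f x = 0"
  shows "integrable M f"
proof -
  have "integrable M (\<lambda>x. indicator A x *\<^sub>R f x)"
    using assms by (intro integrableI_bounded_set_indicator[where B = C]) auto
  moreover have "(\<lambda>x. indicator A x *\<^sub>R f x) = f"
    using assms(5) by (auto simp: fun_eq_iff indicator_def)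
  ultimately show ?thesis by simp
qed

text \<open>Hoelder's inequality on the slice brings in the exponents \<open>p i\<close> at the price of powers of the
  measure of the lower level set, which add up to \<open>q - 1\<close>.\<close>

lemma dyadic_level:
  fixes \<phi> :: "real^'n::finite \<Rightarrow> real" and p :: "'n \<Rightarrow> real"
  assumes N: "CARD('n) > 1" and p: "\<And>i. 1 < p i" and \<phi>: "\<phi> \<in> test_functions \<Omega>" and b: "0 < b"
  defines "S \<equiv> {x. b \<le> \<bar>\<phi> x\<bar> \<and> \<bar>\<phi> x\<bar> < 2 * b}" and "q \<equiv> harmonic_mean p"
  shows "b powr q * measure lborel {x. 2 * b \<le> \<bar>\<phi> x\<bar>} powr (q - q / real CARD('n))
     \<le> (\<Sum>i\<in>UNIV. \<integral>x. indicator S x * \<bar>partial_deriv i \<phi> x\<bar> powr p i \<partial>lborel)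
       * measure lborel {x. b \<le> \<bar>\<phi> x\<bar>} powr (q - 1)"
proof -
  note [measurable] = test_function_measurable[OF \<phi>]
  define n where "n = real CARD('n)"
  have n: "1 < n" using N by (simp add: n_def)
  have q: "0 < q" "(\<Sum>i\<in>UNIV. 1 / p i) = n / q"
    using harmonic_mean_pos[of p] p by (simp_all add: q_def n_def)
  have [measurable]: "S \<in> sets borel" unfolding S_def by measurable
  define a where "a = measure lborel {x. b \<le> \<bar>\<phi> x\<bar>}"
  define a' where "a' = measure lborel {x. 2 * b \<le> \<bar>\<phi> x\<bar>}"
  define D where "D i = (\<integral>x. indicator S x * \<bar>partial_deriv i \<phi> x\<bar> powr p i \<partial>lborel)" for i
  have a: "emeasure lborel {x. b \<le> \<bar>\<phi> x\<bar>} = ennreal a"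
    using test_function_finite_level[OF \<phi> b] by (simp add: a_def emeasure_eq_ennreal_measure less_top)
  have a': "emeasure lborel {x. 2 * b \<le> \<bar>\<phi> x\<bar>} = ennreal a'"
    using test_function_finite_level[OF \<phi>, of "2 * b"] b
    by (simp add: a'_def emeasure_eq_ennreal_measure less_top)
  have S: "emeasure lborel S \<le> ennreal a"
    unfolding a[symmetric] S_def by (intro emeasure_mono) auto
  then have Sfin: "emeasure lborel S < \<infinity>" by (auto simp: le_less_trans)
  have a0: "0 \<le> a" "0 \<le> a'" by (simp_all add: a_def a'_def)
  have D0: "0 \<le> D i" for i unfolding D_def by (intro integral_nonneg_AE) auto
  obtain C where C: "C > 0" "\<And>x. \<bar>\<phi> x\<bar> \<le> C" "\<And>x i. \<bar>partial_deriv i \<phi> x\<bar> \<le> C"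
    using test_function_bounded[OF \<phi>] by metis
  have intD: "integrable lborel (\<lambda>x. indicator S x * \<bar>partial_deriv i \<phi> x\<bar> powr p i)" for i
  proof (rule integrable_bounded_support[where A = S and C = "C powr p i"])
    show "\<bar>indicator S x * \<bar>partial_deriv i \<phi> x\<bar> powr p i\<bar> \<le> C powr p i" for x
      using C p[of i] by (auto simp: indicator_def intro!: powr_mono2)
  qed (use Sfin in auto)
  have nnD: "(\<integral>\<^sup>+x. ennreal (indicator S x * \<bar>partial_deriv i \<phi> x\<bar> powr p i) \<partial>lborel) = ennreal (D i)" for i
    unfolding D_def by (intro nn_integral_eq_integral intD) auto
  have I: "(\<integral>\<^sup>+x. indicator S x * ennreal \<bar>partial_deriv i \<phi> x\<bar> \<partial>lborel)
      \<le> ennreal (D i powr (1 / p i) * a powr (1 - 1 / p i))" for i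
  proof -
    have pi: "0 < 1 / p i" "0 < 1 - 1 / p i" using p[of i] by (auto simp: field_simps)
    have "(\<integral>\<^sup>+x. indicator S x * ennreal \<bar>partial_deriv i \<phi> x\<bar> \<partial>lborel)
       = (\<integral>\<^sup>+x. epowr (ennreal (indicator S x * \<bar>partial_deriv i \<phi> x\<bar> powr p i)) (1 / p i) *
            epowr (indicator S x) (1 - 1 / p i) \<partial>lborel)"
      using p[of i] by (intro nn_integral_cong) (auto simp: indicator_def powr_powr epowr_1)
    also have "\<dots> \<le> epowr (ennreal (D i)) (1 / p i) * epowr (\<integral>\<^sup>+x. indicator S x \<partial>lborel) (1 - 1 / p i)"
      unfolding nnD[symmetric] using pi by (intro nn_integral_Holder_two) auto
    also have "\<dots> \<le> epowr (ennreal (D i)) (1 / p i) * epowr (ennreal a) (1 - 1 / p i)"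
      using S pi by (intro mult_left_mono epowr_mono) auto
    also have "\<dots> = ennreal (D i powr (1 / p i) * a powr (1 - 1 / p i))"
      using D0 a0 by (simp add: ennreal_mult)
    finally show ?thesis .
  qed
  define \<theta> where "\<theta> = 1 / (n - 1)"
  have \<theta>: "0 < \<theta>" using n by (simp add: \<theta>_def)
  define F where "F i = D i powr (1 / p i) * a powr (1 - 1 / p i)" for i
  have F0: "0 \<le> F i" for i by (simp add: F_def)
  have "ennreal (b powr (n * \<theta>) * a') = ennreal (b powr (n * \<theta>)) * emeasure lborel {x. 2 * b \<le> \<bar>\<phi> x\<bar>}"
    using a0 by (simp add: a' ennreal_mult)
  also have "\<dots> \<le> (\<Prod>i\<in>UNIV. epowr (\<integral>\<^sup>+x. indicator S x * ennreal \<bar>partial_deriv i \<phi> x\<bar> \<partial>lborel) \<theta>)"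
    unfolding S_def n_def \<theta>_def by (rule Gagliardo_level[OF N \<phi> b])
  also have "\<dots> \<le> (\<Prod>i\<in>UNIV. epowr (ennreal (F i)) \<theta>)"
    using \<theta> unfolding F_def by (intro prod_mono_ennreal epowr_mono I) auto
  also have "\<dots> = ennreal (\<Prod>i\<in>UNIV. F i powr \<theta>)"
    using F0 by (simp add: prod_ennreal)
  finally have "b powr (n * \<theta>) * a' \<le> (\<Prod>i\<in>UNIV. F i powr \<theta>)"
    by (subst (asm) ennreal_le_iff) (auto intro: prod_nonneg)
  then have "(b powr (n * \<theta>) * a') powr ((n - 1) * q / n) \<le> (\<Prod>i\<in>UNIV. F i powr \<theta>) powr ((n - 1) * q / n)"
    using n q a0 by (intro powr_mono2) auto
  also have "(b powr (n * \<theta>) * a') powr ((n - 1) * q / n) = b powr q * a' powr (q - q / n)"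
  proof -
    have "n * \<theta> * ((n - 1) * q / n) = q" "(n - 1) * q / n = q - q / n"
      using n by (simp_all add: \<theta>_def field_simps)
    then show ?thesis using a0 by (simp only: powr_mult powr_powr)
  qed
  also have "(\<Prod>i\<in>UNIV. F i powr \<theta>) powr ((n - 1) * q / n) = (\<Prod>i\<in>UNIV. F i powr (q / n))"
    using n F0 by (simp add: prod_powr_distrib[symmetric] powr_powr \<theta>_def)
  also have "\<dots> = (\<Prod>i\<in>UNIV. D i powr (q / (n * p i))) * (\<Prod>i\<in>UNIV. a powr ((1 - 1 / p i) * q / n))"
    using D0 a0 by (simp add: F_def powr_mult powr_powr prod.distrib mult.commute)
  also have "(\<Prod>i\<in>UNIV. a powr ((1 - 1 / p i) * q / n)) = a powr (q - 1)"
  proof -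
    have "(\<Sum>i\<in>UNIV. (1 - 1 / p i) * q / n) = (\<Sum>i\<in>(UNIV::'n set). (1 - 1 / p i)) * q / n"
      by (simp add: sum_distrib_right sum_divide_distrib)
    also have "\<dots> = (n - n / q) * q / n"
      by (simp add: sum_subtractf q(2) n_def)
    also have "\<dots> = q - 1" using n q by (simp add: field_simps)
    finally have eq: "(\<Sum>i\<in>UNIV. (1 - 1 / p i) * q / n) = q - 1" .
    show ?thesis
    proof (cases "a = 0")
      case True then show ?thesis by simp
    next
      case False then show ?thesis by (simp add: powr_sum[symmetric] eq)
    qed
  qed
  also have "(\<Prod>i\<in>UNIV. D i powr (q / (n * p i))) * a powr (q - 1) \<le> (\<Sum>i\<in>UNIV. D i) * a powr (q - 1)"
  proof (rule mult_right_mono)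
    have w: "0 < q / (n * p i)" for i using p[of i] n q by simp
    have s: "(\<Sum>i\<in>UNIV. q / (n * p i)) = 1"
    proof -
      have "(\<Sum>i\<in>UNIV. q / (n * p i)) = q / n * (\<Sum>i\<in>UNIV. 1 / p i)"
        by (simp add: sum_distrib_left)
      then show ?thesis using n q by simp
    qed
    have w1: "q / (n * p i) \<le> 1" for i
      unfolding s[symmetric] using w by (intro member_le_sum) (auto intro: less_imp_le)
    have "(\<Prod>i\<in>UNIV. D i powr (q / (n * p i))) \<le> (\<Sum>i\<in>UNIV. q / (n * p i) * D i)"
      by (intro weighted_AM_GM w s D0) auto
    also have "\<dots> \<le> (\<Sum>i\<in>UNIV. 1 * D i)"
      by (intro sum_mono mult_right_mono w1 D0)
    finally show "(\<Prod>i\<in>UNIV. D i powr (q / (n * p i))) \<le> (\<Sum>i\<in>UNIV. D i)" by simp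
  qed simp
  finally show ?thesis by (simp add: a_def a'_def D_def n_def)
qed

text \<open>If the measure does not drop by the factor \<open>\<tau>\<close>, the lower level set can be replaced by the upper
  one, and the powers combine to the exponent of the critical Sobolev embedding.\<close>

lemma dyadic_alternative:
  fixes \<phi> :: "real^'n::finite \<Rightarrow> real" and p :: "'n \<Rightarrow> real"
  assumes N: "CARD('n) > 1" and p: "\<And>i. 1 < p i" and \<phi>: "\<phi> \<in> test_functions \<Omega>" and b: "0 < b"
    and \<tau>: "0 < \<tau>"
  defines "S \<equiv> {x. b \<le> \<bar>\<phi> x\<bar> \<and> \<bar>\<phi> x\<bar> < 2 * b}" and "q \<equiv> harmonic_mean p"
  assumes q: "1 < q"
  defines "a \<equiv> measure lborel {x. b \<le> \<bar>\<phi> x\<bar>}" and "a' \<equiv> measure lborel {x. 2 * b \<le> \<bar>\<phi> x\<bar>}"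
  shows "a' < \<tau> * a \<or> b powr q * a' powr (1 - q / real CARD('n))
     \<le> \<tau> powr (1 - q) * (\<Sum>i\<in>UNIV. \<integral>x. indicator S x * \<bar>partial_deriv i \<phi> x\<bar> powr p i \<partial>lborel)"
    (is "_ \<or> _ \<le> _ * ?D")
proof -
  have D0: "0 \<le> ?D" by (intro sum_nonneg integral_nonneg_AE) auto
  have main: "b powr q * a' powr (q - q / real CARD('n)) \<le> ?D * a powr (q - 1)"
    unfolding S_def q_def a_def a'_def by (rule dyadic_level[OF N p \<phi> b])
  have a: "0 \<le> a" "0 \<le> a'" by (simp_all add: a_def a'_def)
  consider "a' < \<tau> * a" | "a' = 0" | "\<tau> * a \<le> a'" "0 < a'" using a by linarith
  then show ?thesis
  proof cases
    case 2 then show ?thesis using D0 by simp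
  next
    case 3
    have "a powr (q - 1) \<le> (a' / \<tau>) powr (q - 1)"
      using 3 \<tau> a q by (intro powr_mono2) (auto simp: field_simps)
    also have "\<dots> = a' powr (q - 1) * \<tau> powr (1 - q)"
      using 3 \<tau> by (simp add: powr_divide powr_diff)
    finally have "?D * a powr (q - 1) \<le> ?D * (a' powr (q - 1) * \<tau> powr (1 - q))"
      by (intro mult_left_mono D0)
    with main have "b powr q * a' powr (q - q / real CARD('n)) \<le> ?D * (a' powr (q - 1) * \<tau> powr (1 - q))"
      by linarith
    also have "b powr q * a' powr (q - q / real CARD('n))
        = b powr q * a' powr (1 - q / real CARD('n)) * a' powr (q - 1)"
      by (simp add: powr_add[symmetric])
    finally show ?thesis using 3 by (simp add: mult.commute mult.left_commute)
  qed auto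
qed

text \<open>A smooth weight that increases to \<open>(1 + t\<^sup>2) powr (\<gamma> / 2)\<close> as \<open>\<epsilon>\<close> decreases to 0. For \<open>\<epsilon> > 0\<close> it is
  bounded, which makes all integrals finite from the start; the doubling property \<open>wt_double\<close> holds uniformly in \<open>\<epsilon>\<close>.\<close>

definition wt :: "real \<Rightarrow> real \<Rightarrow> real \<Rightarrow> real" where
  "wt \<gamma> \<epsilon> t = ((1 + t\<^sup>2) / (1 + \<epsilon> * t\<^sup>2)) powr (\<gamma> / 2)"

lemma wt_base:
  fixes \<epsilon> t :: real
  assumes "0 < \<epsilon>" "\<epsilon> \<le> 1"
  shows "0 < 1 + \<epsilon> * t\<^sup>2" "1 \<le> (1 + t\<^sup>2) / (1 + \<epsilon> * t\<^sup>2)" "(1 + t\<^sup>2) / (1 + \<epsilon> * t\<^sup>2) \<le> 1 / \<epsilon>"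
    "(1 + t\<^sup>2) / (1 + \<epsilon> * t\<^sup>2) \<le> 1 + t\<^sup>2"
proof -
  show pos: "0 < 1 + \<epsilon> * t\<^sup>2" using assms by (intro add_pos_nonneg mult_nonneg_nonneg) auto
  have "\<epsilon> * t\<^sup>2 \<le> 1 * t\<^sup>2" using assms by (intro mult_right_mono) auto
  then show "1 \<le> (1 + t\<^sup>2) / (1 + \<epsilon> * t\<^sup>2)" using pos by (simp add: field_simps)
  show "(1 + t\<^sup>2) / (1 + \<epsilon> * t\<^sup>2) \<le> 1 / \<epsilon>" using assms pos by (simp add: field_simps)
  show "(1 + t\<^sup>2) / (1 + \<epsilon> * t\<^sup>2) \<le> 1 + t\<^sup>2"
    using pos assms by (simp add: divide_le_eq algebra_simps)
qed

context
  fixes \<gamma> \<epsilon> :: real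
  assumes \<gamma>: "0 \<le> \<gamma>" and \<epsilon>: "0 < \<epsilon>" "\<epsilon> \<le> 1"
begin

lemma wt_ge_1: "1 \<le> wt \<gamma> \<epsilon> t"
  using wt_base(2)[OF \<epsilon>, of t] \<gamma> by (simp add: wt_def ge_one_powr_ge_zero)

lemma wt_pos: "0 < wt \<gamma> \<epsilon> t" "0 \<le> wt \<gamma> \<epsilon> t"
  using wt_ge_1[of t] by simp_all

lemma wt_le: "wt \<gamma> \<epsilon> t \<le> (1 / \<epsilon>) powr (\<gamma> / 2)"
  unfolding wt_def using wt_base[OF \<epsilon>, of t] \<gamma> by (intro powr_mono2) auto

lemma wt_mono:
  assumes "\<bar>s\<bar> \<le> \<bar>t\<bar>" shows "wt \<gamma> \<epsilon> s \<le> wt \<gamma> \<epsilon> t"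
proof -
  have st: "s\<^sup>2 \<le> t\<^sup>2" using assms by (simp add: abs_le_square_iff)
  have "(1 - \<epsilon>) * s\<^sup>2 \<le> (1 - \<epsilon>) * t\<^sup>2" using st \<epsilon> by (intro mult_left_mono) auto
  then have "(1 + s\<^sup>2) / (1 + \<epsilon> * s\<^sup>2) \<le> (1 + t\<^sup>2) / (1 + \<epsilon> * t\<^sup>2)"
    using wt_base(1)[OF \<epsilon>, of s] wt_base(1)[OF \<epsilon>, of t] by (simp add: field_simps)
  then show ?thesis unfolding wt_def using wt_base(2)[OF \<epsilon>, of s] \<gamma> by (intro powr_mono2) auto
qed

lemma wt_double: "wt \<gamma> \<epsilon> (2 * t) \<le> 2 powr \<gamma> * wt \<gamma> \<epsilon> t"
proof -
  let ?z = "(1 + t\<^sup>2) / (1 + \<epsilon> * t\<^sup>2)"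
  have "(1 + (2 * t)\<^sup>2) / (1 + \<epsilon> * (2 * t)\<^sup>2) \<le> (4 * (1 + t\<^sup>2)) / (1 + \<epsilon> * t\<^sup>2)"
    using \<epsilon> wt_base(1)[OF \<epsilon>, of t] by (intro frac_le) (auto simp: power2_eq_square)
  then have "wt \<gamma> \<epsilon> (2 * t) \<le> (4 * ?z) powr (\<gamma> / 2)"
    unfolding wt_def using \<gamma> wt_base(2)[OF \<epsilon>, of "2 * t"] by (intro powr_mono2) auto
  also have "\<dots> = 4 powr (\<gamma> / 2) * ?z powr (\<gamma> / 2)"
    using wt_base(2)[OF \<epsilon>, of t] by (intro powr_mult)
  also have "(4::real) powr (\<gamma> / 2) = 2 powr \<gamma>"
    using powr_powr[of 2 2 "\<gamma> / 2"] by simp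
  finally show ?thesis by (simp add: wt_def)
qed

lemma wt_small: "\<bar>t\<bar> \<le> 1 \<Longrightarrow> wt \<gamma> \<epsilon> t \<le> 2 powr (\<gamma> / 2)"
proof -
  assume "\<bar>t\<bar> \<le> 1"
  then have "t\<^sup>2 \<le> 1" by (simp add: abs_square_le_1)
  then show ?thesis unfolding wt_def using wt_base(2,4)[OF \<epsilon>, of t] \<gamma> by (intro powr_mono2) auto
qed

lemma wt_continuous: "continuous_on UNIV (wt \<gamma> \<epsilon>)"
proof -
  have "1 + \<epsilon> * t\<^sup>2 \<noteq> 0" "(1 + t\<^sup>2) / (1 + \<epsilon> * t\<^sup>2) \<noteq> 0" for t
    using wt_base(1,2)[OF \<epsilon>, of t] by auto
  then show ?thesis unfolding wt_def[abs_def] by (intro continuous_intros) auto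
qed

lemma wt_measurable [measurable]:
  "f \<in> borel_measurable M \<Longrightarrow> (\<lambda>x. wt \<gamma> \<epsilon> (f x)) \<in> borel_measurable M"
  using borel_measurable_continuous_onI[OF wt_continuous] by (rule measurable_compose[rotated])

end

abbreviation energy where
  "energy p \<Omega> \<gamma> \<epsilon> u Du \<equiv> (\<Sum>i\<in>UNIV. \<integral>x. wt \<gamma> \<epsilon> (u x) * \<bar>Du x $ i\<bar> powr p i \<partial>lebesgue_on \<Omega>)"

abbreviation test_energy where
  "test_energy p \<Omega> \<gamma> \<epsilon> \<phi> \<equiv> (\<Sum>i\<in>UNIV. \<integral>x. wt \<gamma> \<epsilon> (\<phi> x) * \<bar>partial_deriv i \<phi> x\<bar> powr p i \<partial>lebesgue_on \<Omega>)"

lemma dyadic_ex: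
  fixes v :: real
  assumes "1 \<le> v" "v < 2 ^ K"
  shows "\<exists>k<K. 2 ^ k \<le> v \<and> v < 2 ^ Suc k"
  using assms by (induction K) (auto simp: not_less, metis less_Suc_eq not_le)

lemma recursive_sum_bound:
  fixes x y :: "nat \<Rightarrow> real"
  assumes "\<And>k. 0 \<le> x k" "\<And>k. x (Suc k) \<le> x k / 2 + y k"
  shows "(\<Sum>k<K. x k) \<le> 2 * x 0 + 2 * (\<Sum>k<K. y k)"
proof -
  have "(\<Sum>k<K. x k) \<le> (\<Sum>k<Suc K. x k)" using assms(1) by simp
  also have "\<dots> = x 0 + (\<Sum>k<K. x (Suc k))" by (rule sum.lessThan_Suc_shift)
  also have "\<dots> \<le> x 0 + (\<Sum>k<K. x k / 2 + y k)" by (intro add_left_mono sum_mono assms)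
  also have "\<dots> = x 0 + (\<Sum>k<K. x k) / 2 + (\<Sum>k<K. y k)"
    by (simp add: sum.distrib sum_divide_distrib)
  finally show ?thesis by linarith
qed


text \<open>The weights for which the lower order terms can be absorbed. For \<open>\<theta> = 1 - q / N\<close> the bound
  on the integrals over arbitrary sets is the Marcinkiewicz condition with exponent \<open>N / q\<close>.\<close>

definition Morrey_weight ::
    "(real^'n::finite) set \<Rightarrow> real \<Rightarrow> real \<Rightarrow> (real^'n \<Rightarrow> ennreal) \<Rightarrow> bool" where
  "Morrey_weight \<Omega> \<theta> \<kappa> V \<longleftrightarrow> 0 \<le> \<kappa> \<and> V \<in> borel_measurable (lebesgue_on \<Omega>) \<and>
     (\<forall>E\<in>sets lebesgue. E \<subseteq> \<Omega> \<longrightarrow>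
        (\<integral>\<^sup>+x. V x * indicator E x \<partial>lebesgue_on \<Omega>) \<le> ennreal (\<kappa> * measure lebesgue E powr \<theta>))"

lemma borel_measurable_lebesgue_onI:
  "f \<in> borel_measurable borel \<Longrightarrow> f \<in> borel_measurable (lebesgue_on \<Omega>)"
  by (intro measurable_restrict_space1 measurable_completion) simp

lemma lebesgue_on_integral_eq:
  fixes f :: "'a::euclidean_space \<Rightarrow> real"
  assumes f: "f \<in> borel_measurable borel" and \<Omega>: "\<Omega> \<in> sets lebesgue" and 0: "\<And>x. x \<notin> \<Omega> \<Longrightarrow> f x = 0"
  shows "(\<integral>x. f x \<partial>lebesgue_on \<Omega>) = (\<integral>x. f x \<partial>lborel)"
    "integrable (lebesgue_on \<Omega>) f \<longleftrightarrow> integrable lborel f"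
proof -
  have eq: "(\<lambda>x. indicator \<Omega> x *\<^sub>R f x) = f" using 0 by (auto simp: indicator_def fun_eq_iff)
  have \<Omega>': "\<Omega> \<inter> space lebesgue \<in> sets lebesgue" using \<Omega> by simp
  show "(\<integral>x. f x \<partial>lebesgue_on \<Omega>) = (\<integral>x. f x \<partial>lborel)"
    using f by (simp only: integral_restrict_space[OF \<Omega>'] eq) (simp add: integral_completion)
  show "integrable (lebesgue_on \<Omega>) f \<longleftrightarrow> integrable lborel f"
    using f by (simp only: integrable_restrict_space[OF \<Omega>'] eq) (simp add: integrable_completion)
qed

text \<open>The slices are disjoint, and the weight is at least \<open>wt \<gamma> \<epsilon> (2 ^ k)\<close> on the slice with index \<open>k\<close>.\<close>

lemma slices_energy:
  fixes \<phi> :: "real^'n::finite \<Rightarrow> real" and p :: "'n \<Rightarrow> real"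
  assumes p: "\<And>i. 1 < p i" and \<phi>: "\<phi> \<in> test_functions \<Omega>"
    and \<gamma>: "0 \<le> \<gamma>" and \<epsilon>: "0 < \<epsilon>" "\<epsilon> \<le> 1" and \<Omega>: "\<Omega> \<in> sets lebesgue"
  defines "S \<equiv> \<lambda>k::nat. {x. 2 ^ k \<le> \<bar>\<phi> x\<bar> \<and> \<bar>\<phi> x\<bar> < 2 * 2 ^ k}"
  shows "integrable (lebesgue_on \<Omega>) (\<lambda>x. wt \<gamma> \<epsilon> (\<phi> x) * \<bar>partial_deriv i \<phi> x\<bar> powr p i)"
    "(\<Sum>k<K. wt \<gamma> \<epsilon> (2 ^ k) * (\<Sum>i\<in>UNIV. \<integral>x. indicator (S k) x * \<bar>partial_deriv i \<phi> x\<bar> powr p i \<partial>lborel))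
     \<le> test_energy p \<Omega> \<gamma> \<epsilon> \<phi>"
proof -
  note [measurable] = test_function_measurable[OF \<phi>]
  note [measurable] = wt_measurable[OF \<gamma> \<epsilon>]
  have [measurable]: "S k \<in> sets borel" for k unfolding S_def by measurable
  let ?K = "closure {x. \<phi> x \<noteq> 0}"
  have Kc: "compact ?K" using test_functionsD(4)[OF \<phi>] .
  have K: "emeasure lborel ?K < \<infinity>" "?K \<in> sets lborel"
    using Kc emeasure_compact_finite[OF Kc] by (simp_all add: borel_compact)
  obtain C where C: "C > 0" "\<And>x. \<bar>\<phi> x\<bar> \<le> C" "\<And>x i. \<bar>partial_deriv i \<phi> x\<bar> \<le> C"
    using test_function_bounded[OF \<phi>] by metis
  have Cp: "\<bar>partial_deriv i \<phi> x\<bar> powr p i \<le> C powr p i" for i x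
    using C p[of i] by (intro powr_mono2) auto
  have wle: "wt \<gamma> \<epsilon> t \<le> (1 / \<epsilon>) powr (\<gamma> / 2)" for t by (rule wt_le[OF \<gamma> \<epsilon>])
  have w0: "0 \<le> wt \<gamma> \<epsilon> t" for t by (rule wt_pos[OF \<gamma> \<epsilon>])
  have out: "\<bar>partial_deriv i \<phi> x\<bar> powr p i = 0" if "x \<notin> ?K" for i x
    using partial_deriv_outside[OF \<phi> that] by simp
  have intw: "integrable lborel (\<lambda>x. wt \<gamma> \<epsilon> (\<phi> x) * \<bar>partial_deriv i \<phi> x\<bar> powr p i)" for i
    by (rule integrable_bounded_support[where A = ?K and C = "(1 / \<epsilon>) powr (\<gamma> / 2) * C powr p i"])
       (use K w0 wle Cp out in \<open>auto simp: abs_mult intro!: mult_mono\<close>)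
  have intS: "integrable lborel (\<lambda>x. indicator (S k) x * \<bar>partial_deriv i \<phi> x\<bar> powr p i)" for i k
    by (rule integrable_bounded_support[where A = ?K and C = "C powr p i"])
       (use K Cp out in \<open>auto simp: abs_mult indicator_def\<close>)
  note eq = lebesgue_on_integral_eq[OF _ \<Omega>, of "\<lambda>x. wt \<gamma> \<epsilon> (\<phi> x) * \<bar>partial_deriv j \<phi> x\<bar> powr p j" for j]
  have 0: "wt \<gamma> \<epsilon> (\<phi> x) * \<bar>partial_deriv j \<phi> x\<bar> powr p j = 0" if "x \<notin> \<Omega>" for x j
    using partial_deriv_outside'[OF \<phi> that] by simp
  show "integrable (lebesgue_on \<Omega>) (\<lambda>x. wt \<gamma> \<epsilon> (\<phi> x) * \<bar>partial_deriv i \<phi> x\<bar> powr p i)"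
    using intw eq(2) 0 by simp
  have pt: "(\<Sum>k<K. wt \<gamma> \<epsilon> (2 ^ k) * indicator (S k) x) \<le> wt \<gamma> \<epsilon> (\<phi> x)" for x
  proof (cases "\<exists>k0<K. x \<in> S k0")
    case True
    then obtain k0 where k0: "k0 < K" "x \<in> S k0" by blast
    have uniq: "k = k0" if "x \<in> S k" for k
    proof (rule ccontr)
      assume "k \<noteq> k0"
      then consider "Suc k \<le> k0" | "Suc k0 \<le> k" by linarith
      then show False
      proof cases
        case 1 then have "(2::real) ^ Suc k \<le> 2 ^ k0" by (intro power_increasing) auto
        then show False using that k0 by (auto simp: S_def)
      next
        case 2 then have "(2::real) ^ Suc k0 \<le> 2 ^ k" by (intro power_increasing) auto
        then show False using that k0 by (auto simp: S_def)
      qed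
    qed
    then have zero: "indicator (S k) x = (0::real)" if "k \<noteq> k0" for k
      using that by (metis indicator_simps(2))
    have "(\<Sum>k<K. wt \<gamma> \<epsilon> (2 ^ k) * indicator (S k) x) = (\<Sum>k\<in>{k0}. wt \<gamma> \<epsilon> (2 ^ k) * indicator (S k) x)"
      using k0 zero by (intro sum.mono_neutral_right) auto
    also have "\<dots> = wt \<gamma> \<epsilon> (2 ^ k0)" using k0 by simp
    also have "\<dots> \<le> wt \<gamma> \<epsilon> (\<phi> x)" using k0 by (intro wt_mono[OF \<gamma> \<epsilon>]) (auto simp: S_def)
    finally show ?thesis .
  next
    case False
    then have "(\<Sum>k<K. wt \<gamma> \<epsilon> (2 ^ k) * indicator (S k) x) = 0" by (intro sum.neutral) auto
    then show ?thesis using w0 by simp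
  qed
  have "(\<Sum>k<K. wt \<gamma> \<epsilon> (2 ^ k) * (\<Sum>i\<in>UNIV. \<integral>x. indicator (S k) x * \<bar>partial_deriv i \<phi> x\<bar> powr p i \<partial>lborel))
     = (\<Sum>i\<in>UNIV. \<Sum>k<K. wt \<gamma> \<epsilon> (2 ^ k) * (\<integral>x. indicator (S k) x * \<bar>partial_deriv i \<phi> x\<bar> powr p i \<partial>lborel))"
    by (simp add: sum_distrib_left) (rule sum.swap)
  also have "\<dots> = (\<Sum>i\<in>UNIV. \<integral>x. (\<Sum>k<K. wt \<gamma> \<epsilon> (2 ^ k) * (indicator (S k) x * \<bar>partial_deriv i \<phi> x\<bar> powr p i)) \<partial>lborel)"
    using intS by simp
  also have "\<dots> \<le> (\<Sum>i\<in>UNIV. \<integral>x. wt \<gamma> \<epsilon> (\<phi> x) * \<bar>partial_deriv i \<phi> x\<bar> powr p i \<partial>lborel)"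
  proof (intro sum_mono integral_mono intw)
    fix i x
    show "integrable lborel (\<lambda>x. \<Sum>k<K. wt \<gamma> \<epsilon> (2 ^ k) * (indicator (S k) x * \<bar>partial_deriv i \<phi> x\<bar> powr p i))"
      using intS by simp
    have "(\<Sum>k<K. wt \<gamma> \<epsilon> (2 ^ k) * (indicator (S k) x * \<bar>partial_deriv i \<phi> x\<bar> powr p i))
       = (\<Sum>k<K. wt \<gamma> \<epsilon> (2 ^ k) * indicator (S k) x) * \<bar>partial_deriv i \<phi> x\<bar> powr p i"
      unfolding sum_distrib_right by (intro sum.cong) (simp_all add: mult.assoc)
    also have "\<dots> \<le> wt \<gamma> \<epsilon> (\<phi> x) * \<bar>partial_deriv i \<phi> x\<bar> powr p i"
      by (intro mult_right_mono pt) auto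
    finally show "(\<Sum>k<K. wt \<gamma> \<epsilon> (2 ^ k) * (indicator (S k) x * \<bar>partial_deriv i \<phi> x\<bar> powr p i))
      \<le> wt \<gamma> \<epsilon> (\<phi> x) * \<bar>partial_deriv i \<phi> x\<bar> powr p i" .
  qed
  finally show "(\<Sum>k<K. wt \<gamma> \<epsilon> (2 ^ k) * (\<Sum>i\<in>UNIV. \<integral>x. indicator (S k) x * \<bar>partial_deriv i \<phi> x\<bar> powr p i \<partial>lborel))
     \<le> test_energy p \<Omega> \<gamma> \<epsilon> \<phi>"
    using eq(1) 0 by simp
qed

text \<open>A discrete layer-cake bound: the doubling property makes the largest term of the sum
  comparable to the left-hand side.\<close>

lemma layer_bound:
  assumes q: "0 < q" and \<gamma>: "0 \<le> \<gamma>" and \<epsilon>: "0 < \<epsilon>" "\<epsilon> \<le> 1" and t: "\<bar>t\<bar> < 2 ^ K"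
  shows "(1 + t\<^sup>2) powr (q / 2) * wt \<gamma> \<epsilon> t \<le> (4 powr q * 2 powr \<gamma>) *
    (1 + (\<Sum>k<K. wt \<gamma> \<epsilon> (2 ^ k) * (2 ^ k) powr q * indicator {t. 2 ^ k \<le> \<bar>t\<bar>} t))"
    (is "_ \<le> ?c * (1 + ?s)")
proof (cases "\<bar>t\<bar> < 1")
  case True
  then have "t\<^sup>2 \<le> 1" by (simp add: abs_square_le_1)
  then have "(1 + t\<^sup>2) powr (q / 2) \<le> 16 powr (q / 2)" using q by (intro powr_mono2) auto
  moreover have "(16::real) powr (q / 2) = 4 powr q" using powr_powr[of 4 2 "q / 2"] by simp
  moreover have "wt \<gamma> \<epsilon> t \<le> 2 powr \<gamma>"
    using wt_small[OF \<gamma> \<epsilon>, of t] True \<gamma> powr_mono[of "\<gamma> / 2" \<gamma> 2] by linarith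
  ultimately have "(1 + t\<^sup>2) powr (q / 2) * wt \<gamma> \<epsilon> t \<le> ?c"
    using wt_pos(2)[OF \<gamma> \<epsilon>] by (intro mult_mono) auto
  then have "(1 + t\<^sup>2) powr (q / 2) * wt \<gamma> \<epsilon> t \<le> ?c * 1" by simp
  also have "\<dots> \<le> ?c * (1 + ?s)"
    using wt_pos(2)[OF \<gamma> \<epsilon>] by (intro mult_left_mono) (auto intro!: sum_nonneg)
  finally show ?thesis .
next
  case False
  then obtain k where k: "k < K" "2 ^ k \<le> \<bar>t\<bar>" "\<bar>t\<bar> < 2 ^ Suc k"
    using dyadic_ex[of "\<bar>t\<bar>" K] t by auto
  have "1 \<le> (2::real) ^ k" by simp
  then have k1: "1 \<le> ((2::real) ^ k)\<^sup>2" by (simp only: one_le_power)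
  have "t\<^sup>2 \<le> (2 ^ Suc k)\<^sup>2" using k by (metis abs_ge_zero less_imp_le power2_abs power_mono)
  then have "t\<^sup>2 \<le> 4 * (2 ^ k)\<^sup>2" by (simp add: power_mult_distrib)
  then have "1 + t\<^sup>2 \<le> 16 * (2 ^ k)\<^sup>2" using k1 by linarith
  then have "1 + t\<^sup>2 \<le> (4 * 2 ^ k)\<^sup>2" by (simp add: power_mult_distrib)
  then have "(1 + t\<^sup>2) powr (q / 2) \<le> ((4 * 2 ^ k)\<^sup>2) powr (q / 2)" using q by (intro powr_mono2) auto
  also have "((4 * 2 ^ k :: real)\<^sup>2) powr (q / 2) = (4 * 2 ^ k) powr q"
    using powr_powr[of "4 * 2 ^ k :: real" 2 "q / 2"] by simp
  also have "\<dots> = 4 powr q * (2 ^ k) powr q" by (simp add: powr_mult)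
  finally have A: "(1 + t\<^sup>2) powr (q / 2) \<le> 4 powr q * (2 ^ k) powr q" .
  have "wt \<gamma> \<epsilon> t \<le> wt \<gamma> \<epsilon> (2 * 2 ^ k)" using k by (intro wt_mono[OF \<gamma> \<epsilon>]) auto
  also have "\<dots> \<le> 2 powr \<gamma> * wt \<gamma> \<epsilon> (2 ^ k)" by (rule wt_double[OF \<gamma> \<epsilon>])
  finally have B: "wt \<gamma> \<epsilon> t \<le> 2 powr \<gamma> * wt \<gamma> \<epsilon> (2 ^ k)" .
  have "(1 + t\<^sup>2) powr (q / 2) * wt \<gamma> \<epsilon> t \<le> (4 powr q * (2 ^ k) powr q) * (2 powr \<gamma> * wt \<gamma> \<epsilon> (2 ^ k))"
    using wt_pos(2)[OF \<gamma> \<epsilon>] by (intro mult_mono A B) auto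
  also have "\<dots> = ?c * (wt \<gamma> \<epsilon> (2 ^ k) * (2 ^ k) powr q * indicator {t. 2 ^ k \<le> \<bar>t\<bar>} t)"
    using k by simp
  also have "\<dots> \<le> ?c * (1 + ?s)"
  proof (rule mult_left_mono)
    have "wt \<gamma> \<epsilon> (2 ^ k) * (2 ^ k) powr q * indicator {t. 2 ^ k \<le> \<bar>t\<bar>} t \<le> ?s"
      using k wt_pos(2)[OF \<gamma> \<epsilon>] by (intro member_le_sum) auto
    then show "wt \<gamma> \<epsilon> (2 ^ k) * (2 ^ k) powr q * indicator {t. 2 ^ k \<le> \<bar>t\<bar>} t \<le> 1 + ?s" by linarith
  qed simp
  finally show ?thesis .
qed

text \<open>On each dyadic slice the weight is essentially constant, so the unweighted alternative for
  level sets can be summed over the slices; a level that is much smaller than the previous one is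
  absorbed by it. The threshold \<open>\<tau>\<close> is chosen so that absorption gains a factor 1/2.\<close>

lemma Hardy_test:
  fixes p :: "'n::finite \<Rightarrow> real"
  assumes N: "CARD('n) > 1" and p: "\<And>i. 1 < p i"
  defines "q \<equiv> harmonic_mean p" and "\<theta> \<equiv> 1 - harmonic_mean p / real CARD('n)"
  assumes q: "1 < q" "q < real CARD('n)" and \<gamma>: "0 \<le> \<gamma>"
  shows "\<exists>C>0. \<forall>(\<Omega> :: (real^'n) set) \<phi> V \<kappa> \<epsilon>. open \<Omega> \<longrightarrow> bounded \<Omega> \<longrightarrow> 0 < \<epsilon> \<longrightarrow> \<epsilon> \<le> 1 \<longrightarrow>
     \<phi> \<in> test_functions \<Omega> \<longrightarrow> Morrey_weight \<Omega> \<theta> \<kappa> V \<longrightarrow>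
     (\<integral>\<^sup>+x. V x * ennreal ((1 + (\<phi> x)\<^sup>2) powr (q / 2) * wt \<gamma> \<epsilon> (\<phi> x)) \<partial>lebesgue_on \<Omega>)
      \<le> ennreal (C * \<kappa> * (measure lebesgue \<Omega> powr \<theta> + test_energy p \<Omega> \<gamma> \<epsilon> \<phi>))"
proof -
  have \<theta>: "0 < \<theta>" using q by (simp add: \<theta>_def q_def)
  define c where "c = 2 powr (\<gamma> + q)"
  define \<tau> where "\<tau> = (1 / (2 * c)) powr (1 / \<theta>)"
  have c: "0 < c" by (simp add: c_def)
  have \<tau>: "0 < \<tau>" "\<tau> powr \<theta> * c = 1 / 2" using c \<theta> by (simp_all add: \<tau>_def powr_powr)
  define c1 where "c1 = c * \<tau> powr (1 - q)"
  have c1: "0 < c1" using c \<tau> by (simp add: c1_def)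
  define c0 where "c0 = 4 powr q * 2 powr \<gamma>"
  have c0: "0 < c0" by (simp add: c0_def)
  define C where "C = c0 * (1 + 2 * 2 powr (\<gamma> / 2) + 2 * c1)"
  have C: "0 < C" unfolding C_def using c0 c1 by (intro mult_pos_pos add_pos_pos) auto
  show ?thesis
  proof (intro exI[of _ C] conjI C allI impI)
    fix \<Omega> :: "(real^'n) set" and \<phi> V and \<kappa> \<epsilon> :: real
    assume \<Omega>: "open \<Omega>" "bounded \<Omega>" and \<epsilon>: "0 < \<epsilon>" "\<epsilon> \<le> 1" and \<phi>: "\<phi> \<in> test_functions \<Omega>"
      and V: "Morrey_weight \<Omega> \<theta> \<kappa> V"
    note [measurable] = test_function_measurable[OF \<phi>]
    have \<Omega>l: "\<Omega> \<in> sets lebesgue" using \<Omega> by auto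
    have \<kappa>: "0 \<le> \<kappa>" and [measurable]: "V \<in> borel_measurable (lebesgue_on \<Omega>)"
      using V by (auto simp: Morrey_weight_def)
    define W where "W = wt \<gamma> \<epsilon>"
    have W0: "0 \<le> W t" for t unfolding W_def by (rule wt_pos[OF \<gamma> \<epsilon>])
    define E where "E k = {x. 2 ^ k \<le> \<bar>\<phi> x\<bar>}" for k :: nat
    have Eb [measurable]: "E k \<in> sets borel" for k unfolding E_def by measurable
    have El: "E k \<in> sets lebesgue" for k using Eb[of k] by simp
    have Esub: "E k \<subseteq> \<Omega>" for k
    proof
      fix x assume "x \<in> E k"
      then have "(2::real) ^ k \<le> \<bar>\<phi> x\<bar>" by (simp add: E_def)
      moreover have "0 < (2::real) ^ k" by simp
      ultimately have "\<phi> x \<noteq> 0" by linarith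
      then show "x \<in> \<Omega>" using test_functionsD(6)[OF \<phi>] by blast
    qed
    have \<Omega>fin: "emeasure lebesgue \<Omega> < \<infinity>" using \<Omega> emeasure_bounded_finite by (auto intro: )
    define a where "a k = measure lebesgue (E k)" for k
    have a0: "0 \<le> a k" for k by (simp add: a_def)
    have a\<Omega>: "a k \<le> measure lebesgue \<Omega>" for k
      unfolding a_def using \<Omega>fin Esub El \<Omega>l
      by (intro measure_mono_fmeasurable) (auto simp: fmeasurable_def)
    have ab: "measure lborel (E k) = a k" for k using Eb[of k] by (simp add: a_def measure_completion)
    obtain B where B: "\<And>x. \<bar>\<phi> x\<bar> \<le> B" using test_function_bounded[OF \<phi>] by metis
    obtain K where "B < 2 ^ K" using real_arch_pow[of 2 B] by auto
    then have K: "\<bar>\<phi> x\<bar> < 2 ^ K" for x using B[of x] by linarith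
    define S where "S k = {x. 2 ^ k \<le> \<bar>\<phi> x\<bar> \<and> \<bar>\<phi> x\<bar> < 2 * 2 ^ k}" for k :: nat
    define D where "D k = (\<Sum>i\<in>UNIV. \<integral>x. indicator (S k) x * \<bar>partial_deriv i \<phi> x\<bar> powr p i \<partial>lborel)" for k
    define DD where "DD = test_energy p \<Omega> \<gamma> \<epsilon> \<phi>"
    have D0: "0 \<le> D k" for k unfolding D_def by (intro sum_nonneg integral_nonneg_AE) auto
    have Dsum: "(\<Sum>k<K. W (2 ^ k) * D k) \<le> DD"
      unfolding D_def DD_def W_def S_def by (rule slices_energy(2)[OF p \<phi> \<gamma> \<epsilon> \<Omega>l])
    define x where "x k = W (2 ^ k) * (2 ^ k) powr q * a k powr \<theta>" for k :: nat
    have x0: "0 \<le> x k" for k using W0 by (simp add: x_def)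
    have rec: "x (Suc k) \<le> x k / 2 + c1 * (W (2 ^ k) * D k)" for k
    proof -
      have "W (2 ^ Suc k) \<le> 2 powr \<gamma> * W (2 ^ k)"
        unfolding W_def using wt_double[OF \<gamma> \<epsilon>, of "2 ^ k"] by simp
      then have "x (Suc k) \<le> (2 powr \<gamma> * W (2 ^ k)) * (2 powr q * (2 ^ k) powr q) * a (Suc k) powr \<theta>"
        unfolding x_def by (intro mult_right_mono mult_mono) (auto simp: powr_mult W0)
      then have x1: "x (Suc k) \<le> c * (W (2 ^ k) * ((2 ^ k) powr q * a (Suc k) powr \<theta>))"
        by (simp add: c_def powr_add mult_ac)
      have "a (Suc k) < \<tau> * a k \<or> (2 ^ k) powr q * a (Suc k) powr \<theta> \<le> \<tau> powr (1 - q) * D k"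
        using dyadic_alternative[OF N, of p \<phi> \<Omega> "2 ^ k" \<tau>] \<tau> q p \<phi>
        by (simp add: D_def S_def q_def[symmetric] \<theta>_def E_def[symmetric] ab
            E_def[of "Suc k", simplified, symmetric])
      then show ?thesis
      proof
        assume "a (Suc k) < \<tau> * a k"
        then have "a (Suc k) powr \<theta> \<le> (\<tau> * a k) powr \<theta>" using a0 \<theta> by (intro powr_mono2) auto
        also have "\<dots> = \<tau> powr \<theta> * a k powr \<theta>" using \<tau> a0 by (simp add: powr_mult)
        finally have "c * (W (2 ^ k) * ((2 ^ k) powr q * a (Suc k) powr \<theta>))
            \<le> c * (W (2 ^ k) * ((2 ^ k) powr q * (\<tau> powr \<theta> * a k powr \<theta>)))"
          using c W0 by (intro mult_left_mono) auto
        also have "\<dots> = (\<tau> powr \<theta> * c) * x k" by (simp add: x_def mult_ac)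
        also have "\<dots> = x k / 2" by (simp add: \<tau>)
        finally show ?thesis using x1 c1 W0[of "2 ^ k"] D0[of k] by (smt (verit) mult_nonneg_nonneg)
      next
        assume "(2 ^ k) powr q * a (Suc k) powr \<theta> \<le> \<tau> powr (1 - q) * D k"
        then have "c * (W (2 ^ k) * ((2 ^ k) powr q * a (Suc k) powr \<theta>))
            \<le> c * (W (2 ^ k) * (\<tau> powr (1 - q) * D k))"
          using c W0 by (intro mult_left_mono) auto
        then show ?thesis using x1 x0[of k] by (simp add: c1_def mult_ac)
      qed
    qed
    define m where "m = measure lebesgue \<Omega> powr \<theta>"
    have X: "(\<Sum>k<K. x k) \<le> 2 * (2 powr (\<gamma> / 2) * m) + 2 * (c1 * DD)"
    proof -
      have "x 0 \<le> 2 powr (\<gamma> / 2) * m"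
        unfolding x_def m_def using wt_small[OF \<gamma> \<epsilon>, of 1] W0 a\<Omega>[of 0] a0 \<theta>
        by (simp add: W_def) (intro mult_mono powr_mono2, auto)
      moreover have "(\<Sum>k<K. c1 * (W (2 ^ k) * D k)) \<le> c1 * DD"
        unfolding sum_distrib_left[symmetric] using c1 by (intro mult_left_mono Dsum) auto
      ultimately show ?thesis using recursive_sum_bound[of x "\<lambda>k. c1 * (W (2 ^ k) * D k)" K] x0 rec by auto
    qed
    have DD0: "0 \<le> DD"
      unfolding DD_def using wt_pos(2)[OF \<gamma> \<epsilon>] by (intro sum_nonneg integral_nonneg_AE) auto
    have VE: "(\<integral>\<^sup>+x. V x * indicator (E k) x \<partial>lebesgue_on \<Omega>) \<le> ennreal (\<kappa> * a k powr \<theta>)" for k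
      using V El[of k] Esub[of k] unfolding Morrey_weight_def a_def by blast
    have V\<Omega>: "(\<integral>\<^sup>+x. V x \<partial>lebesgue_on \<Omega>) \<le> ennreal (\<kappa> * m)"
    proof -
      have "(\<integral>\<^sup>+x. V x \<partial>lebesgue_on \<Omega>) = (\<integral>\<^sup>+x. V x * indicator \<Omega> x \<partial>lebesgue_on \<Omega>)"
        by (intro nn_integral_cong) auto
      also have "\<dots> \<le> ennreal (\<kappa> * measure lebesgue \<Omega> powr \<theta>)"
        using V \<Omega>l unfolding Morrey_weight_def by blast
      finally show ?thesis by (simp add: m_def)
    qed
    have [measurable]: "E k \<in> sets (lebesgue_on \<Omega>)" for k
      using El Esub \<Omega>l by (simp add: sets_restrict_space_iff)
    have "(\<integral>\<^sup>+x. V x * ennreal ((1 + (\<phi> x)\<^sup>2) powr (q / 2) * wt \<gamma> \<epsilon> (\<phi> x)) \<partial>lebesgue_on \<Omega>)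
       \<le> (\<integral>\<^sup>+x. ennreal c0 * (V x + (\<Sum>k<K. ennreal (W (2 ^ k) * (2 ^ k) powr q) * (V x * indicator (E k) x))) \<partial>lebesgue_on \<Omega>)"
    proof (rule nn_integral_mono)
      fix x
      have "ennreal ((1 + (\<phi> x)\<^sup>2) powr (q / 2) * wt \<gamma> \<epsilon> (\<phi> x)) \<le>
         ennreal (c0 * (1 + (\<Sum>k<K. W (2 ^ k) * (2 ^ k) powr q * indicator (E k) x)))"
        using layer_bound[OF _ \<gamma> \<epsilon> K, of q x] q
        by (intro ennreal_leI) (simp add: W_def c0_def E_def indicator_def)
      also have "\<dots> = ennreal c0 * (1 + (\<Sum>k<K. ennreal (W (2 ^ k) * (2 ^ k) powr q) * indicator (E k) x))"
      proof -
        have "ennreal (c0 * (1 + (\<Sum>k<K. W (2 ^ k) * (2 ^ k) powr q * indicator (E k) x)))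
          = ennreal c0 * ennreal (1 + (\<Sum>k<K. W (2 ^ k) * (2 ^ k) powr q * indicator (E k) x))"
          using c0 by (intro ennreal_mult') auto
        also have "ennreal (1 + (\<Sum>k<K. W (2 ^ k) * (2 ^ k) powr q * indicator (E k) x))
          = 1 + ennreal (\<Sum>k<K. W (2 ^ k) * (2 ^ k) powr q * indicator (E k) x)"
          using W0 by (subst ennreal_plus) (auto intro!: sum_nonneg)
        also have "ennreal (\<Sum>k<K. W (2 ^ k) * (2 ^ k) powr q * indicator (E k) x)
          = (\<Sum>k<K. ennreal (W (2 ^ k) * (2 ^ k) powr q) * indicator (E k) x)"
          using W0 by (subst sum_ennreal[symmetric]) (auto intro!: sum.cong simp: indicator_def)
        finally show ?thesis .
      qed
      finally have "V x * ennreal ((1 + (\<phi> x)\<^sup>2) powr (q / 2) * wt \<gamma> \<epsilon> (\<phi> x)) \<le>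
        V x * (ennreal c0 * (1 + (\<Sum>k<K. ennreal (W (2 ^ k) * (2 ^ k) powr q) * indicator (E k) x)))"
        by (intro mult_left_mono) auto
      also have "\<dots> = ennreal c0 * (V x + (\<Sum>k<K. ennreal (W (2 ^ k) * (2 ^ k) powr q) * (V x * indicator (E k) x)))"
        by (simp only: distrib_left sum_distrib_left mult_ac mult_1_left mult_1_right)
      finally show "V x * ennreal ((1 + (\<phi> x)\<^sup>2) powr (q / 2) * wt \<gamma> \<epsilon> (\<phi> x)) \<le>
         ennreal c0 * (V x + (\<Sum>k<K. ennreal (W (2 ^ k) * (2 ^ k) powr q) * (V x * indicator (E k) x)))" .
    qed
    also have "\<dots> = ennreal c0 * ((\<integral>\<^sup>+x. V x \<partial>lebesgue_on \<Omega>) +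
        (\<Sum>k<K. ennreal (W (2 ^ k) * (2 ^ k) powr q) * (\<integral>\<^sup>+x. V x * indicator (E k) x \<partial>lebesgue_on \<Omega>)))"
      by (simp add: nn_integral_cmult nn_integral_add nn_integral_sum)
    also have "\<dots> \<le> ennreal c0 * (ennreal (\<kappa> * m) + (\<Sum>k<K. ennreal (W (2 ^ k) * (2 ^ k) powr q) * ennreal (\<kappa> * a k powr \<theta>)))"
      by (intro mult_left_mono add_mono sum_mono VE V\<Omega>) auto
    also have "\<dots> = ennreal (c0 * (\<kappa> * m + (\<Sum>k<K. \<kappa> * x k)))"
    proof -
      have "(\<Sum>k<K. ennreal (W (2 ^ k) * (2 ^ k) powr q) * ennreal (\<kappa> * a k powr \<theta>)) = ennreal (\<Sum>k<K. \<kappa> * x k)"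
        using W0 \<kappa> by (subst sum_ennreal[symmetric])
          (auto intro!: sum.cong simp: x_def mult_ac simp flip: ennreal_mult)
      moreover have "0 \<le> (\<Sum>k<K. \<kappa> * x k)" using \<kappa> x0 by (intro sum_nonneg) auto
      moreover have "0 \<le> \<kappa> * m" using \<kappa> by (simp add: m_def)
      ultimately show ?thesis using c0 by (simp only: ennreal_plus[symmetric] ennreal_mult'[symmetric] less_imp_le)
    qed
    also have "\<dots> \<le> ennreal (C * \<kappa> * (m + DD))"
    proof (rule ennreal_leI)
      have "c0 * (\<kappa> * m + (\<Sum>k<K. \<kappa> * x k)) = c0 * \<kappa> * (m + (\<Sum>k<K. x k))"
        by (simp add: sum_distrib_left[symmetric] algebra_simps)
      also have "\<dots> \<le> c0 * \<kappa> * (m + (2 * (2 powr (\<gamma> / 2) * m) + 2 * (c1 * DD)))"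
        using X c0 \<kappa> by (intro mult_left_mono) auto
      also have "\<dots> \<le> c0 * \<kappa> * ((1 + 2 * 2 powr (\<gamma> / 2) + 2 * c1) * (m + DD))"
      proof (rule mult_left_mono)
        have "0 \<le> m" by (simp add: m_def)
        moreover have "0 \<le> c1 * m" "0 \<le> 2 powr (\<gamma> / 2) * DD" using c1 \<open>0 \<le> m\<close> DD0 by auto
        ultimately show "m + (2 * (2 powr (\<gamma> / 2) * m) + 2 * (c1 * DD)) \<le> (1 + 2 * 2 powr (\<gamma> / 2) + 2 * c1) * (m + DD)"
          using DD0 by (simp add: algebra_simps)
      qed (use c0 \<kappa> in auto)
      finally show "c0 * (\<kappa> * m + (\<Sum>k<K. \<kappa> * x k)) \<le> C * \<kappa> * (m + DD)" by (simp add: C_def mult_ac)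
    qed
    finally show "(\<integral>\<^sup>+x. V x * ennreal ((1 + (\<phi> x)\<^sup>2) powr (q / 2) * wt \<gamma> \<epsilon> (\<phi> x)) \<partial>lebesgue_on \<Omega>)
      \<le> ennreal (C * \<kappa> * (measure lebesgue \<Omega> powr \<theta> + test_energy p \<Omega> \<gamma> \<epsilon> \<phi>))"
      by (simp add: m_def DD_def)
  qed
qed

section \<open>Smooth functions and cutoffs\<close>

lemma Ck_fun_differentiable: "Ck_fun (Suc k) f \<Longrightarrow> (f has_derivative frechet_derivative f (at x)) (at x)"
  by (simp add: frechet_derivative_works[symmetric])

lemma Ck_fun_SucI:
  assumes "\<And>x. (f has_derivative f' x) (at x)" "\<And>i. Ck_fun k (\<lambda>x. f' x (axis i 1))"
  shows "Ck_fun (Suc k) f"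
proof -
  have "partial_deriv i f = (\<lambda>x. f' x (axis i 1))" for i
    using partial_deriv_eqI[OF assms(1)] by auto
  then show ?thesis using assms by (auto simp: differentiable_def)
qed

lemma Ck_fun_const: "Ck_fun k (\<lambda>_. c)"
proof (induction k arbitrary: c)
  case 0 then show ?case by simp
next
  case (Suc k)
  show ?case by (rule Ck_fun_SucI[where f' = "\<lambda>_ _. 0"]) (use Suc in auto)
qed

lemma Ck_fun_nth: "Ck_fun k (\<lambda>x. x $ j)"
proof (cases k)
  case 0 then show ?thesis by (simp add: continuous_on_component)
next
  case (Suc k')
  show ?thesis unfolding Suc
  proof (rule Ck_fun_SucI[where f' = "\<lambda>_ h. h $ j"])
    show "((\<lambda>x. x $ j) has_derivative (\<lambda>h. h $ j)) (at x)" for x :: "real^'a"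
      by (intro bounded_linear_imp_has_derivative bounded_linear_vec_nth)
  qed (rule Ck_fun_const)
qed

lemma Ck_fun_add: "Ck_fun k f \<Longrightarrow> Ck_fun k g \<Longrightarrow> Ck_fun k (\<lambda>x. f x + g x)"
proof (induction k arbitrary: f g)
  case 0 then show ?case by (auto intro: continuous_intros)
next
  case (Suc k)
  show ?case
  proof (rule Ck_fun_SucI)
    show "((\<lambda>x. f x + g x) has_derivative
        (\<lambda>h. frechet_derivative f (at x) h + frechet_derivative g (at x) h)) (at x)" for x
      using Suc.prems by (intro has_derivative_add Ck_fun_differentiable)
    show "Ck_fun k (\<lambda>x. frechet_derivative f (at x) (axis i 1) + frechet_derivative g (at x) (axis i 1))" for i
      unfolding partial_deriv_def[symmetric] using Suc.prems by (intro Suc.IH) auto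
  qed
qed

lemma Ck_fun_mult: "Ck_fun k f \<Longrightarrow> Ck_fun k g \<Longrightarrow> Ck_fun k (\<lambda>x. f x * g x)"
proof (induction k arbitrary: f g)
  case 0 then show ?case by (auto intro: continuous_intros)
next
  case (Suc k)
  have C: "Ck_fun k f" "Ck_fun k g" "\<And>i. Ck_fun k (partial_deriv i f)" "\<And>i. Ck_fun k (partial_deriv i g)"
    using Suc.prems Ck_fun_SucD[OF Suc.prems(1)] Ck_fun_SucD[OF Suc.prems(2)] by auto
  show ?case
  proof (rule Ck_fun_SucI)
    show "((\<lambda>x. f x * g x) has_derivative
        (\<lambda>h. f x * frechet_derivative g (at x) h + frechet_derivative f (at x) h * g x)) (at x)" for x
      using Suc.prems by (intro has_derivative_mult Ck_fun_differentiable)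
    show "Ck_fun k (\<lambda>x. f x * frechet_derivative g (at x) (axis i 1) + frechet_derivative f (at x) (axis i 1) * g x)" for i
      using C by (intro Ck_fun_add) (auto intro!: Suc.IH simp flip: partial_deriv_def)
  qed
qed

lemma Ck_fun_prod: "finite I \<Longrightarrow> (\<And>i. i \<in> I \<Longrightarrow> Ck_fun k (f i)) \<Longrightarrow> Ck_fun k (\<lambda>x. \<Prod>i\<in>I. f i x)"
  by (induction I rule: finite_induct) (auto intro: Ck_fun_const Ck_fun_mult)

lemma Ck_fun_powr:
  assumes "\<And>x. 0 < f x"
  shows "Ck_fun k f \<Longrightarrow> Ck_fun k (\<lambda>x. f x powr a)"
proof (induction k arbitrary: a)
  case 0
  then show ?case using assms by (auto intro!: continuous_intros simp: less_imp_neq[symmetric])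
next
  case (Suc k)
  show ?case
  proof (rule Ck_fun_SucI)
    show "((\<lambda>x. f x powr a) has_derivative
        (\<lambda>h. (a * f x powr (a - 1)) * frechet_derivative f (at x) h)) (at x)" for x
    proof -
      have "((\<lambda>t. t powr a) has_derivative (*) (a * f x powr (a - 1))) (at (f x))"
        using has_real_derivative_powr[OF assms, of a x] by (simp only: has_field_derivative_def)
      from has_derivative_compose[OF Ck_fun_differentiable[OF Suc.prems] this] show ?thesis .
    qed
    show "Ck_fun k (\<lambda>x. (a * f x powr (a - 1)) * frechet_derivative f (at x) (axis i 1))" for i
      using Suc Ck_fun_SucD[OF Suc.prems]
      by (intro Ck_fun_mult Ck_fun_const) (auto simp flip: partial_deriv_def)
  qed
qed

text \<open>The functions \<open>exp (- 1 / t) / t ^ m\<close>, extended by 0, span a space that is closed under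
  differentiation; smoothness of each of them follows by induction on the order.\<close>

definition flat :: "nat \<Rightarrow> real \<Rightarrow> real" where
  "flat m t = (if 0 < t then exp (- 1 / t) / t ^ m else 0)"

lemma flat_at_right: "(flat m \<longlongrightarrow> 0) (at_right 0)"
proof -
  have "((\<lambda>t::real. exp (- 1 / t) / t ^ m) \<longlongrightarrow> 0) (at_right 0)" by real_asymp
  moreover have "eventually (\<lambda>t::real. exp (- 1 / t) / t ^ m = flat m t) (at_right 0)"
    by (auto simp: flat_def eventually_at_filter)
  ultimately show ?thesis by (rule Lim_transform_eventually)
qed

lemma flat_deriv: "(flat m has_real_derivative flat (m + 2) t - real m * flat (Suc m) t) (at t)"
proof -
  consider "t < 0" | "t = 0" | "0 < t" by linarith
  then show ?thesis
  proof cases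
    case 1
    have "((\<lambda>_. 0) has_real_derivative 0) (at t)" by simp
    then have "(flat m has_real_derivative 0) (at t)"
      by (rule has_field_derivative_transform_within_open[of _ _ _ "{..<0}"]) (use 1 in \<open>auto simp: flat_def\<close>)
    then show ?thesis using 1 by (simp add: flat_def)
  next
    case 3
    have "((\<lambda>t. exp (- 1 / t) / t ^ m) has_real_derivative
        exp (- 1 / t) / t ^ (m + 2) - real m * (exp (- 1 / t) / t ^ Suc m)) (at t)"
    proof -
      have E: "((\<lambda>t. exp (- 1 / t)) has_real_derivative exp (- 1 / t) / t\<^sup>2) (at t)"
        using 3 by (auto intro!: derivative_eq_intros simp: power2_eq_square)
      have "real m * t ^ (m - Suc 0) = real m * t ^ m / t" using 3 by (cases m) auto
      then have P: "((\<lambda>t. t ^ m) has_real_derivative real m * t ^ m / t) (at t)"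
        using DERIV_pow[of m t] by simp
      show ?thesis
        by (rule DERIV_cong[OF DERIV_divide[OF E P]]) (use 3 in \<open>auto simp: field_simps power2_eq_square\<close>)
    qed
    then have "(flat m has_real_derivative
        exp (- 1 / t) / t ^ (m + 2) - real m * (exp (- 1 / t) / t ^ Suc m)) (at t)"
      by (rule has_field_derivative_transform_within_open[of _ _ _ "{0<..}"]) (use 3 in \<open>auto simp: flat_def\<close>)
    then show ?thesis using 3 by (simp add: flat_def)
  next
    case 2
    have "((\<lambda>h. (flat m (0 + h) - flat m 0) / h) \<longlongrightarrow> 0) (at 0)"
    proof (rule filterlim_split_at)
      have "eventually (\<lambda>h. 0 = (flat m (0 + h) - flat m 0) / h) (at_left 0)"
        by (auto simp: flat_def eventually_at_filter)
      then show "((\<lambda>h. (flat m (0 + h) - flat m 0) / h) \<longlongrightarrow> 0) (at_left 0)"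
        by (rule Lim_transform_eventually[rotated]) simp
      have "eventually (\<lambda>h. flat (Suc m) h = (flat m (0 + h) - flat m 0) / h) (at_right 0)"
        by (auto simp: flat_def eventually_at_filter)
      then show "((\<lambda>h. (flat m (0 + h) - flat m 0) / h) \<longlongrightarrow> 0) (at_right 0)"
        by (rule Lim_transform_eventually[rotated]) (rule flat_at_right)
    qed
    then show ?thesis using 2 by (simp add: DERIV_def) (simp add: flat_def)
  qed
qed

lemma Ck_fun_flat: "Ck_fun k g \<Longrightarrow> Ck_fun k (\<lambda>x. flat m (g x))"
proof (induction k arbitrary: m)
  case 0
  have "continuous_on UNIV (flat m)"
    using flat_deriv by (intro DERIV_continuous_on) (auto intro: has_field_derivative_at_within)
  then show ?case using 0 by (auto intro: continuous_on_compose2)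
next
  case (Suc k)
  show ?case
  proof (rule Ck_fun_SucI)
    show "((\<lambda>x. flat m (g x)) has_derivative (\<lambda>h. (flat (m + 2) (g x) + (- real m) * flat (Suc m) (g x)) *
        frechet_derivative g (at x) h)) (at x)" for x
    proof -
      have "(flat m has_derivative (\<lambda>h. (flat (m + 2) (g x) + (- real m) * flat (Suc m) (g x)) * h)) (at (g x))"
        using flat_deriv[of m "g x"] by (simp add: has_field_derivative_def)
      from has_derivative_compose[OF Ck_fun_differentiable[OF Suc.prems] this] show ?thesis .
    qed
    show "Ck_fun k (\<lambda>x. (flat (m + 2) (g x) + (- real m) * flat (Suc m) (g x)) *
        frechet_derivative g (at x) (axis i 1))" for i
      using Suc Ck_fun_SucD[OF Suc.prems]
      by (intro Ck_fun_mult Ck_fun_add Ck_fun_const) (auto simp flip: partial_deriv_def)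
  qed
qed

text \<open>Smooth functions that increase to the indicator function of the box as \<open>n\<close> grows.\<close>

definition box_cutoff :: "nat \<Rightarrow> real^'n::finite \<Rightarrow> real^'n \<Rightarrow> real^'n \<Rightarrow> real" where
  "box_cutoff n a b x = (\<Prod>i\<in>UNIV. flat 0 (real n * ((x $ i - a $ i) * (b $ i - x $ i))))"

lemma flat_0_bounds: "0 \<le> flat 0 t" "flat 0 t \<le> 1"
  by (auto simp: flat_def)

lemma box_cutoff_bounds: "0 \<le> box_cutoff n a b x" "box_cutoff n a b x \<le> 1"
  unfolding box_cutoff_def by (auto intro!: prod_nonneg prod_le_1 flat_0_bounds)

lemma box_cutoff_outside: "x \<notin> box a b \<Longrightarrow> box_cutoff n a b x = 0" if "\<And>i. a $ i \<le> b $ i"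
proof -
  assume "x \<notin> box a b"
  then obtain i where "\<not> (a $ i < x $ i \<and> x $ i < b $ i)" by (auto simp: mem_box_cart)
  then have "(x $ i - a $ i) * (b $ i - x $ i) \<le> 0"
    using that[of i] by (auto simp: mult_le_0_iff not_less)
  then have "real n * ((x $ i - a $ i) * (b $ i - x $ i)) \<le> 0" by (simp add: mult_le_0_iff)
  then have "flat 0 (real n * ((x $ i - a $ i) * (b $ i - x $ i))) = 0" by (simp add: flat_def)
  then show ?thesis unfolding box_cutoff_def by (auto intro!: prod_zero)
qed

lemma box_cutoff_tendsto:
  fixes a b x :: "real^'n::finite"
  assumes "\<And>i. a $ i \<le> b $ i"
  shows "(\<lambda>n. box_cutoff n a b x) \<longlonglongrightarrow> indicator (box a b) x"
proof (cases "x \<in> box a b")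
  case True
  have "(\<lambda>n. box_cutoff n a b x) \<longlonglongrightarrow> (\<Prod>i\<in>(UNIV::'n set). 1)"
    unfolding box_cutoff_def
  proof (rule tendsto_prod)
    fix i :: 'n
    let ?c = "(x $ i - a $ i) * (b $ i - x $ i)"
    have c: "0 < ?c" using True by (auto simp: mem_box_cart)
    have "(\<lambda>n. exp (- 1 / (real n * c))) \<longlonglongrightarrow> 1" if "0 < c" for c :: real
      using that by real_asymp
    from this[OF c] have "(\<lambda>n. exp (- 1 / (real n * ?c))) \<longlonglongrightarrow> 1" .
    moreover have "eventually (\<lambda>n. exp (- 1 / (real n * ?c)) = flat 0 (real n * ?c)) sequentially"
      using eventually_gt_at_top[of 0] by eventually_elim (use c in \<open>simp add: flat_def\<close>)
    ultimately show "(\<lambda>n. flat 0 (real n * ?c)) \<longlonglongrightarrow> 1" by (rule Lim_transform_eventually)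
  qed
  then show ?thesis using True by simp
next
  case False then show ?thesis using box_cutoff_outside[OF assms] by simp
qed

lemma box_cutoff_test:
  assumes "\<And>i. a $ i \<le> b $ i" "cbox a b \<subseteq> \<Omega>"
  shows "box_cutoff n a b \<in> test_functions \<Omega>"
proof -
  have "Ck_fun k (box_cutoff n a b)" for k
  proof -
    have "box_cutoff n a b = (\<lambda>x. \<Prod>i\<in>UNIV. flat 0 (real n * ((x $ i + (- a $ i)) * (b $ i + (- 1) * x $ i))))"
      by (auto simp: box_cutoff_def fun_eq_iff)
    moreover have "Ck_fun k (\<lambda>x. \<Prod>i\<in>UNIV. flat 0 (real n * ((x $ i + (- a $ i)) * (b $ i + (- 1) * x $ i))))"
      by (intro Ck_fun_prod Ck_fun_flat Ck_fun_mult Ck_fun_add Ck_fun_const Ck_fun_nth) simp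
    ultimately show ?thesis by simp
  qed
  moreover have "{x. box_cutoff n a b x \<noteq> 0} \<subseteq> cbox a b"
    using box_cutoff_outside[OF assms(1)] box_subset_cbox by blast
  then have "closure {x. box_cutoff n a b x \<noteq> 0} \<subseteq> cbox a b"
    by (rule closure_minimal) (rule closed_cbox)
  then have "closure {x. box_cutoff n a b x \<noteq> 0} \<subseteq> \<Omega>" "compact (closure {x. box_cutoff n a b x \<noteq> 0})"
    using assms(2) compact_Int_closed[OF compact_cbox[of a b] closed_closure, of "{x. box_cutoff n a b x \<noteq> 0}"]
    by (auto simp: Int_absorb1)
  ultimately show ?thesis unfolding test_functions_def by blast
qed

section \<open>Uniqueness of weak gradients\<close>

text \<open>The positive and the negative part are densities of two measures that agree on the boxes,
  which are a generator stable under intersection.\<close>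

lemma AE_zero_if_box_integrals_zero:
  fixes f :: "'a::euclidean_space \<Rightarrow> real"
  assumes f: "integrable lborel f"
    and 0: "\<And>a b. (\<integral>x. indicator (box a b) x * f x \<partial>lborel) = 0"
  shows "AE x in lborel. f x = 0"
proof -
  note [measurable] = borel_measurable_integrable[OF f]
  let ?P = "density lborel (\<lambda>x. ennreal (f x))" and ?Q = "density lborel (\<lambda>x. ennreal (- f x))"
  have fin: "(\<integral>\<^sup>+x. ennreal (f x) \<partial>lborel) < \<infinity>" "(\<integral>\<^sup>+x. ennreal (- f x) \<partial>lborel) < \<infinity>"
    using f unfolding real_integrable_def by (auto simp: less_top)
  have box: "emeasure ?P (box a b) = emeasure ?Q (box a b) \<and> emeasure ?P (box a b) < \<infinity>" for a b
  proof -
    let ?g = "\<lambda>x. indicator (box a b) x * f x"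
    have g: "integrable lborel ?g" using integrable_mult_indicator[OF _ f, of "box a b"] by simp
    have eq: "emeasure ?P (box a b) = (\<integral>\<^sup>+x. ennreal (?g x) \<partial>lborel)"
      "emeasure ?Q (box a b) = (\<integral>\<^sup>+x. ennreal (- ?g x) \<partial>lborel)"
      by (auto simp: emeasure_density indicator_def intro!: nn_integral_cong)
    have fin': "(\<integral>\<^sup>+x. ennreal (?g x) \<partial>lborel) < \<infinity>" "(\<integral>\<^sup>+x. ennreal (- ?g x) \<partial>lborel) < \<infinity>"
      using g unfolding real_integrable_def by (auto simp: less_top)
    have "enn2real (\<integral>\<^sup>+x. ennreal (?g x) \<partial>lborel) = enn2real (\<integral>\<^sup>+x. ennreal (- ?g x) \<partial>lborel)"
      using real_lebesgue_integral_def[OF g] 0[of a b] by simp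
    then show ?thesis using fin' unfolding eq by (metis ennreal_enn2real infinity_ennreal_def)
  qed
  have "?P = ?Q"
  proof (rule measure_eqI_generator_eq)
    let ?E = "range (\<lambda>(a, b). box a b :: 'a set)"
    show "Int_stable ?E" by (auto simp: Int_stable_def box_Int_box)
    show "?E \<subseteq> Pow UNIV" "sets ?P = sigma_sets UNIV ?E" "sets ?Q = sigma_sets UNIV ?E"
      by (simp_all add: borel_eq_box)
    let ?A = "\<lambda>n::nat. box (- (real n *\<^sub>R One)) (real n *\<^sub>R One) :: 'a set"
    show "range ?A \<subseteq> ?E" "(\<Union>i. ?A i) = UNIV" unfolding UN_box_eq_UNIV by auto
    show "emeasure ?P (?A i) \<noteq> \<infinity>" for i using box by (metis order.irrefl)
    show "emeasure ?P X = emeasure ?Q X" if "X \<in> ?E" for X using that box by auto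
  qed
  then have "AE x in lborel. ennreal (f x) = ennreal (- f x)"
    by (subst (asm) sigma_finite_measure.density_unique_iff[OF sigma_finite_lborel]) auto
  then show ?thesis
  proof eventually_elim
    case (elim x)
    then show ?case by (cases "0 \<le> f x") (auto simp: ennreal_eq_0_iff ennreal_neg)
  qed
qed

lemma AE_zero_if_box_integrals_zero':
  fixes f :: "'a::euclidean_space \<Rightarrow> real"
  assumes f: "integrable lebesgue f"
    and 0: "\<And>a b. (\<integral>x. indicator (box a b) x * f x \<partial>lebesgue) = 0"
  shows "AE x in lebesgue. f x = 0"
proof -
  obtain g where g [measurable]: "g \<in> borel_measurable lborel" and fg: "AE x in lborel. f x = g x"
    using completion_ex_borel_measurable_real[of f lborel] f by auto
  have fgl: "AE x in lebesgue. f x = g x" using fg by (rule AE_completion)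
  have gl: "g \<in> borel_measurable lebesgue" by (rule measurable_completion) simp
  have "integrable lebesgue g"
    using f integrable_cong_AE[OF _ gl fgl] borel_measurable_integrable[OF f] by simp
  then have gi: "integrable lborel g" by (simp add: integrable_completion)
  have "(\<integral>x. indicator (box a b) x * g x \<partial>lborel) = 0" for a b
  proof -
    have [measurable]: "f \<in> borel_measurable lebesgue" "g \<in> borel_measurable lebesgue"
      using f gl by auto
    have [measurable]: "box a b \<in> sets lebesgue" by simp
    have "(\<integral>x. indicator (box a b) x * g x \<partial>lborel) = (\<integral>x. indicator (box a b) x * g x \<partial>lebesgue)"
      by (subst integral_completion) auto
    also have "\<dots> = (\<integral>x. indicator (box a b) x * f x \<partial>lebesgue)"
    proof (rule integral_cong_AE)
      show "AE x in lebesgue. indicator (box a b) x * g x = indicator (box a b) x * f x"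
        using fgl by eventually_elim simp
    qed measurable
    finally show ?thesis using 0 by simp
  qed
  then have "AE x in lborel. g x = 0" by (intro AE_zero_if_box_integrals_zero gi)
  then have "AE x in lebesgue. g x = 0" by (rule AE_completion)
  with fgl show ?thesis by eventually_elim simp
qed

text \<open>Tested with the cutoffs of a box, the definition shows that two weak gradients have the same
  integral over every box in \<open>\<Omega>\<close>. Uniqueness identifies the gradient that occurs in the equation with
  the limit of the gradients of the approximating test functions.\<close>

lemma weak_gradient_unique:
  fixes u :: "real^'n::finite \<Rightarrow> real"
  assumes \<Omega>: "open \<Omega>" and D1: "has_weak_gradient \<Omega> u D1" and D2: "has_weak_gradient \<Omega> u D2"
  shows "AE x in lebesgue_on \<Omega>. D1 x = D2 x"
proof -
  have \<Omega>l: "\<Omega> \<in> sets lebesgue" using \<Omega> by simp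
  have box0: "(\<integral>x. indicator (box a b) x * (D1 x $ i - D2 x $ i) \<partial>lebesgue) = 0 \<and>
      integrable lebesgue (\<lambda>x. indicator (box a b) x * (D1 x $ i - D2 x $ i))"
    if ab: "cbox a b \<subseteq> \<Omega>" for a b i
  proof (cases "box a b = {}")
    case False
    then have le: "a $ j \<le> b $ j" for j
      by (auto simp: interval_ne_empty_cart intro: less_imp_le)
    define g where "g D x = indicator (cbox a b) x * (D x $ i)" for D :: "real^'n \<Rightarrow> real^'n" and x
    have gi: "integrable lebesgue (g D)" if "has_weak_gradient \<Omega> u D" for D
    proof -
      have "integrable (lebesgue_on (cbox a b)) (\<lambda>x. D x $ i)"
        using that ab by (auto simp: has_weak_gradient_def locally_integrable_on_def)
      then show ?thesis by (subst (asm) integrable_restrict_space) (auto simp: g_def[abs_def])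
    qed
    have cut: "box_cutoff n a b \<in> test_functions \<Omega>" for n by (intro box_cutoff_test le ab)
    have eq: "(\<integral>x. D x $ i * box_cutoff n a b x \<partial>lebesgue_on \<Omega>) = (\<integral>x. g D x * box_cutoff n a b x \<partial>lebesgue)" for D n
    proof -
      have "(\<integral>x. D x $ i * box_cutoff n a b x \<partial>lebesgue_on \<Omega>)
          = (\<integral>x. indicator \<Omega> x *\<^sub>R (D x $ i * box_cutoff n a b x) \<partial>lebesgue)"
        using \<Omega>l by (intro integral_restrict_space) auto
      also have "\<dots> = (\<integral>x. g D x * box_cutoff n a b x \<partial>lebesgue)"
      proof (intro Bochner_Integration.integral_cong refl)
        fix x
        show "indicator \<Omega> x *\<^sub>R (D x $ i * box_cutoff n a b x) = g D x * box_cutoff n a b x"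
        proof (cases "x \<in> box a b")
          case True
          then have "x \<in> cbox a b" "x \<in> \<Omega>" using ab box_subset_cbox[of a b] by auto
          then show ?thesis by (simp add: g_def)
        next
          case False then show ?thesis using box_cutoff_outside[OF le] by simp
        qed
      qed
      finally show ?thesis .
    qed
    have lim: "(\<lambda>n. \<integral>x. g D x * box_cutoff n a b x \<partial>lebesgue) \<longlonglongrightarrow> (\<integral>x. g D x * indicator (box a b) x \<partial>lebesgue)"
      if "has_weak_gradient \<Omega> u D" for D
    proof (rule integral_dominated_convergence)
      note gi[OF that]
      then have [measurable]: "g D \<in> borel_measurable lebesgue" by simp
      have [measurable]: "box_cutoff n a b \<in> borel_measurable lebesgue" for n
        using test_function_measurable(1)[OF cut] by (intro measurable_completion) simp
      have [measurable]: "box a b \<in> sets lebesgue" by simp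
      show "(\<lambda>x. g D x * indicator (box a b) x) \<in> borel_measurable lebesgue"
        "(\<lambda>x. g D x * box_cutoff n a b x) \<in> borel_measurable lebesgue" for n by measurable
      show "integrable lebesgue (\<lambda>x. \<bar>g D x\<bar>)" using gi[OF that] by simp
      show "AE x in lebesgue. (\<lambda>n. g D x * box_cutoff n a b x) \<longlonglongrightarrow> g D x * indicator (box a b) x"
        by (intro AE_I2 tendsto_mult tendsto_const box_cutoff_tendsto le)
      show "AE x in lebesgue. norm (g D x * box_cutoff n a b x) \<le> \<bar>g D x\<bar>" for n
        using box_cutoff_bounds[of n a b] by (intro AE_I2) (auto simp: abs_mult mult_left_le)
    qed
    have eq12: "(\<integral>x. g D1 x * box_cutoff n a b x \<partial>lebesgue) = (\<integral>x. g D2 x * box_cutoff n a b x \<partial>lebesgue)" for n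
    proof -
      have "(\<integral>x. u x * partial_deriv i (box_cutoff n a b) x \<partial>lebesgue_on \<Omega>)
          = - (\<integral>x. D x $ i * box_cutoff n a b x \<partial>lebesgue_on \<Omega>)" if "has_weak_gradient \<Omega> u D" for D
        using that cut[of n] unfolding has_weak_gradient_def by blast
      from this[OF D1] this[OF D2] show ?thesis unfolding eq by linarith
    qed
    have lim12: "(\<integral>x. g D1 x * indicator (box a b) x \<partial>lebesgue) = (\<integral>x. g D2 x * indicator (box a b) x \<partial>lebesgue)"
      using LIMSEQ_unique[OF lim[OF D1]] lim[OF D2] by (simp add: eq12)
    have gb: "g D x * indicator (box a b) x = indicator (box a b) x * (D x $ i)" for D x
      using box_subset_cbox[of a b] by (auto simp: g_def indicator_def)
    have ib: "integrable lebesgue (\<lambda>x. indicator (box a b) x * (D x $ i))" if "has_weak_gradient \<Omega> u D" for D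
    proof -
      have "integrable lebesgue (\<lambda>x. indicator (box a b) x *\<^sub>R g D x)"
        by (rule integrable_mult_indicator[OF _ gi[OF that]]) simp
      then show ?thesis unfolding gb[symmetric] by (simp only: real_scaleR_def mult.commute[of "g D _"])
    qed
    show ?thesis
      unfolding right_diff_distrib
      using lim12[unfolded gb] Bochner_Integration.integral_diff[OF ib[OF D1] ib[OF D2]]
        Bochner_Integration.integrable_diff[OF ib[OF D1] ib[OF D2]] by simp
  qed simp
  have ae_box: "AE x in lebesgue. x \<in> box a b \<longrightarrow> D1 x $ i = D2 x $ i" if ab: "cbox a b \<subseteq> \<Omega>" for a b i
  proof -
    let ?f = "\<lambda>x. indicator (box a b) x * (D1 x $ i - D2 x $ i)"
    have "(\<integral>x. indicator (box c d) x * ?f x \<partial>lebesgue) = 0" for c d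
    proof -
      obtain a' b' where a'b': "box a b \<inter> box c d = box a' b'" by (auto simp: box_Int_box)
      have eq: "indicator (box c d) x * ?f x = indicator (box a' b') x * (D1 x $ i - D2 x $ i)" for x
        unfolding a'b'[symmetric] by (auto simp: indicator_def)
      show ?thesis
      proof (cases "box a' b' = {}")
        case True then show ?thesis unfolding eq by simp
      next
        case False
        then have "closure (box a' b') = cbox a' b'" by (rule closure_box)
        moreover have "closure (box a' b') \<subseteq> cbox a b"
          using a'b' box_subset_cbox[of a b] by (intro closure_minimal) auto
        ultimately show ?thesis unfolding eq using box0[of a' b' i] ab by auto
      qed
    qed
    then have "AE x in lebesgue. ?f x = 0"
      using box0[OF ab] by (intro AE_zero_if_box_integrals_zero') auto
    then show ?thesis by eventually_elim (auto simp: indicator_def split: if_splits)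
  qed
  have ae_cbox: "AE x in lebesgue. x \<in> cbox a b \<longrightarrow> D1 x $ i = D2 x $ i" if ab: "cbox a b \<subseteq> \<Omega>" for a b i
  proof -
    have "cbox a b - box a b \<in> null_sets lebesgue"
      using negligible_frontier_interval[of a b] by (simp add: negligible_iff_null_sets)
    then have "AE x in lebesgue. x \<notin> cbox a b - box a b" by (rule AE_not_in)
    with ae_box[OF ab, of i] show ?thesis by eventually_elim auto
  qed
  obtain \<D> where \<D>: "countable \<D>" "\<D> \<subseteq> Pow \<Omega>" "\<And>X. X \<in> \<D> \<Longrightarrow> \<exists>a b. X = cbox a b" "\<Union>\<D> = \<Omega>"
    using open_countable_Union_open_cbox[OF \<Omega>] by metis
  have "AE x in lebesgue. \<forall>X\<in>\<D>. \<forall>i. x \<in> X \<longrightarrow> D1 x $ i = D2 x $ i"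
  proof (subst AE_ball_countable[OF \<D>(1)], rule ballI)
    fix X assume "X \<in> \<D>"
    then obtain a b where "X = cbox a b" "cbox a b \<subseteq> \<Omega>" using \<D> by blast
    then show "AE x in lebesgue. \<forall>i. x \<in> X \<longrightarrow> D1 x $ i = D2 x $ i"
      using ae_cbox unfolding AE_all_countable by blast
  qed
  then have "AE x in lebesgue. x \<in> \<Omega> \<longrightarrow> D1 x = D2 x"
    by eventually_elim (use \<D>(4) in \<open>auto simp: vec_eq_iff\<close>)
  then show ?thesis using \<Omega>l by (simp add: AE_restrict_space_iff)
qed

section \<open>Measurability and dominated approximation\<close>

lemma complete_lebesgue_on:
  assumes "\<Omega> \<in> sets lebesgue" shows "complete_measure (lebesgue_on \<Omega>)"
proof
  fix A B assume "B \<subseteq> A" "A \<in> null_sets (lebesgue_on \<Omega>)"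
  then have "A \<in> null_sets lebesgue" "A \<subseteq> \<Omega>"
    using assms by (auto simp: null_sets_restrict_space)
  then have "B \<in> sets lebesgue" "B \<subseteq> \<Omega>"
    using completion.complete[OF \<open>B \<subseteq> A\<close>] \<open>B \<subseteq> A\<close> by auto
  then show "B \<in> sets (lebesgue_on \<Omega>)" using assms by (simp add: sets_restrict_space_iff)
qed

lemma measurable_lebesgue_on_AE:
  assumes \<Omega>: "\<Omega> \<in> sets lebesgue" and f: "f \<in> borel_measurable (lebesgue_on \<Omega>)"
    and ae: "AE x in lebesgue_on \<Omega>. f x = g x"
  shows "g \<in> borel_measurable (lebesgue_on \<Omega>)"
proof (rule measurableI)
  interpret complete_measure "lebesgue_on \<Omega>" by (rule complete_lebesgue_on[OF \<Omega>])
  fix A :: "'b set" assume A: "A \<in> sets borel"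
  show "g -` A \<inter> space (lebesgue_on \<Omega>) \<in> sets (lebesgue_on \<Omega>)"
  proof (rule in_sets_AE)
    show "f -` A \<inter> space (lebesgue_on \<Omega>) \<in> sets (lebesgue_on \<Omega>)" using f A by (rule measurable_sets)
    show "AE x in lebesgue_on \<Omega>. (x \<in> f -` A \<inter> space (lebesgue_on \<Omega>)) = (x \<in> g -` A \<inter> space (lebesgue_on \<Omega>))"
      using ae by eventually_elim auto
  qed auto
qed simp

text \<open>For simple functions \<open>v\<close> the composition is a finite sum of measurable functions, and
  continuity in the second variable carries this over to limits; completeness of the measure takes
  care of the exceptional null set.\<close>

lemma caratheodory_comp:
  fixes f :: "real^'n::finite \<Rightarrow> 'b::{metric_space, second_countable_topology} \<Rightarrow> real"
  assumes \<Omega>: "\<Omega> \<in> sets lebesgue" and f: "caratheodory \<Omega> f" and v: "v \<in> borel_measurable (lebesgue_on \<Omega>)"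
  shows "(\<lambda>x. f x (v x)) \<in> borel_measurable (lebesgue_on \<Omega>)"
proof -
  let ?M = "lebesgue_on \<Omega>"
  have [measurable]: "(\<lambda>x. f x y) \<in> borel_measurable ?M" for y using f by (simp add: caratheodory_def)
  have cont: "AE x in ?M. continuous_on UNIV (f x)" using f by (simp add: caratheodory_def)
  obtain F where F: "\<And>i. simple_function ?M (F i)" "\<And>x. x \<in> space ?M \<Longrightarrow> (\<lambda>i. F i x) \<longlonglongrightarrow> v x"
    using borel_measurable_implies_sequence_metric[OF v] by metis
  have m [measurable]: "(\<lambda>x. f x (F i x)) \<in> borel_measurable ?M" for i
  proof -
    have fin: "finite (F i ` space ?M)" and [measurable]: "\<And>y. F i -` {y} \<inter> space ?M \<in> sets ?M"
      using simple_functionD[OF F(1)[of i]] by auto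
    have "(\<lambda>x. \<Sum>y\<in>F i ` space ?M. indicator (F i -` {y} \<inter> space ?M) x * f x y) \<in> borel_measurable ?M"
      by measurable
    moreover have "(\<Sum>y\<in>F i ` space ?M. indicator (F i -` {y} \<inter> space ?M) x * f x y) = f x (F i x)"
      if "x \<in> space ?M" for x
    proof -
      have "(\<Sum>y\<in>F i ` space ?M. indicator (F i -` {y} \<inter> space ?M) x * f x y)
        = (\<Sum>y\<in>{F i x}. indicator (F i -` {y} \<inter> space ?M) x * f x y)"
        using that fin by (intro sum.mono_neutral_right) auto
      also have "\<dots> = f x (F i x)" using that by simp
      finally show ?thesis .
    qed
    ultimately show ?thesis by (subst (asm) measurable_cong)
  qed
  have "(\<lambda>x. lim (\<lambda>i. f x (F i x))) \<in> borel_measurable ?M" by measurable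
  moreover have "AE x in ?M. lim (\<lambda>i. f x (F i x)) = f x (v x)"
    using cont AE_space
  proof eventually_elim
    case (elim x)
    have "(\<lambda>i. f x (F i x)) \<longlonglongrightarrow> f x (v x)"
    proof (rule isCont_tendsto_compose[OF _ F(2)[OF elim(2)]])
      show "isCont (f x) (v x)" using elim(1) by (simp add: continuous_on_eq_continuous_at)
    qed
    then show ?case by (rule limI)
  qed
  ultimately show ?thesis by (rule measurable_lebesgue_on_AE[OF \<Omega>])
qed

text \<open>A subsequence whose \<open>L\<^sup>1\<close> norms are summable converges almost everywhere and is dominated by the
  sum of the absolute values.\<close>

lemma L1_dominated_subsequence:
  fixes f :: "nat \<Rightarrow> 'a \<Rightarrow> real"
  assumes f: "\<And>n. integrable M (f n)" "\<And>n x. 0 \<le> f n x" and lim: "(\<lambda>n. \<integral>x. f n x \<partial>M) \<longlonglongrightarrow> 0"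
  obtains r H where "strict_mono r" "integrable M H" "AE x in M. (\<lambda>n. f (r n) x) \<longlonglongrightarrow> 0"
    "AE x in M. \<forall>n. f (r n) x \<le> H x"
proof -
  have "\<exists>N. \<forall>m\<ge>N. (\<integral>x. f m x \<partial>M) < (1/2) ^ n" for n
    using order_tendstoD(2)[OF lim, of "(1/2) ^ n"] by (simp add: eventually_sequentially)
  then obtain N where N: "\<And>n m. N n \<le> m \<Longrightarrow> (\<integral>x. f m x \<partial>M) < (1/2) ^ n" by metis
  define r where "r n = (\<Sum>k\<le>n. N k) + n" for n
  have r: "strict_mono r" by (rule strict_monoI_Suc) (simp add: r_def)
  have "N n \<le> r n" for n
    using member_le_sum[of n "{..n}" N] by (simp add: r_def)
  then have small: "(\<integral>x. f (r n) x \<partial>M) < (1/2) ^ n" for n using N by blast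
  note [measurable] = borel_measurable_integrable[OF f(1)]
  have "(\<integral>\<^sup>+x. (\<Sum>n. ennreal (f (r n) x)) \<partial>M) = (\<Sum>n. \<integral>\<^sup>+x. ennreal (f (r n) x) \<partial>M)"
    by (intro nn_integral_suminf) measurable
  also have "\<dots> \<le> (\<Sum>n. ennreal ((1/2) ^ n))"
    using small by (intro suminf_le) (auto simp: nn_integral_eq_integral f intro!: ennreal_leI less_imp_le)
  also have "(\<Sum>n. ennreal ((1/2) ^ n)) \<noteq> top"
    by (rule ennreal_suminf_neq_top) (auto intro: summable_geometric)
  then have "(\<Sum>n. ennreal ((1/2) ^ n)) < \<infinity>" by (simp add: less_top)
  finally have "AE x in M. (\<Sum>n. ennreal (f (r n) x)) \<noteq> \<infinity>"
    by (intro nn_integral_PInf_AE) auto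
  then have sm: "AE x in M. summable (\<lambda>n. f (r n) x)"
    by eventually_elim (auto intro: summable_suminf_not_top f)
  have smi: "summable (\<lambda>n. \<integral>x. f (r n) x \<partial>M)"
    by (rule summable_comparison_test'[of "\<lambda>n. (1/2) ^ n" 0])
       (use small f in \<open>auto simp: summable_geometric intro: less_imp_le\<close>)
  show ?thesis
  proof (rule that[OF r, of "\<lambda>x. \<Sum>n. f (r n) x"])
    show "integrable M (\<lambda>x. \<Sum>n. f (r n) x)"
      using sm smi f by (intro integrable_suminf) auto
    show "AE x in M. (\<lambda>n. f (r n) x) \<longlonglongrightarrow> 0"
      using sm by eventually_elim (rule summable_LIMSEQ_zero)
    show "AE x in M. \<forall>n. f (r n) x \<le> (\<Sum>n. f (r n) x)"
      using sm
    proof eventually_elim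
      case (elim x)
      show ?case
      proof
        fix n
        show "f (r n) x \<le> (\<Sum>n. f (r n) x)" using sum_le_suminf[OF elim, of "{n}"] f by simp
      qed
    qed
  qed
qed

lemma abs_powr_add_le:
  fixes a b q :: real
  assumes "0 < q"
  shows "\<bar>a + b\<bar> powr q \<le> 2 powr q * (\<bar>a\<bar> powr q + \<bar>b\<bar> powr q)"
proof -
  have "\<bar>a + b\<bar> powr q \<le> (2 * max \<bar>a\<bar> \<bar>b\<bar>) powr q" using assms by (intro powr_mono2) auto
  also have "\<dots> = 2 powr q * (max \<bar>a\<bar> \<bar>b\<bar>) powr q" by (simp add: powr_mult)
  also have "\<dots> \<le> 2 powr q * (\<bar>a\<bar> powr q + \<bar>b\<bar> powr q)"
    by (intro mult_left_mono) (auto simp: max_def)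
  finally show ?thesis .
qed

lemma Lp_space_diff:
  assumes "0 < q" and v: "v \<in> Lp_space q \<Omega>" and w: "w \<in> Lp_space q \<Omega>"
  shows "integrable (lebesgue_on \<Omega>) (\<lambda>x. \<bar>v x - w x\<bar> powr q)"
proof -
  have [measurable]: "v \<in> borel_measurable (lebesgue_on \<Omega>)" "w \<in> borel_measurable (lebesgue_on \<Omega>)"
    using v w by (auto simp: Lp_space_def)
  have "integrable (lebesgue_on \<Omega>) (\<lambda>x. 2 powr q * (\<bar>v x\<bar> powr q + \<bar>w x\<bar> powr q))"
    using v w by (auto simp: Lp_space_def)
  then show ?thesis
  proof (rule Bochner_Integration.integrable_bound)
    show "AE x in lebesgue_on \<Omega>. norm (\<bar>v x - w x\<bar> powr q) \<le> norm (2 powr q * (\<bar>v x\<bar> powr q + \<bar>w x\<bar> powr q))"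
      using abs_powr_add_le[OF assms(1), of "v x" "- w x" for x] by (intro AE_I2) simp
  qed measurable
qed

lemma test_function_Lp:
  assumes \<phi>: "\<phi> \<in> test_functions \<Omega>" and \<Omega>: "\<Omega> \<in> sets lebesgue" and q: "0 < q"
  shows "partial_deriv i \<phi> \<in> Lp_space q \<Omega>" "\<phi> \<in> Lp_space q \<Omega>"
proof -
  note [measurable] = test_function_measurable[OF \<phi>]
  let ?K = "closure {x. \<phi> x \<noteq> 0}"
  have K: "emeasure lborel ?K < \<infinity>" "?K \<in> sets lborel"
    using emeasure_compact_finite[OF test_functionsD(4)[OF \<phi>]] test_functionsD(4)[OF \<phi>]
    by (simp_all add: borel_compact)
  obtain C where C: "C > 0" "\<And>x. \<bar>\<phi> x\<bar> \<le> C" "\<And>x i. \<bar>partial_deriv i \<phi> x\<bar> \<le> C"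
    using test_function_bounded[OF \<phi>] by metis
  have gen: "f \<in> Lp_space q \<Omega>" if [measurable]: "f \<in> borel_measurable borel"
    and f: "\<And>x. \<bar>f x\<bar> \<le> C" "\<And>x. x \<notin> ?K \<Longrightarrow> f x = 0" for f
  proof -
    have "integrable lborel (\<lambda>x. \<bar>f x\<bar> powr q)"
      by (rule integrable_bounded_support[where A = ?K and C = "C powr q"])
         (use K f C q in \<open>auto intro!: powr_mono2\<close>)
    moreover have "f x = 0" if "x \<notin> \<Omega>" for x
      using f(2)[of x] test_functionsD(5)[OF \<phi>] that by auto
    ultimately have "integrable (lebesgue_on \<Omega>) (\<lambda>x. \<bar>f x\<bar> powr q)"
      by (subst lebesgue_on_integral_eq(2)[OF _ \<Omega>]) auto
    then show ?thesis unfolding Lp_space_def by (auto intro: borel_measurable_lebesgue_onI)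
  qed
  show "partial_deriv i \<phi> \<in> Lp_space q \<Omega>"
    using C partial_deriv_outside[OF \<phi>] by (intro gen) auto
  have "\<phi> x = 0" if "x \<notin> ?K" for x using that closure_subset[of "{x. \<phi> x \<noteq> 0}"] by auto
  from gen[OF _ C(2) this] show "\<phi> \<in> Lp_space q \<Omega>" by simp
qed

lemma Lp_norm_tendsto_0:
  assumes q: "0 < q" and lim: "(\<lambda>k. Lp_norm q \<Omega> (v k)) \<longlonglongrightarrow> 0"
  shows "(\<lambda>k. \<integral>x. \<bar>v k x\<bar> powr q \<partial>lebesgue_on \<Omega>) \<longlonglongrightarrow> 0"
proof -
  have "(\<lambda>k. Lp_norm q \<Omega> (v k) powr q) \<longlonglongrightarrow> 0"
    by (rule tendsto_zero_powrI[OF lim tendsto_const _ q]) (simp add: Lp_norm_def)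
  moreover have "Lp_norm q \<Omega> (v k) powr q = (\<integral>x. \<bar>v k x\<bar> powr q \<partial>lebesgue_on \<Omega>)" for k
    using q by (simp add: Lp_norm_def powr_powr)
  ultimately show ?thesis by simp
qed

text \<open>Approximation by test functions with an integrable majorant for all derivatives: it reduces
  every passage to the limit below to dominated convergence or Fatou's lemma.\<close>

definition dominated_approx ::
    "('n::finite \<Rightarrow> real) \<Rightarrow> (real^'n) set \<Rightarrow> (real^'n \<Rightarrow> real) \<Rightarrow> (real^'n \<Rightarrow> real^'n) \<Rightarrow>
     (nat \<Rightarrow> real^'n \<Rightarrow> real) \<Rightarrow> (real^'n \<Rightarrow> real) \<Rightarrow> bool" where
  "dominated_approx p \<Omega> u Du \<phi> H \<longleftrightarrow>
     u \<in> borel_measurable (lebesgue_on \<Omega>) \<and> (\<forall>i. (\<lambda>x. Du x $ i) \<in> Lp_space (p i) \<Omega>) \<and>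
     (\<forall>k. \<phi> k \<in> test_functions \<Omega>) \<and> integrable (lebesgue_on \<Omega>) H \<and>
     (AE x in lebesgue_on \<Omega>. (\<lambda>k. \<phi> k x) \<longlonglongrightarrow> u x) \<and>
     (\<forall>i. AE x in lebesgue_on \<Omega>. (\<lambda>k. partial_deriv i (\<phi> k) x) \<longlonglongrightarrow> Du x $ i) \<and>
     (\<forall>i. AE x in lebesgue_on \<Omega>. \<forall>k. \<bar>partial_deriv i (\<phi> k) x\<bar> powr p i \<le> H x) \<and>
     (\<forall>i. AE x in lebesgue_on \<Omega>. \<bar>Du x $ i\<bar> powr p i \<le> H x)"

lemma W0_dominated_approximation:
  fixes u :: "real^'n::finite \<Rightarrow> real"
  assumes u: "u \<in> W0_space p \<Omega>" and p: "\<And>i. 1 < p i" and \<Omega>: "\<Omega> \<in> sets lebesgue"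
  obtains Du \<phi> H where "has_weak_gradient \<Omega> u Du" "dominated_approx p \<Omega> u Du \<phi> H"
proof -
  let ?M = "lebesgue_on \<Omega>"
  have p0: "0 < p i" for i using p[of i] by simp
  obtain Du \<phi> where Du: "has_weak_gradient \<Omega> u Du" "\<And>i. (\<lambda>x. Du x $ i) \<in> Lp_space (p i) \<Omega>"
    and \<phi>: "\<And>k::nat. \<phi> k \<in> test_functions \<Omega>"
    and l1: "(\<lambda>k. \<Sum>i\<in>UNIV. Lp_norm (p i) \<Omega> (\<lambda>x. partial_deriv i (\<phi> k) x - Du x $ i)) \<longlonglongrightarrow> 0"
    and l2: "(\<lambda>k. Lp_norm 1 \<Omega> (\<lambda>x. \<phi> k x - u x)) \<longlonglongrightarrow> 0" and u1: "u \<in> Lp_space 1 \<Omega>"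
    using u unfolding W0_space_def by blast
  define h where "h k x = (\<Sum>i\<in>UNIV. \<bar>partial_deriv i (\<phi> k) x - Du x $ i\<bar> powr p i) + \<bar>\<phi> k x - u x\<bar> powr 1" for k x
  have i1: "integrable ?M (\<lambda>x. \<bar>partial_deriv i (\<phi> k) x - Du x $ i\<bar> powr p i)" for i k
    by (intro Lp_space_diff test_function_Lp(1)[OF \<phi>] \<Omega> Du p0)
  have i2: "integrable ?M (\<lambda>x. \<bar>\<phi> k x - u x\<bar> powr 1)" for k
    by (intro Lp_space_diff test_function_Lp(2)[OF \<phi>] \<Omega> u1) auto
  have hi: "integrable ?M (h k)" for k unfolding h_def by (intro Bochner_Integration.integrable_add Bochner_Integration.integrable_sum i1 i2)
  have h0: "0 \<le> h k x" for k x unfolding h_def by (intro add_nonneg_nonneg sum_nonneg) auto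
  have lim1: "(\<lambda>k. \<integral>x. \<bar>partial_deriv i (\<phi> k) x - Du x $ i\<bar> powr p i \<partial>?M) \<longlonglongrightarrow> 0" for i
  proof (rule Lp_norm_tendsto_0[OF p0])
    show "(\<lambda>k. Lp_norm (p i) \<Omega> (\<lambda>x. partial_deriv i (\<phi> k) x - Du x $ i)) \<longlonglongrightarrow> 0"
    proof (rule tendsto_sandwich[OF _ _ tendsto_const l1])
      show "\<forall>\<^sub>F k in sequentially. 0 \<le> Lp_norm (p i) \<Omega> (\<lambda>x. partial_deriv i (\<phi> k) x - Du x $ i)"
        by (simp add: Lp_norm_def)
      show "\<forall>\<^sub>F k in sequentially. Lp_norm (p i) \<Omega> (\<lambda>x. partial_deriv i (\<phi> k) x - Du x $ i)
          \<le> (\<Sum>i\<in>UNIV. Lp_norm (p i) \<Omega> (\<lambda>x. partial_deriv i (\<phi> k) x - Du x $ i))"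
        by (intro always_eventually allI member_le_sum) (auto simp: Lp_norm_def)
    qed
  qed
  have lim2: "(\<lambda>k. \<integral>x. \<bar>\<phi> k x - u x\<bar> powr 1 \<partial>?M) \<longlonglongrightarrow> 0"
    using Lp_norm_tendsto_0[OF _ l2] by simp
  have "(\<lambda>k. (\<Sum>i\<in>UNIV. \<integral>x. \<bar>partial_deriv i (\<phi> k) x - Du x $ i\<bar> powr p i \<partial>?M) + (\<integral>x. \<bar>\<phi> k x - u x\<bar> powr 1 \<partial>?M))
      \<longlonglongrightarrow> (\<Sum>i\<in>(UNIV::'n set). 0) + 0"
    by (intro tendsto_add tendsto_sum lim1 lim2)
  then have hlim: "(\<lambda>k. \<integral>x. h k x \<partial>?M) \<longlonglongrightarrow> 0"
    unfolding h_def by (simp add: Bochner_Integration.integral_add Bochner_Integration.integral_sum i1 i2[simplified] Bochner_Integration.integrable_sum)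
  obtain r H where r: "strict_mono r" "integrable ?M H" "AE x in ?M. (\<lambda>n. h (r n) x) \<longlonglongrightarrow> 0"
    "AE x in ?M. \<forall>n. h (r n) x \<le> H x"
    by (rule L1_dominated_subsequence[OF hi h0 hlim])
  have hge1: "\<bar>partial_deriv i (\<phi> k) x - Du x $ i\<bar> powr p i \<le> h k x" for i k x
  proof -
    have "\<bar>partial_deriv i (\<phi> k) x - Du x $ i\<bar> powr p i \<le> (\<Sum>i\<in>UNIV. \<bar>partial_deriv i (\<phi> k) x - Du x $ i\<bar> powr p i)"
      by (intro member_le_sum) auto
    then show ?thesis unfolding h_def by (smt (verit) powr_ge_zero)
  qed
  have hge2: "\<bar>\<phi> k x - u x\<bar> \<le> h k x" for k x
    unfolding h_def by (simp add: sum_nonneg)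
  define H' where "H' x = (\<Sum>i\<in>UNIV. 2 powr p i * (H x + \<bar>Du x $ i\<bar> powr p i)) + (\<Sum>i\<in>UNIV. \<bar>Du x $ i\<bar> powr p i)" for x
  show ?thesis
  proof (rule that[OF Du(1), of "\<phi> \<circ> r" H'], unfold dominated_approx_def, intro conjI allI)
    show "u \<in> borel_measurable ?M" using u1 by (simp add: Lp_space_def)
    show "(\<lambda>x. Du x $ i) \<in> Lp_space (p i) \<Omega>" for i by (rule Du(2))
    show "(\<phi> \<circ> r) k \<in> test_functions \<Omega>" for k using \<phi> by simp
    show "integrable ?M H'"
      unfolding H'_def using Du(2) r(2)
      by (intro Bochner_Integration.integrable_add Bochner_Integration.integrable_sum integrable_mult_right) (auto simp: Lp_space_def)
    show "AE x in ?M. (\<lambda>k. (\<phi> \<circ> r) k x) \<longlonglongrightarrow> u x"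
      using r(3)
    proof eventually_elim
      case (elim x)
      have "(\<lambda>k. \<phi> (r k) x - u x) \<longlonglongrightarrow> 0"
        by (rule Lim_null_comparison[OF _ elim]) (use hge2 in auto)
      then show ?case by (simp add: LIM_zero_iff)
    qed
    have Hpos: "AE x in ?M. 0 \<le> H x" using r(4) by eventually_elim (use h0 order_trans in blast)
    show "AE x in ?M. (\<lambda>k. partial_deriv i ((\<phi> \<circ> r) k) x) \<longlonglongrightarrow> Du x $ i" for i
      using r(3)
    proof eventually_elim
      case (elim x)
      have "(\<lambda>k. \<bar>partial_deriv i (\<phi> (r k)) x - Du x $ i\<bar> powr p i) \<longlonglongrightarrow> 0"
        by (rule tendsto_sandwich[OF _ _ tendsto_const elim]) (use hge1 in auto)
      then have "(\<lambda>k. (\<bar>partial_deriv i (\<phi> (r k)) x - Du x $ i\<bar> powr p i) powr (1 / p i)) \<longlonglongrightarrow> 0"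
        by (rule tendsto_zero_powrI[OF _ tendsto_const]) (use p0[of i] in auto)
      then have "(\<lambda>k. \<bar>partial_deriv i (\<phi> (r k)) x - Du x $ i\<bar>) \<longlonglongrightarrow> 0"
        using p0[of i] by (simp add: powr_powr)
      then show ?case by (simp add: LIM_zero_iff tendsto_rabs_zero_iff)
    qed
    have sumpos: "0 \<le> (\<Sum>i\<in>UNIV. \<bar>Du x $ i\<bar> powr p i)" for x by (intro sum_nonneg) auto
    show "AE x in ?M. \<forall>k. \<bar>partial_deriv i ((\<phi> \<circ> r) k) x\<bar> powr p i \<le> H' x" for i
      using r(4) Hpos
    proof eventually_elim
      case (elim x)
      show ?case
      proof
        fix k
        have "\<bar>partial_deriv i ((\<phi> \<circ> r) k) x\<bar> powr p i
            \<le> 2 powr p i * (\<bar>partial_deriv i (\<phi> (r k)) x - Du x $ i\<bar> powr p i + \<bar>Du x $ i\<bar> powr p i)"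
          using abs_powr_add_le[OF p0[of i], of "partial_deriv i (\<phi> (r k)) x - Du x $ i" "Du x $ i"] by simp
        also have "\<dots> \<le> 2 powr p i * (H x + \<bar>Du x $ i\<bar> powr p i)"
          using elim hge1[of i "r k" x] by (intro mult_left_mono add_right_mono) (auto intro: order_trans)
        also have "\<dots> \<le> (\<Sum>i\<in>UNIV. 2 powr p i * (H x + \<bar>Du x $ i\<bar> powr p i))"
          using elim by (intro member_le_sum) auto
        also have "\<dots> \<le> H' x" unfolding H'_def using sumpos by simp
        finally show "\<bar>partial_deriv i ((\<phi> \<circ> r) k) x\<bar> powr p i \<le> H' x" .
      qed
    qed
    show "AE x in ?M. \<bar>Du x $ i\<bar> powr p i \<le> H' x" for i
      using Hpos
    proof eventually_elim
      case (elim x)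
      have "\<bar>Du x $ i\<bar> powr p i \<le> (\<Sum>i\<in>UNIV. \<bar>Du x $ i\<bar> powr p i)" by (intro member_le_sum) auto
      also have "\<dots> \<le> H' x" unfolding H'_def using elim by (simp add: sum_nonneg)
      finally show ?case .
    qed
  qed
qed

section \<open>Weighted truncations as test functions\<close>

text \<open>The derivative of \<open>t * wt \<gamma> \<epsilon> t\<close>.\<close>

definition dwt :: "real \<Rightarrow> real \<Rightarrow> real \<Rightarrow> real" where
  "dwt \<gamma> \<epsilon> t = wt \<gamma> \<epsilon> t * (1 + \<gamma> * ((1 - \<epsilon>) * t\<^sup>2 / ((1 + t\<^sup>2) * (1 + \<epsilon> * t\<^sup>2))))"

context
  fixes \<gamma> \<epsilon> :: real
  assumes \<gamma>: "0 \<le> \<gamma>" and \<epsilon>: "0 < \<epsilon>" "\<epsilon> \<le> 1"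
begin

lemma dwt_bounds: "wt \<gamma> \<epsilon> t \<le> dwt \<gamma> \<epsilon> t" "dwt \<gamma> \<epsilon> t \<le> (1 + \<gamma>) * wt \<gamma> \<epsilon> t" "0 \<le> dwt \<gamma> \<epsilon> t"
proof -
  let ?r = "(1 - \<epsilon>) * t\<^sup>2 / ((1 + t\<^sup>2) * (1 + \<epsilon> * t\<^sup>2))"
  have pos: "0 < 1 + \<epsilon> * t\<^sup>2" "0 < 1 + t\<^sup>2" using wt_base(1)[OF \<epsilon>, of t] by (auto simp: add_pos_nonneg)
  have r0: "0 \<le> ?r" using \<epsilon> pos by (intro divide_nonneg_pos mult_nonneg_nonneg mult_pos_pos) auto
  have "(1 - \<epsilon>) * t\<^sup>2 \<le> 1 * t\<^sup>2" using \<epsilon> by (intro mult_right_mono) auto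
  also have "\<dots> \<le> (1 + t\<^sup>2) * 1" by simp
  also have "\<dots> \<le> (1 + t\<^sup>2) * (1 + \<epsilon> * t\<^sup>2)" using \<epsilon> pos by (intro mult_left_mono) auto
  finally have r1: "?r \<le> 1" using pos by (simp add: divide_le_eq)
  have w: "0 \<le> wt \<gamma> \<epsilon> t" by (rule wt_pos[OF \<gamma> \<epsilon>])
  have a: "1 \<le> 1 + \<gamma> * ?r" using mult_nonneg_nonneg[OF \<gamma> r0] by linarith
  have b: "1 + \<gamma> * ?r \<le> 1 + \<gamma>" using mult_left_mono[OF r1 \<gamma>] by simp
  show "wt \<gamma> \<epsilon> t \<le> dwt \<gamma> \<epsilon> t" using mult_left_mono[OF a w] by (simp add: dwt_def)
  then show "0 \<le> dwt \<gamma> \<epsilon> t" using w by linarith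
  show "dwt \<gamma> \<epsilon> t \<le> (1 + \<gamma>) * wt \<gamma> \<epsilon> t" using mult_left_mono[OF b w] by (simp add: dwt_def mult.commute)
qed

lemma dwt_continuous: "continuous_on UNIV (dwt \<gamma> \<epsilon>)"
proof -
  have "1 + \<epsilon> * t\<^sup>2 \<noteq> 0" "1 + t\<^sup>2 \<noteq> 0" for t
    using wt_base(1)[OF \<epsilon>, of t] by (auto simp: add_nonneg_eq_0_iff)
  then show ?thesis unfolding dwt_def[abs_def] using wt_continuous[OF \<gamma> \<epsilon>]
    by (intro continuous_intros) auto
qed

lemma dwt_measurable [measurable]:
  "f \<in> borel_measurable M \<Longrightarrow> (\<lambda>x. dwt \<gamma> \<epsilon> (f x)) \<in> borel_measurable M"
  using borel_measurable_continuous_onI[OF dwt_continuous] by (rule measurable_compose[rotated])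

lemma dwt_deriv: "((\<lambda>t. t * wt \<gamma> \<epsilon> t) has_real_derivative dwt \<gamma> \<epsilon> t) (at t)"
proof -
  let ?n = "1 + t\<^sup>2" and ?m = "1 + \<epsilon> * t\<^sup>2"
  have pos: "0 < ?m" "0 < ?n" "0 < ?n / ?m" using wt_base(1,2)[OF \<epsilon>, of t] by (auto simp: add_pos_nonneg)
  have z: "((\<lambda>t. (1 + t\<^sup>2) / (1 + \<epsilon> * t\<^sup>2)) has_real_derivative
      2 * t * (1 - \<epsilon>) / ?m\<^sup>2) (at t)"
    using pos by (auto intro!: derivative_eq_intros simp: power2_eq_square field_simps)
  have "((\<lambda>t. ((1 + t\<^sup>2) / (1 + \<epsilon> * t\<^sup>2)) powr (\<gamma> / 2)) has_real_derivative
      \<gamma> / 2 * (?n / ?m) powr (\<gamma> / 2 - 1) * (2 * t * (1 - \<epsilon>) / ?m\<^sup>2)) (at t)"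
    using has_real_derivative_powr'[OF z, of "\<lambda>_. \<gamma> / 2" 0] pos
    by (rule_tac DERIV_cong[OF DERIV_fun_powr[OF z]]) (auto simp: of_nat_1)
  moreover have "(?n / ?m) powr (\<gamma> / 2 - 1) = wt \<gamma> \<epsilon> t * (?m / ?n)"
    using pos by (simp add: wt_def powr_diff)
  ultimately have w: "(wt \<gamma> \<epsilon> has_real_derivative
      \<gamma> / 2 * (wt \<gamma> \<epsilon> t * (?m / ?n)) * (2 * t * (1 - \<epsilon>) / ?m\<^sup>2)) (at t)"
    by (simp add: wt_def[abs_def])
  have "((\<lambda>t. t * wt \<gamma> \<epsilon> t) has_real_derivative
      1 * wt \<gamma> \<epsilon> t + (\<gamma> / 2 * (wt \<gamma> \<epsilon> t * (?m / ?n)) * (2 * t * (1 - \<epsilon>) / ?m\<^sup>2)) * t) (at t)"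
    by (rule DERIV_mult[OF DERIV_ident w])
  moreover have "1 * wt \<gamma> \<epsilon> t + (\<gamma> / 2 * (wt \<gamma> \<epsilon> t * (?m / ?n)) * (2 * t * (1 - \<epsilon>) / ?m\<^sup>2)) * t = dwt \<gamma> \<epsilon> t"
    unfolding dwt_def using pos by (simp add: power2_eq_square divide_simps) (simp add: algebra_simps)
  ultimately show ?thesis by simp
qed

lemma truncation_test_function:
  fixes \<phi> :: "real^'n::finite \<Rightarrow> real"
  assumes \<phi>: "\<phi> \<in> test_functions \<Omega>"
  defines "\<psi> \<equiv> \<lambda>x. \<phi> x * wt \<gamma> \<epsilon> (\<phi> x)"
  shows "\<psi> \<in> test_functions \<Omega>" "partial_deriv i \<psi> x = dwt \<gamma> \<epsilon> (\<phi> x) * partial_deriv i \<phi> x"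
proof -
  have C: "Ck_fun k \<phi>" for k using \<phi> by (simp add: test_functions_def)
  have pos: "0 < 1 + \<epsilon> * (\<phi> x * \<phi> x)" "0 < 1 + \<phi> x * \<phi> x" for x
    using wt_base(1)[OF \<epsilon>, of "\<phi> x"] by (auto simp: add_pos_nonneg power2_eq_square)
  have "Ck_fun k (\<lambda>x. (1 + \<phi> x * \<phi> x) * (1 + \<epsilon> * (\<phi> x * \<phi> x)) powr (-1))" for k
    using pos by (intro Ck_fun_mult Ck_fun_powr Ck_fun_add Ck_fun_const C) auto
  moreover have zpos: "0 < (1 + \<phi> x * \<phi> x) * (1 + \<epsilon> * (\<phi> x * \<phi> x)) powr (-1)" for x
    using pos[of x] by (metis less_irrefl mult_pos_pos powr_gt_zero)
  ultimately have "Ck_fun k (\<lambda>x. ((1 + \<phi> x * \<phi> x) * (1 + \<epsilon> * (\<phi> x * \<phi> x)) powr (-1)) powr (\<gamma> / 2))" for k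
    using Ck_fun_powr[where f = "\<lambda>x. (1 + \<phi> x * \<phi> x) * (1 + \<epsilon> * (\<phi> x * \<phi> x)) powr (-1)"] by blast
  moreover have "((1 + \<phi> x * \<phi> x) * (1 + \<epsilon> * (\<phi> x * \<phi> x)) powr (-1)) powr (\<gamma> / 2) = wt \<gamma> \<epsilon> (\<phi> x)" for x
  proof -
    have "(1 + \<epsilon> * (\<phi> x * \<phi> x)) powr (-1) = inverse (1 + \<epsilon> * (\<phi> x * \<phi> x))"
      using powr_minus[of "1 + \<epsilon> * (\<phi> x * \<phi> x)" 1] pos[of x] by simp
    then show ?thesis by (simp only: wt_def power2_eq_square divide_inverse)
  qed
  ultimately have "Ck_fun k (\<lambda>x. wt \<gamma> \<epsilon> (\<phi> x))" for k by simp
  then have "Ck_fun k \<psi>" for k unfolding \<psi>_def by (intro Ck_fun_mult C)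
  moreover have "{x. \<psi> x \<noteq> 0} = {x. \<phi> x \<noteq> 0}"
    unfolding \<psi>_def using wt_pos(1)[OF \<gamma> \<epsilon>] by (auto simp: less_imp_neq[symmetric])
  ultimately show "\<psi> \<in> test_functions \<Omega>" using \<phi> by (simp add: test_functions_def)
  have "(\<phi> has_derivative frechet_derivative \<phi> (at x)) (at x)"
    using test_functionsD(3)[OF \<phi>] frechet_derivative_works by blast
  from has_derivative_compose[OF this dwt_deriv[of "\<phi> x", unfolded has_field_derivative_def]]
  have "(\<psi> has_derivative (\<lambda>h. dwt \<gamma> \<epsilon> (\<phi> x) * frechet_derivative \<phi> (at x) h)) (at x)"
    by (simp add: \<psi>_def)
  from partial_deriv_eqI[OF this] show "partial_deriv i \<psi> x = dwt \<gamma> \<epsilon> (\<phi> x) * partial_deriv i \<phi> x"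
    by (simp add: partial_deriv_def)
qed

end

section \<open>Passage to the limit from test functions\<close>

lemma Young_scaled:
  fixes p \<delta> x y :: real
  assumes p: "1 < p" and \<delta>: "0 < \<delta>" and xy: "0 \<le> x" "0 \<le> y"
  shows "x * y \<le> \<delta> * y powr p + \<delta> powr (- (conj_exponent p / p)) * x powr conj_exponent p"
proof -
  let ?q = "conj_exponent p"
  have q: "1 < ?q" "1 / p + 1 / ?q = 1" using p by (simp_all add: conj_exponent_def field_simps)
  have "x * y = (\<delta> powr (- (1 / p)) * x) * (\<delta> powr (1 / p) * y)"
    using \<delta> by (simp add: powr_minus field_simps)
  also have "\<dots> = (\<delta> powr (1 / p) * y) * (\<delta> powr (- (1 / p)) * x)" by (rule mult.commute)
  also have "\<dots> \<le> (\<delta> powr (1 / p) * y) powr p / p + (\<delta> powr (- (1 / p)) * x) powr ?q / ?q"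
    using p q xy by (intro Youngs_inequality) auto
  also have "\<dots> \<le> (\<delta> powr (1 / p) * y) powr p / 1 + (\<delta> powr (- (1 / p)) * x) powr ?q / 1"
    using p q by (intro add_mono divide_left_mono) auto
  also have "\<dots> = \<delta> * y powr p + \<delta> powr (- (?q / p)) * x powr ?q"
    using p \<delta> xy by (simp add: powr_mult powr_powr)
  finally show ?thesis .
qed

lemma conj_exponent_gt_1: "1 < p \<Longrightarrow> 1 < conj_exponent p"
  by (simp add: conj_exponent_def field_simps)

context
  fixes p :: "'n::finite \<Rightarrow> real" and \<Omega> :: "(real^'n) set" and u Du \<phi> H and \<gamma> \<epsilon> :: real
  assumes p: "\<And>i. 1 < p i" and \<Omega>: "\<Omega> \<in> sets lebesgue"
    and app: "dominated_approx p \<Omega> u Du \<phi> H" and \<gamma>: "0 \<le> \<gamma>" and \<epsilon>: "0 < \<epsilon>" "\<epsilon> \<le> 1"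
begin

lemma approx_measurable:
  "u \<in> borel_measurable (lebesgue_on \<Omega>)" "(\<lambda>x. Du x $ i) \<in> borel_measurable (lebesgue_on \<Omega>)"
  "Du \<in> borel_measurable (lebesgue_on \<Omega>)" "\<phi> k \<in> borel_measurable (lebesgue_on \<Omega>)"
  "partial_deriv i (\<phi> k) \<in> borel_measurable (lebesgue_on \<Omega>)"
  using app test_function_measurable[of "\<phi> k" \<Omega>]
  by (auto simp: dominated_approx_def Lp_space_def intro: borel_measurable_vecI borel_measurable_lebesgue_onI)

lemma tendsto_comp_approx:
  assumes "continuous_on UNIV (f :: real \<Rightarrow> real)"
  shows "AE x in lebesgue_on \<Omega>. (\<lambda>k. f (\<phi> k x)) \<longlonglongrightarrow> f (u x)"
proof -
  have "AE x in lebesgue_on \<Omega>. (\<lambda>k. \<phi> k x) \<longlonglongrightarrow> u x" using app by (simp add: dominated_approx_def)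
  then show ?thesis
  proof eventually_elim
    case (elim x)
    show ?case
      by (rule isCont_tendsto_compose[OF _ elim]) (use assms in \<open>simp add: continuous_on_eq_continuous_at\<close>)
  qed
qed

lemma energy_integrable: "integrable (lebesgue_on \<Omega>) (\<lambda>x. wt \<gamma> \<epsilon> (u x) * \<bar>Du x $ i\<bar> powr p i)"
  and energy_tendsto: "(\<lambda>k. \<integral>x. wt \<gamma> \<epsilon> (\<phi> k x) * \<bar>partial_deriv i (\<phi> k) x\<bar> powr p i \<partial>lebesgue_on \<Omega>)
    \<longlonglongrightarrow> (\<integral>x. wt \<gamma> \<epsilon> (u x) * \<bar>Du x $ i\<bar> powr p i \<partial>lebesgue_on \<Omega>)"
proof -
  let ?M = "lebesgue_on \<Omega>" and ?c = "(1 / \<epsilon>) powr (\<gamma> / 2)"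
  note [measurable] = approx_measurable wt_measurable[OF \<gamma> \<epsilon>]
  have H: "integrable ?M (\<lambda>x. ?c * H x)" using app by (auto simp: dominated_approx_def)
  have c: "0 \<le> wt \<gamma> \<epsilon> t" "wt \<gamma> \<epsilon> t \<le> ?c" for t by (rule wt_pos[OF \<gamma> \<epsilon>], rule wt_le[OF \<gamma> \<epsilon>])
  have m1: "(\<lambda>x. wt \<gamma> \<epsilon> (u x) * \<bar>Du x $ i\<bar> powr p i) \<in> borel_measurable ?M"
    "(\<lambda>x. wt \<gamma> \<epsilon> (\<phi> k x) * \<bar>partial_deriv i (\<phi> k) x\<bar> powr p i) \<in> borel_measurable ?M" for k
    by measurable
  have lim: "AE x in ?M. (\<lambda>k. wt \<gamma> \<epsilon> (\<phi> k x) * \<bar>partial_deriv i (\<phi> k) x\<bar> powr p i)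
      \<longlonglongrightarrow> wt \<gamma> \<epsilon> (u x) * \<bar>Du x $ i\<bar> powr p i"
  proof -
    have "AE x in ?M. (\<lambda>k. partial_deriv i (\<phi> k) x) \<longlonglongrightarrow> Du x $ i"
      using app by (simp add: dominated_approx_def)
    with tendsto_comp_approx[OF wt_continuous[OF \<gamma> \<epsilon>]] show ?thesis
    proof eventually_elim
      case (elim x)
      have "(\<lambda>k. \<bar>partial_deriv i (\<phi> k) x\<bar> powr p i) \<longlonglongrightarrow> \<bar>Du x $ i\<bar> powr p i"
        using p[of i] by (intro tendsto_powr2 tendsto_rabs elim tendsto_const) auto
      with elim(1) show ?case by (rule tendsto_mult)
    qed
  qed
  have dom: "AE x in ?M. norm (wt \<gamma> \<epsilon> (\<phi> k x) * \<bar>partial_deriv i (\<phi> k) x\<bar> powr p i) \<le> ?c * H x" for k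
  proof -
    have "AE x in ?M. \<forall>k. \<bar>partial_deriv i (\<phi> k) x\<bar> powr p i \<le> H x" using app by (simp add: dominated_approx_def)
    then show ?thesis
    proof eventually_elim
      case (elim x)
      have "wt \<gamma> \<epsilon> (\<phi> k x) * \<bar>partial_deriv i (\<phi> k) x\<bar> powr p i \<le> ?c * H x"
        using elim by (intro mult_mono c) auto
      then show ?case using c(1)[of "\<phi> k x"] by (simp add: abs_mult)
    qed
  qed
  show "integrable ?M (\<lambda>x. wt \<gamma> \<epsilon> (u x) * \<bar>Du x $ i\<bar> powr p i)"
    by (rule integrable_dominated_convergence[OF m1 H lim dom])
  show "(\<lambda>k. \<integral>x. wt \<gamma> \<epsilon> (\<phi> k x) * \<bar>partial_deriv i (\<phi> k) x\<bar> powr p i \<partial>?M)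
    \<longlonglongrightarrow> (\<integral>x. wt \<gamma> \<epsilon> (u x) * \<bar>Du x $ i\<bar> powr p i \<partial>?M)"
    by (rule integral_dominated_convergence[OF m1 H lim dom])
qed

lemma flux_integrable:
  assumes g [measurable]: "g \<in> borel_measurable (lebesgue_on \<Omega>)"
    and gi: "integrable (lebesgue_on \<Omega>) (\<lambda>x. \<bar>g x\<bar> powr conj_exponent (p i))"
  shows "integrable (lebesgue_on \<Omega>) (\<lambda>x. g x * (dwt \<gamma> \<epsilon> (u x) * Du x $ i))"
    and "integrable (lebesgue_on \<Omega>) (\<lambda>x. g x * (dwt \<gamma> \<epsilon> (\<phi> k x) * partial_deriv i (\<phi> k) x))"
    and "(\<lambda>k. \<integral>x. g x * (dwt \<gamma> \<epsilon> (\<phi> k x) * partial_deriv i (\<phi> k) x) \<partial>lebesgue_on \<Omega>)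
      \<longlonglongrightarrow> (\<integral>x. g x * (dwt \<gamma> \<epsilon> (u x) * Du x $ i) \<partial>lebesgue_on \<Omega>)"
proof -
  let ?M = "lebesgue_on \<Omega>" and ?c = "(1 + \<gamma>) * (1 / \<epsilon>) powr (\<gamma> / 2)"
  let ?B = "\<lambda>x. ?c * (H x + \<bar>g x\<bar> powr conj_exponent (p i))"
  note [measurable] = approx_measurable dwt_measurable[OF \<gamma> \<epsilon>]
  have H: "integrable ?M ?B" using app gi by (auto simp: dominated_approx_def)
  have c: "0 \<le> dwt \<gamma> \<epsilon> t" "dwt \<gamma> \<epsilon> t \<le> ?c" for t
    using dwt_bounds[OF \<gamma> \<epsilon>, of t] order_trans[OF dwt_bounds(2)[OF \<gamma> \<epsilon>, of t]
      mult_left_mono[OF wt_le[OF \<gamma> \<epsilon>, of t], of "1 + \<gamma>"]] \<gamma> by auto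
  have m1: "(\<lambda>x. g x * (dwt \<gamma> \<epsilon> (u x) * Du x $ i)) \<in> borel_measurable ?M"
    "(\<lambda>x. g x * (dwt \<gamma> \<epsilon> (\<phi> k x) * partial_deriv i (\<phi> k) x)) \<in> borel_measurable ?M" for k
    by measurable
  have lim: "AE x in ?M. (\<lambda>k. g x * (dwt \<gamma> \<epsilon> (\<phi> k x) * partial_deriv i (\<phi> k) x))
      \<longlonglongrightarrow> g x * (dwt \<gamma> \<epsilon> (u x) * Du x $ i)"
  proof -
    have "AE x in ?M. (\<lambda>k. partial_deriv i (\<phi> k) x) \<longlonglongrightarrow> Du x $ i"
      using app by (simp add: dominated_approx_def)
    with tendsto_comp_approx[OF dwt_continuous[OF \<gamma> \<epsilon>]] show ?thesis
      by eventually_elim (intro tendsto_intros)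
  qed
  have dom: "AE x in ?M. norm (g x * (dwt \<gamma> \<epsilon> (\<phi> k x) * partial_deriv i (\<phi> k) x)) \<le> ?B x" for k
  proof -
    have "AE x in ?M. \<forall>k. \<bar>partial_deriv i (\<phi> k) x\<bar> powr p i \<le> H x" using app by (simp add: dominated_approx_def)
    then show ?thesis
    proof eventually_elim
      case (elim x)
      have "\<bar>g x\<bar> * \<bar>partial_deriv i (\<phi> k) x\<bar> \<le> 1 * \<bar>partial_deriv i (\<phi> k) x\<bar> powr p i
          + 1 powr (- (conj_exponent (p i) / p i)) * \<bar>g x\<bar> powr conj_exponent (p i)"
        by (intro Young_scaled p) auto
      also have "\<dots> \<le> H x + \<bar>g x\<bar> powr conj_exponent (p i)" using elim by simp
      finally have "dwt \<gamma> \<epsilon> (\<phi> k x) * (\<bar>g x\<bar> * \<bar>partial_deriv i (\<phi> k) x\<bar>) \<le> ?B x"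
        using \<gamma> by (intro mult_mono c) auto
      then show ?case using c(1)[of "\<phi> k x"] by (simp add: abs_mult mult_ac)
    qed
  qed
  show "integrable ?M (\<lambda>x. g x * (dwt \<gamma> \<epsilon> (u x) * Du x $ i))"
    by (rule integrable_dominated_convergence[OF m1 H lim dom])
  show "integrable ?M (\<lambda>x. g x * (dwt \<gamma> \<epsilon> (\<phi> k x) * partial_deriv i (\<phi> k) x))"
  proof (rule Bochner_Integration.integrable_bound[OF H m1(2)])
    show "AE x in ?M. norm (g x * (dwt \<gamma> \<epsilon> (\<phi> k x) * partial_deriv i (\<phi> k) x)) \<le> norm (?B x)"
      using dom[of k] by eventually_elim (metis abs_ge_self order_trans real_norm_def)
  qed
  show "(\<lambda>k. \<integral>x. g x * (dwt \<gamma> \<epsilon> (\<phi> k x) * partial_deriv i (\<phi> k) x) \<partial>?M)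
      \<longlonglongrightarrow> (\<integral>x. g x * (dwt \<gamma> \<epsilon> (u x) * Du x $ i) \<partial>?M)"
    by (rule integral_dominated_convergence[OF m1 H lim dom])
qed

text \<open>Where \<open>V\<close> is infinite, both sides of the pointwise limit are infinite because \<open>f\<close> is positive.\<close>

lemma Fatou_approx:
  assumes f: "continuous_on UNIV f" "\<And>t. 0 < f t" and V [measurable]: "V \<in> borel_measurable (lebesgue_on \<Omega>)"
    and bound: "\<And>k. (\<integral>\<^sup>+x. V x * ennreal (f (\<phi> k x)) \<partial>lebesgue_on \<Omega>) \<le> ennreal (R k)" and R: "R \<longlonglongrightarrow> r"
  shows "(\<integral>\<^sup>+x. V x * ennreal (f (u x)) \<partial>lebesgue_on \<Omega>) \<le> ennreal r"
proof -
  let ?M = "lebesgue_on \<Omega>"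
  have [measurable]: "f \<in> borel_measurable borel" using f(1) by (rule borel_measurable_continuous_onI)
  note [measurable] = approx_measurable
  have "AE x in ?M. V x * ennreal (f (u x)) = liminf (\<lambda>k. V x * ennreal (f (\<phi> k x)))"
    using tendsto_comp_approx[OF f(1)]
  proof eventually_elim
    case (elim x)
    have "(\<lambda>k. V x * ennreal (f (\<phi> k x))) \<longlonglongrightarrow> V x * ennreal (f (u x))"
    proof (cases "V x = top")
      case True
      moreover have "ennreal (f t) \<noteq> 0" for t using f(2)[of t] by (simp add: ennreal_eq_0_iff not_le)
      ultimately show ?thesis by (simp add: ennreal_top_mult)
    next
      case False
      then show ?thesis by (intro ennreal_tendsto_cmult tendsto_ennrealI elim) (simp add: less_top)
    qed
    then show ?case by (simp add: lim_imp_Liminf)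
  qed
  then have "(\<integral>\<^sup>+x. V x * ennreal (f (u x)) \<partial>?M) = (\<integral>\<^sup>+x. liminf (\<lambda>k. V x * ennreal (f (\<phi> k x))) \<partial>?M)"
    by (rule nn_integral_cong_AE)
  also have "\<dots> \<le> liminf (\<lambda>k. \<integral>\<^sup>+x. V x * ennreal (f (\<phi> k x)) \<partial>?M)"
    by (intro nn_integral_liminf) measurable
  also have "\<dots> \<le> liminf (\<lambda>k. ennreal (R k))"
    by (intro Liminf_mono always_eventually allI bound)
  also have "\<dots> = ennreal r" by (intro lim_imp_Liminf tendsto_ennrealI R) simp
  finally show ?thesis .
qed

end

lemma Hardy_W0:
  fixes p :: "'n::finite \<Rightarrow> real"
  assumes N: "CARD('n) > 1" and p: "\<And>i. 1 < p i"
  defines "q \<equiv> harmonic_mean p" and "\<theta> \<equiv> 1 - harmonic_mean p / real CARD('n)"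
  assumes q: "1 < q" "q < real CARD('n)" and \<gamma>: "0 \<le> \<gamma>"
  shows "\<exists>C>0. \<forall>(\<Omega> :: (real^'n) set) u Du \<phi> H V \<kappa> \<epsilon>. open \<Omega> \<longrightarrow> bounded \<Omega> \<longrightarrow> 0 < \<epsilon> \<longrightarrow> \<epsilon> \<le> 1 \<longrightarrow>
     dominated_approx p \<Omega> u Du \<phi> H \<longrightarrow> Morrey_weight \<Omega> \<theta> \<kappa> V \<longrightarrow>
     (\<integral>\<^sup>+x. V x * ennreal ((1 + (u x)\<^sup>2) powr (q / 2) * wt \<gamma> \<epsilon> (u x)) \<partial>lebesgue_on \<Omega>)
      \<le> ennreal (C * \<kappa> * (measure lebesgue \<Omega> powr \<theta> + energy p \<Omega> \<gamma> \<epsilon> u Du))"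
proof -
  obtain C where C: "C > 0" and Hardy: "\<And>(\<Omega> :: (real^'n) set) \<phi> V \<kappa> \<epsilon>. open \<Omega> \<Longrightarrow> bounded \<Omega> \<Longrightarrow> 0 < \<epsilon> \<Longrightarrow> \<epsilon> \<le> 1 \<Longrightarrow>
     \<phi> \<in> test_functions \<Omega> \<Longrightarrow> Morrey_weight \<Omega> \<theta> \<kappa> V \<Longrightarrow>
     (\<integral>\<^sup>+x. V x * ennreal ((1 + (\<phi> x)\<^sup>2) powr (q / 2) * wt \<gamma> \<epsilon> (\<phi> x)) \<partial>lebesgue_on \<Omega>)
      \<le> ennreal (C * \<kappa> * (measure lebesgue \<Omega> powr \<theta> + test_energy p \<Omega> \<gamma> \<epsilon> \<phi>))"
    using Hardy_test[OF N, of p \<gamma>] p q \<gamma> unfolding q_def \<theta>_def by blast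
  show ?thesis
  proof (intro exI[of _ C] conjI C allI impI)
    fix \<Omega> :: "(real^'n) set" and u Du \<phi> H V and \<kappa> \<epsilon> :: real
    assume \<Omega>: "open \<Omega>" "bounded \<Omega>" and \<epsilon>: "0 < \<epsilon>" "\<epsilon> \<le> 1" and app: "dominated_approx p \<Omega> u Du \<phi> H"
      and V: "Morrey_weight \<Omega> \<theta> \<kappa> V"
    have \<Omega>l: "\<Omega> \<in> sets lebesgue" using \<Omega> by simp
    have \<phi>: "\<phi> k \<in> test_functions \<Omega>" for k using app by (simp add: dominated_approx_def)
    show "(\<integral>\<^sup>+x. V x * ennreal ((1 + (u x)\<^sup>2) powr (q / 2) * wt \<gamma> \<epsilon> (u x)) \<partial>lebesgue_on \<Omega>)
      \<le> ennreal (C * \<kappa> * (measure lebesgue \<Omega> powr \<theta> + energy p \<Omega> \<gamma> \<epsilon> u Du))"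
    proof (rule Fatou_approx[OF p \<Omega>l app \<gamma> \<epsilon>, where f = "\<lambda>t. (1 + t\<^sup>2) powr (q / 2) * wt \<gamma> \<epsilon> t"])
      have pos: "0 < 1 + t\<^sup>2" for t :: real by (simp add: add_pos_nonneg)
      then have "1 + t\<^sup>2 \<noteq> 0" for t :: real by (metis less_irrefl)
      then show "continuous_on UNIV (\<lambda>t. (1 + t\<^sup>2) powr (q / 2) * wt \<gamma> \<epsilon> t)"
        using wt_continuous[OF \<gamma> \<epsilon>] by (intro continuous_intros) auto
      show "0 < (1 + t\<^sup>2) powr (q / 2) * wt \<gamma> \<epsilon> t" for t
        using wt_pos(1)[OF \<gamma> \<epsilon>, of t] pos[of t] by simp
      show "V \<in> borel_measurable (lebesgue_on \<Omega>)" using V by (simp add: Morrey_weight_def)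
      show "(\<integral>\<^sup>+x. V x * ennreal ((1 + (\<phi> k x)\<^sup>2) powr (q / 2) * wt \<gamma> \<epsilon> (\<phi> k x)) \<partial>lebesgue_on \<Omega>)
         \<le> ennreal (C * \<kappa> * (measure lebesgue \<Omega> powr \<theta> + test_energy p \<Omega> \<gamma> \<epsilon> (\<phi> k)))" for k
        by (rule Hardy[OF \<Omega> \<epsilon> \<phi> V])
      show "(\<lambda>k. C * \<kappa> * (measure lebesgue \<Omega> powr \<theta> + test_energy p \<Omega> \<gamma> \<epsilon> (\<phi> k)))
         \<longlonglongrightarrow> C * \<kappa> * (measure lebesgue \<Omega> powr \<theta> + energy p \<Omega> \<gamma> \<epsilon> u Du)"
        by (intro tendsto_intros energy_tendsto[OF p \<Omega>l app \<gamma> \<epsilon>])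
    qed
  qed
qed

section \<open>Examples of Morrey weights\<close>

lemma Morrey_weight_add:
  assumes V: "Morrey_weight \<Omega> \<theta> \<kappa> V" and W: "Morrey_weight \<Omega> \<theta> \<kappa>' W" and \<Omega>: "\<Omega> \<in> sets lebesgue"
  shows "Morrey_weight \<Omega> \<theta> (\<kappa> + \<kappa>') (\<lambda>x. V x + W x)"
proof -
  have k: "0 \<le> \<kappa>" "0 \<le> \<kappa>'" and [measurable]: "V \<in> borel_measurable (lebesgue_on \<Omega>)" "W \<in> borel_measurable (lebesgue_on \<Omega>)"
    using V W by (auto simp: Morrey_weight_def)
  show ?thesis unfolding Morrey_weight_def
  proof (intro conjI ballI impI)
    fix E assume E: "E \<in> sets lebesgue" "E \<subseteq> \<Omega>"
    then have [measurable]: "E \<in> sets (lebesgue_on \<Omega>)" using \<Omega> by (simp add: sets_restrict_space_iff)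
    have "(\<integral>\<^sup>+x. (V x + W x) * indicator E x \<partial>lebesgue_on \<Omega>) =
      (\<integral>\<^sup>+x. V x * indicator E x \<partial>lebesgue_on \<Omega>) + (\<integral>\<^sup>+x. W x * indicator E x \<partial>lebesgue_on \<Omega>)"
      unfolding distrib_right by (intro nn_integral_add) measurable
    also have "\<dots> \<le> ennreal (\<kappa> * measure lebesgue E powr \<theta>) + ennreal (\<kappa>' * measure lebesgue E powr \<theta>)"
      using V W E unfolding Morrey_weight_def by (intro add_mono) blast+
    also have "\<dots> = ennreal ((\<kappa> + \<kappa>') * measure lebesgue E powr \<theta>)"
      using k by (simp add: distrib_right)
    finally show "(\<integral>\<^sup>+x. (V x + W x) * indicator E x \<partial>lebesgue_on \<Omega>) \<le> ennreal ((\<kappa> + \<kappa>') * measure lebesgue E powr \<theta>)" .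
  qed (use k in auto)
qed

lemma nn_integral_lebesgue_on_indicator:
  assumes "\<Omega> \<in> sets lebesgue" "E \<in> sets lebesgue" "E \<subseteq> \<Omega>"
  shows "(\<integral>\<^sup>+x. indicator E x \<partial>lebesgue_on \<Omega>) = emeasure lebesgue E"
  using assms by (subst nn_integral_indicator) (auto simp: sets_restrict_space_iff emeasure_restrict_space)

lemma finite_emeasure_subset:
  fixes \<Omega> :: "'a::euclidean_space set"
  assumes "bounded \<Omega>" "\<Omega> \<in> sets lebesgue" "E \<subseteq> \<Omega>"
  shows "emeasure lebesgue E = ennreal (measure lebesgue E)" "emeasure lebesgue E < \<infinity>"
proof -
  have "emeasure lebesgue E \<le> emeasure lebesgue \<Omega>" using assms by (intro emeasure_mono)
  also have "\<dots> < \<infinity>"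
    using lmeasurable_iff_integrable_on assms by (metis bounded_set_imp_lmeasurable fmeasurableD2 infinity_ennreal_def less_top)
  finally show fin: "emeasure lebesgue E < \<infinity>" .
  then show "emeasure lebesgue E = ennreal (measure lebesgue E)"
    by (intro emeasure_eq_ennreal_measure) auto
qed

text \<open>Weak type \<open>m\<close>: split the integral at the level at which the trivial bound and the sum
  over the dyadic levels above it are of the same size.\<close>

lemma Morrey_weight_weak_type:
  assumes m: "1 < m"
  shows "\<exists>c>0. \<forall>(\<Omega> :: (real^'n::finite) set) V A. open \<Omega> \<longrightarrow> bounded \<Omega> \<longrightarrow> V \<in> borel_measurable (lebesgue_on \<Omega>) \<longrightarrow> 0 < A \<longrightarrow>
    (\<forall>s>0. emeasure lebesgue {x\<in>\<Omega>. ennreal s < V x} \<le> ennreal (A * s powr (- m))) \<longrightarrow>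
    Morrey_weight \<Omega> (1 - 1 / m) (c * A powr (1 / m)) V"
proof -
  define \<rho> where "\<rho> = (2::real) powr (1 - m)"
  have \<rho>: "0 < \<rho>" "\<rho> < 1" using m by (auto simp: \<rho>_def intro: powr_less_one)
  define c where "c = 1 + 2 * (1 / (1 - \<rho>))"
  have c: "0 < c" using \<rho> by (simp add: c_def add_pos_pos)
  show ?thesis
  proof (intro exI[of _ c] conjI c allI impI)
    fix \<Omega> :: "(real^'n) set" and V :: "real^'n \<Rightarrow> ennreal" and A :: real
    assume \<Omega>: "open \<Omega>" "bounded \<Omega>" and V [measurable]: "V \<in> borel_measurable (lebesgue_on \<Omega>)" and A: "0 < A"
      and wk: "\<forall>s>0. emeasure lebesgue {x\<in>\<Omega>. ennreal s < V x} \<le> ennreal (A * s powr (- m))"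
    have \<Omega>l: "\<Omega> \<in> sets lebesgue" using \<Omega> by simp
    show "Morrey_weight \<Omega> (1 - 1 / m) (c * A powr (1 / m)) V"
      unfolding Morrey_weight_def
    proof (intro conjI ballI impI V)
      show "0 \<le> c * A powr (1 / m)" using c by simp
      fix E assume E: "E \<in> sets lebesgue" "E \<subseteq> \<Omega>"
      then have [measurable]: "E \<in> sets (lebesgue_on \<Omega>)" using \<Omega>l by (simp add: sets_restrict_space_iff)
      define e where "e = measure lebesgue E"
      have Ee: "emeasure lebesgue E = ennreal e" unfolding e_def by (rule finite_emeasure_subset[OF \<Omega>(2) \<Omega>l E(2)])
      have indE: "(\<integral>\<^sup>+x. indicator E x \<partial>lebesgue_on \<Omega>) = ennreal e"
        using nn_integral_lebesgue_on_indicator[OF \<Omega>l E] Ee by simp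
      show "(\<integral>\<^sup>+x. V x * indicator E x \<partial>lebesgue_on \<Omega>) \<le> ennreal (c * A powr (1 / m) * measure lebesgue E powr (1 - 1 / m))"
      proof (cases "e = 0")
        case True
        then have "E \<in> null_sets (lebesgue_on \<Omega>)" using indE by (simp add: null_sets_def)
        then have "AE x in lebesgue_on \<Omega>. x \<notin> E" by (rule AE_not_in)
        then have "AE x in lebesgue_on \<Omega>. V x * indicator E x = 0" by eventually_elim simp
        then have "(\<integral>\<^sup>+x. V x * indicator E x \<partial>lebesgue_on \<Omega>) = (\<integral>\<^sup>+x. 0 \<partial>lebesgue_on \<Omega>)" by (rule nn_integral_cong_AE)
        then show ?thesis by simp
      next
        case False
        then have e: "0 < e" by (simp add: e_def less_le)
        define \<tau> where "\<tau> = (A / e) powr (1 / m)"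
        have \<tau>: "0 < \<tau>" using A e by (simp add: \<tau>_def)
        define L where "L j = {x\<in>\<Omega>. ennreal (2 ^ j * \<tau>) < V x}" for j :: nat
        have Lm [measurable]: "L j \<in> sets (lebesgue_on \<Omega>)" for j
        proof -
          have "{x\<in>space (lebesgue_on \<Omega>). ennreal (2 ^ j * \<tau>) < V x} \<in> sets (lebesgue_on \<Omega>)" by measurable
          then show ?thesis by (simp add: L_def)
        qed
        have pt: "V x * indicator E x \<le> ennreal \<tau> * indicator E x + (\<Sum>j. ennreal (2 ^ Suc j * \<tau>) * indicator (L j) x)"
          if x: "x \<in> space (lebesgue_on \<Omega>)" for x
        proof (cases "V x \<le> ennreal \<tau>")
          case True then show ?thesis by (intro add_increasing2 mult_right_mono) auto
        next
          case nle: False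
          have "V x \<le> (\<Sum>j. ennreal (2 ^ Suc j * \<tau>) * indicator (L j) x)"
          proof (cases "\<exists>j. V x \<le> ennreal (2 ^ Suc j * \<tau>)")
            case True
            define j where "j = (LEAST j. V x \<le> ennreal (2 ^ Suc j * \<tau>))"
            have j: "V x \<le> ennreal (2 ^ Suc j * \<tau>)" unfolding j_def using True by (rule LeastI_ex)
            have "x \<in> L j"
            proof (cases j)
              case 0 then show ?thesis using nle x by (auto simp: L_def)
            next
              case (Suc i)
              then have "\<not> V x \<le> ennreal (2 ^ Suc i * \<tau>)" 
                using not_less_Least[of i "\<lambda>j. V x \<le> ennreal (2 ^ Suc j * \<tau>)"] unfolding j_def by simp
              then show ?thesis using x Suc by (auto simp: L_def)
            qed
            then have "V x \<le> (\<Sum>j\<in>{j}. ennreal (2 ^ Suc j * \<tau>) * indicator (L j) x)" using j by simp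
            also have "\<dots> \<le> (\<Sum>j. ennreal (2 ^ Suc j * \<tau>) * indicator (L j) x)"
              by (intro sum_le_suminf) auto
            finally show ?thesis .
          next
            case False
            then have big: "ennreal (2 ^ Suc j * \<tau>) < V x" for j by (simp add: not_le)
            have xL: "x \<in> L j" for j
            proof -
              have "ennreal (2 ^ j * \<tau>) \<le> ennreal (2 ^ Suc j * \<tau>)" using \<tau> by (intro ennreal_leI) auto
              then show ?thesis using big[of j] x by (auto simp: L_def)
            qed
            have "(\<Sum>j. ennreal (2 ^ Suc j * \<tau>) * indicator (L j) x) = (\<Sum>j. ennreal (2 ^ Suc j * \<tau>))"
              using xL by simp
            also have "\<dots> = top"
            proof (rule ccontr)
              assume "(\<Sum>j. ennreal (2 ^ Suc j * \<tau>)) \<noteq> top"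
              then have "summable (\<lambda>j. 2 ^ Suc j * \<tau>)" using \<tau> by (intro summable_suminf_not_top) auto
              then have "(\<lambda>j. 2 ^ Suc j * \<tau>) \<longlonglongrightarrow> 0" by (rule summable_LIMSEQ_zero)
              then have "eventually (\<lambda>j. 2 ^ Suc j * \<tau> < \<tau>) sequentially" using \<tau> by (rule order_tendstoD)
              then obtain j where "2 ^ Suc j * \<tau> < \<tau>" using eventually_happens'[OF sequentially_bot] by blast
              moreover have "1 * \<tau> \<le> 2 ^ Suc j * \<tau>" using \<tau> by (intro mult_right_mono one_le_power) auto
              ultimately show False by linarith
            qed
            finally show ?thesis by simp
          qed
          moreover have "V x * indicator E x \<le> V x" by (simp add: indicator_def)
          ultimately show ?thesis by (meson add_increasing order_trans zero_le)
        qed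
        have Lmeas: "(\<integral>\<^sup>+x. indicator (L j) x \<partial>lebesgue_on \<Omega>) \<le> ennreal (A * (2 ^ j * \<tau>) powr (- m))" for j
        proof -
          have "L j \<in> sets lebesgue" "L j \<subseteq> \<Omega>" using Lm[of j] \<Omega>l by (auto simp: sets_restrict_space_iff L_def)
          then have "(\<integral>\<^sup>+x. indicator (L j) x \<partial>lebesgue_on \<Omega>) = emeasure lebesgue (L j)"
            by (intro nn_integral_lebesgue_on_indicator \<Omega>l)
          also have "\<dots> \<le> ennreal (A * (2 ^ j * \<tau>) powr (- m))" unfolding L_def using wk \<tau> by simp
          finally show ?thesis .
        qed
        have "(\<integral>\<^sup>+x. V x * indicator E x \<partial>lebesgue_on \<Omega>)
           \<le> (\<integral>\<^sup>+x. ennreal \<tau> * indicator E x + (\<Sum>j. ennreal (2 ^ Suc j * \<tau>) * indicator (L j) x) \<partial>lebesgue_on \<Omega>)"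
          by (intro nn_integral_mono pt)
        also have "\<dots> = ennreal \<tau> * (\<integral>\<^sup>+x. indicator E x \<partial>lebesgue_on \<Omega>) +
            (\<Sum>j. ennreal (2 ^ Suc j * \<tau>) * (\<integral>\<^sup>+x. indicator (L j) x \<partial>lebesgue_on \<Omega>))"
          by (subst nn_integral_add) (simp_all add: nn_integral_cmult nn_integral_suminf del: nn_integral_indicator)
        also have "\<dots> \<le> ennreal \<tau> * ennreal e + (\<Sum>j. ennreal (2 ^ Suc j * \<tau>) * ennreal (A * (2 ^ j * \<tau>) powr (- m)))"
          unfolding indE by (intro add_left_mono suminf_le mult_left_mono Lmeas) auto
        also have "(\<Sum>j. ennreal (2 ^ Suc j * \<tau>) * ennreal (A * (2 ^ j * \<tau>) powr (- m)))
           = (\<Sum>j. ennreal (2 * A * \<tau> powr (1 - m) * \<rho> ^ j))"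
        proof (rule suminf_cong)
          fix j
          have "(2 ^ Suc j * \<tau>) * (A * (2 ^ j * \<tau>) powr (- m)) = 2 * A * ((2 ^ j * \<tau>) powr 1 * (2 ^ j * \<tau>) powr (- m))"
            using \<tau> by simp
          also have "(2 ^ j * \<tau>) powr 1 * (2 ^ j * \<tau>) powr (- m) = (2 ^ j * \<tau>) powr (1 - m)"
            by (simp only: powr_add[symmetric] diff_conv_add_uminus)
          also have "\<dots> = (2 ^ j) powr (1 - m) * \<tau> powr (1 - m)" using \<tau> by (simp add: powr_mult)
          also have "((2::real) ^ j) powr (1 - m) = \<rho> ^ j"
            by (simp add: \<rho>_def powr_realpow[symmetric] powr_powr mult.commute)
          finally have eq: "(2 ^ Suc j * \<tau>) * (A * (2 ^ j * \<tau>) powr (- m)) = 2 * A * \<tau> powr (1 - m) * \<rho> ^ j"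
            by (simp only: mult_ac)
          have "ennreal (2 ^ Suc j * \<tau>) * ennreal (A * (2 ^ j * \<tau>) powr (- m)) = ennreal ((2 ^ Suc j * \<tau>) * (A * (2 ^ j * \<tau>) powr (- m)))"
            using \<tau> A by (intro ennreal_mult[symmetric]) auto
          then show "ennreal (2 ^ Suc j * \<tau>) * ennreal (A * (2 ^ j * \<tau>) powr (- m)) = ennreal (2 * A * \<tau> powr (1 - m) * \<rho> ^ j)"
            unfolding eq .
        qed
        also have "\<dots> = ennreal (\<Sum>j. 2 * A * \<tau> powr (1 - m) * \<rho> ^ j)"
          using A \<rho> by (intro suminf_ennreal2) (auto intro!: summable_mult summable_geometric)
        also have "(\<Sum>j. 2 * A * \<tau> powr (1 - m) * \<rho> ^ j) = 2 * A * \<tau> powr (1 - m) * (1 / (1 - \<rho>))"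
          using \<rho> by (subst suminf_mult) (auto simp: suminf_geometric intro!: summable_geometric)
        also have "ennreal \<tau> * ennreal e + ennreal (2 * A * \<tau> powr (1 - m) * (1 / (1 - \<rho>)))
          = ennreal (\<tau> * e + 2 * A * \<tau> powr (1 - m) * (1 / (1 - \<rho>)))"
          using \<tau> e A \<rho> by (simp add: ennreal_mult)
        also have "\<tau> * e + 2 * A * \<tau> powr (1 - m) * (1 / (1 - \<rho>)) = c * A powr (1 / m) * e powr (1 - 1 / m)"
        proof -
          have 1: "\<tau> * e = A powr (1 / m) * e powr (1 - 1 / m)"
            using A e by (simp add: \<tau>_def powr_divide powr_diff)
          have "A * \<tau> powr (1 - m) = A powr 1 * (A powr ((1 - m) / m) / e powr ((1 - m) / m))"
            using A e by (simp add: \<tau>_def powr_powr powr_divide)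
          also have "\<dots> = A powr (1 + (1 - m) / m) * e powr (- ((1 - m) / m))"
            by (simp only: powr_add powr_minus divide_inverse mult.assoc)
          also have "\<dots> = A powr (1 / m) * e powr (1 - 1 / m)"
          proof -
            have "1 + (1 - m) / m = 1 / m" "- ((1 - m) / m) = 1 - 1 / m" using m by (simp_all add: field_simps)
            then show ?thesis by (simp only:)
          qed
          finally have 2: "A * \<tau> powr (1 - m) = A powr (1 / m) * e powr (1 - 1 / m)" .
          have "\<tau> * e + 2 * A * \<tau> powr (1 - m) * (1 / (1 - \<rho>)) = \<tau> * e + 2 * (A * \<tau> powr (1 - m)) * (1 / (1 - \<rho>))" by simp
          also have "\<dots> = c * A powr (1 / m) * e powr (1 - 1 / m)" unfolding 1 2 c_def by (simp add: algebra_simps)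
          finally show ?thesis .
        qed
        finally show ?thesis by (simp add: e_def)
      qed
    qed
  qed
qed

text \<open>The decreasing rearrangement is at least \<open>t\<close> on the interval from 0 to the measure of the level set
  of height \<open>t\<close>, so the norm bounds this measure.\<close>

lemma weak_Lp_distribution:
  fixes f :: "real^'n::finite \<Rightarrow> real"
  assumes \<Omega>: "bounded \<Omega>" "\<Omega> \<in> sets lebesgue" and q: "0 < q" and d: "0 < d" and t: "0 < t"
    and norm: "weak_Lp_norm q \<Omega> f < ennreal d"
  shows "emeasure lebesgue {x\<in>\<Omega>. t < \<bar>f x\<bar>} \<le> ennreal ((d / t) powr q)"
proof (rule ccontr)
  let ?L = "{x\<in>\<Omega>. t < \<bar>f x\<bar>}"
  assume "\<not> emeasure lebesgue ?L \<le> ennreal ((d / t) powr q)"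
  then obtain s where s: "ennreal ((d / t) powr q) < s" "s < emeasure lebesgue ?L"
    using dense by (auto simp: not_le)
  have s_fin: "s < top" using s(2) by (rule less_le_trans) simp
  then obtain r where r: "s = ennreal r" "0 \<le> r" by (cases s) auto
  have rd: "(d / t) powr q < r" using s(1) r by (simp add: ennreal_less_iff)
  then have r0: "0 < r" by (metis le_less_trans powr_ge_zero)
  have "emeasure lebesgue ?L \<le> emeasure lebesgue \<Omega>" using \<Omega> by (intro emeasure_mono) auto
  then have r\<Omega>: "ennreal r < emeasure lebesgue \<Omega>" using s(2) r by (auto intro: less_le_trans)
  have "ennreal t \<le> decr_rearrangement \<Omega> f r"
    unfolding decr_rearrangement_def distribution_fun_def using s(2) r t by (intro SUP_upper) auto
  then have "ennreal (r powr (1 / q)) * ennreal t \<le> ennreal (r powr (1 / q)) * decr_rearrangement \<Omega> f r"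
    by (intro mult_left_mono) auto
  also have "\<dots> \<le> weak_Lp_norm q \<Omega> f"
    unfolding weak_Lp_norm_def using r0 r\<Omega> by (intro SUP_upper) auto
  also have "\<dots> < ennreal d" by (rule norm)
  finally have "ennreal (r powr (1 / q) * t) < ennreal d" using t by (simp add: ennreal_mult)
  then have "r powr (1 / q) * t < d" using t by (simp add: ennreal_less_iff)
  moreover have "((d / t) powr q) powr (1 / q) < r powr (1 / q)"
    using rd q by (intro powr_less_mono2) auto
  then have "d / t < r powr (1 / q)" using q d t by (simp add: powr_powr)
  then have "d < r powr (1 / q) * t" using t by (simp add: divide_less_eq)
  ultimately show False by linarith
qed

lemma Morrey_weight_Marcinkiewicz:
  assumes m: "1 < m"
  shows "\<exists>c>0. \<forall>(\<Omega> :: (real^'n::finite) set) f d q. open \<Omega> \<longrightarrow> bounded \<Omega> \<longrightarrow>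
    f \<in> borel_measurable (lebesgue_on \<Omega>) \<longrightarrow> 0 < d \<longrightarrow> 0 < q \<longrightarrow> weak_Lp_norm (m * q) \<Omega> f < ennreal d \<longrightarrow>
    Morrey_weight \<Omega> (1 - 1 / m) (c * d powr q) (\<lambda>x. ennreal (\<bar>f x\<bar> powr q))"
proof -
  obtain c where c: "c > 0" and W: "\<And>(\<Omega> :: (real^'n) set) V A. open \<Omega> \<Longrightarrow> bounded \<Omega> \<Longrightarrow>
    V \<in> borel_measurable (lebesgue_on \<Omega>) \<Longrightarrow> 0 < A \<Longrightarrow>
    (\<forall>s>0. emeasure lebesgue {x\<in>\<Omega>. ennreal s < V x} \<le> ennreal (A * s powr (- m))) \<Longrightarrow>
    Morrey_weight \<Omega> (1 - 1 / m) (c * A powr (1 / m)) V"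
    using Morrey_weight_weak_type[OF m] by blast
  show ?thesis
  proof (intro exI[of _ c] conjI c allI impI)
    fix \<Omega> :: "(real^'n) set" and f and d q :: real
    assume \<Omega>: "open \<Omega>" "bounded \<Omega>" and [measurable]: "f \<in> borel_measurable (lebesgue_on \<Omega>)" and d: "0 < d"
      and q: "0 < q" and norm: "weak_Lp_norm (m * q) \<Omega> f < ennreal d"
    have \<Omega>l: "\<Omega> \<in> sets lebesgue" using \<Omega> by simp
    have "Morrey_weight \<Omega> (1 - 1 / m) (c * (d powr (m * q)) powr (1 / m)) (\<lambda>x. ennreal (\<bar>f x\<bar> powr q))"
    proof (rule W[OF \<Omega>]; (intro allI impI)?)
      show "(\<lambda>x. ennreal (\<bar>f x\<bar> powr q)) \<in> borel_measurable (lebesgue_on \<Omega>)" by measurable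
      show "0 < d powr (m * q)" using d by simp
      fix s :: real assume s: "0 < s"
      have eqS: "{x\<in>\<Omega>. ennreal s < ennreal (\<bar>f x\<bar> powr q)} = {x\<in>\<Omega>. s powr (1 / q) < \<bar>f x\<bar>}"
      proof -
        have "s < y powr q \<longleftrightarrow> s powr (1 / q) < y" if y: "0 \<le> y" for y
        proof
          assume "s < y powr q"
          then have "s powr (1 / q) < (y powr q) powr (1 / q)" using s q by (intro powr_less_mono2) auto
          then show "s powr (1 / q) < y" using q y by (simp add: powr_powr)
        next
          assume "s powr (1 / q) < y"
          then have "(s powr (1 / q)) powr q < y powr q" using q by (intro powr_less_mono2) auto
          then show "s < y powr q" using q s by (simp add: powr_powr)
        qed
        then have "s < \<bar>f x\<bar> powr q \<longleftrightarrow> s powr (1 / q) < \<bar>f x\<bar>" for x by simp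
        moreover have "ennreal s < ennreal (\<bar>f x\<bar> powr q) \<longleftrightarrow> s < \<bar>f x\<bar> powr q" for x
          using s by (intro ennreal_less_iff) simp
        ultimately show ?thesis by (intro Collect_cong) blast
      qed
      have "0 < m * q" "0 < s powr (1 / q)" using m q s by simp_all
      then have "emeasure lebesgue {x\<in>\<Omega>. ennreal s < ennreal (\<bar>f x\<bar> powr q)}
          \<le> ennreal ((d / s powr (1 / q)) powr (m * q))"
        unfolding eqS using d norm by (intro weak_Lp_distribution[OF \<Omega>(2) \<Omega>l])
      also have "(d / s powr (1 / q)) powr (m * q) = d powr (m * q) * s powr (- m)"
      proof -
        have "(s powr (1 / q)) powr (m * q) = s powr m" using q by (simp add: powr_powr)
        then show ?thesis using d by (simp add: powr_divide powr_minus_divide)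
      qed
      finally show "emeasure lebesgue {x\<in>\<Omega>. ennreal s < ennreal (\<bar>f x\<bar> powr q)} \<le> ennreal (d powr (m * q) * s powr (- m))" .
    qed
    moreover have "(d powr (m * q)) powr (1 / m) = d powr q" using m by (simp add: powr_powr)
    ultimately show "Morrey_weight \<Omega> (1 - 1 / m) (c * d powr q) (\<lambda>x. ennreal (\<bar>f x\<bar> powr q))" by simp
  qed
qed

text \<open>A bounded function restricted to a level set of \<open>u\<close> is a weight whose constant tends to 0 with
  the measure of the level set.\<close>

lemma Morrey_weight_level:
  fixes u :: "real^'n::finite \<Rightarrow> real"
  assumes \<Omega>: "bounded \<Omega>" "\<Omega> \<in> sets lebesgue" and [measurable]: "u \<in> borel_measurable (lebesgue_on \<Omega>)"
    and M: "0 \<le> M" and \<theta>: "0 \<le> \<theta>" "\<theta> \<le> 1"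
  shows "Morrey_weight \<Omega> \<theta> (M * measure lebesgue {x\<in>\<Omega>. s < \<bar>u x\<bar>} powr (1 - \<theta>))
    (\<lambda>x. ennreal M * indicator {x\<in>\<Omega>. s < \<bar>u x\<bar>} x)"
proof -
  let ?L = "{x\<in>\<Omega>. s < \<bar>u x\<bar>}"
  have "{x\<in>space (lebesgue_on \<Omega>). s < \<bar>u x\<bar>} \<in> sets (lebesgue_on \<Omega>)" by measurable
  then have L [measurable]: "?L \<in> sets (lebesgue_on \<Omega>)" by simp
  then have Ll: "?L \<in> sets lebesgue" using \<Omega> by (simp add: sets_restrict_space_iff)
  show ?thesis unfolding Morrey_weight_def
  proof (intro conjI ballI impI)
    show "(\<lambda>x. ennreal M * indicator ?L x) \<in> borel_measurable (lebesgue_on \<Omega>)" by measurable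
    fix E assume E: "E \<in> sets lebesgue" "E \<subseteq> \<Omega>"
    have fin: "emeasure lebesgue (?L \<inter> E) = ennreal (measure lebesgue (?L \<inter> E))"
      using E by (intro finite_emeasure_subset[OF \<Omega>]) auto
    have le: "measure lebesgue (?L \<inter> E) \<le> measure lebesgue ?L" "measure lebesgue (?L \<inter> E) \<le> measure lebesgue E"
    proof -
      have fm: "S \<in> fmeasurable lebesgue" if "S \<in> sets lebesgue" "S \<subseteq> \<Omega>" for S
        using finite_emeasure_subset(2)[OF \<Omega> that(2)] that(1) by (auto intro: fmeasurableI)
      have f2: "?L \<in> fmeasurable lebesgue" "E \<in> fmeasurable lebesgue" using Ll E by (auto intro!: fm)
      have LE: "?L \<inter> E \<in> sets lebesgue" using Ll E(1) by (rule sets.Int)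
      show "measure lebesgue (?L \<inter> E) \<le> measure lebesgue ?L"
        by (rule measure_mono_fmeasurable[OF Int_lower1 LE f2(1)])
      show "measure lebesgue (?L \<inter> E) \<le> measure lebesgue E"
        by (rule measure_mono_fmeasurable[OF Int_lower2 LE f2(2)])
    qed
    have "(\<integral>\<^sup>+x. ennreal M * indicator ?L x * indicator E x \<partial>lebesgue_on \<Omega>)
        = (\<integral>\<^sup>+x. ennreal M * indicator (?L \<inter> E) x \<partial>lebesgue_on \<Omega>)"
      by (intro nn_integral_cong) (simp add: indicator_def)
    also have "\<dots> = ennreal M * (\<integral>\<^sup>+x. indicator (?L \<inter> E) x \<partial>lebesgue_on \<Omega>)"
      using E Ll \<Omega> by (intro nn_integral_cmult borel_measurable_indicator) (auto simp: sets_restrict_space_iff)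
    also have "(\<integral>\<^sup>+x. indicator (?L \<inter> E) x \<partial>lebesgue_on \<Omega>) = ennreal (measure lebesgue (?L \<inter> E))"
      unfolding fin[symmetric] using E Ll by (intro nn_integral_lebesgue_on_indicator \<Omega>) auto
    also have "ennreal M * \<dots> = ennreal (M * measure lebesgue (?L \<inter> E))" using M by (simp add: ennreal_mult)
    also have "\<dots> \<le> ennreal (M * measure lebesgue ?L powr (1 - \<theta>) * measure lebesgue E powr \<theta>)"
    proof (rule ennreal_leI)
      have "measure lebesgue (?L \<inter> E) = measure lebesgue (?L \<inter> E) powr (1 - \<theta>) * measure lebesgue (?L \<inter> E) powr \<theta>"
        by (simp add: powr_add[symmetric])
      also have "\<dots> \<le> measure lebesgue ?L powr (1 - \<theta>) * measure lebesgue E powr \<theta>"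
        using \<theta> le by (intro mult_mono powr_mono2) auto
      finally have "M * measure lebesgue (?L \<inter> E) \<le> M * (measure lebesgue ?L powr (1 - \<theta>) * measure lebesgue E powr \<theta>)"
        using M by (rule mult_left_mono)
      then show "M * measure lebesgue (?L \<inter> E) \<le> M * measure lebesgue ?L powr (1 - \<theta>) * measure lebesgue E powr \<theta>"
        by (simp add: mult.assoc)
    qed
    finally show "(\<integral>\<^sup>+x. ennreal M * indicator ?L x * indicator E x \<partial>lebesgue_on \<Omega>)
      \<le> ennreal (M * measure lebesgue ?L powr (1 - \<theta>) * measure lebesgue E powr \<theta>)" .
  qed (use M in auto)
qed

lemma level_measure_tendsto_0:
  fixes u :: "real^'n::finite \<Rightarrow> real"
  assumes \<Omega>: "bounded \<Omega>" "\<Omega> \<in> sets lebesgue" and [measurable]: "u \<in> borel_measurable (lebesgue_on \<Omega>)"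
  shows "(\<lambda>n. measure lebesgue {x\<in>\<Omega>. real n < \<bar>u x\<bar>}) \<longlonglongrightarrow> 0"
proof -
  let ?L = "\<lambda>n::nat. {x\<in>\<Omega>. real n < \<bar>u x\<bar>}"
  have Ll: "?L n \<in> sets lebesgue" for n
  proof -
    have "{x\<in>space (lebesgue_on \<Omega>). real n < \<bar>u x\<bar>} \<in> sets (lebesgue_on \<Omega>)" by measurable
    then show ?thesis using \<Omega> by (simp add: sets_restrict_space_iff)
  qed
  have "(\<lambda>n. measure lebesgue (?L n)) \<longlonglongrightarrow> measure lebesgue (\<Inter>n. ?L n)"
  proof (rule Lim_measure_decseq)
    show "range ?L \<subseteq> sets lebesgue" using Ll by auto
    show "decseq ?L" by (auto simp: decseq_def)
    show "emeasure lebesgue (?L n) \<noteq> \<infinity>" for n using finite_emeasure_subset(2)[OF \<Omega>, of "?L n"] by auto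
  qed
  moreover have "(\<Inter>n. ?L n) = {}"
  proof -
    have "x \<notin> (\<Inter>n. ?L n)" for x
    proof
      assume "x \<in> (\<Inter>n. ?L n)"
      then have "real n < \<bar>u x\<bar>" for n by auto
      moreover obtain n where "\<bar>u x\<bar> \<le> real n" using real_arch_simple by blast
      ultimately show False using not_le by blast
    qed
    then show ?thesis by blast
  qed
  ultimately show ?thesis by simp
qed

section \<open>The weighted energy estimate\<close>

lemma abs_flux_powr:
  fixes z :: real
  assumes "1 < p" shows "(\<bar>z\<bar> powr (p - 1)) powr conj_exponent p = \<bar>z\<bar> powr p"
    and "\<bar>\<bar>z\<bar> powr (p - 2) * z\<bar> = \<bar>z\<bar> powr (p - 1)"
proof -
  show "(\<bar>z\<bar> powr (p - 1)) powr conj_exponent p = \<bar>z\<bar> powr p"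
    using assms by (simp add: powr_powr conj_exponent_def)
  show "\<bar>\<bar>z\<bar> powr (p - 2) * z\<bar> = \<bar>z\<bar> powr (p - 1)"
  proof (cases "z = 0")
    case False
    then have "\<bar>z\<bar> powr (p - 2) * \<bar>z\<bar> powr 1 = \<bar>z\<bar> powr (p - 1)" by (subst powr_add[symmetric]) simp
    then show ?thesis using False by (simp add: abs_mult)
  qed simp
qed

text \<open>The function \<open>u * wt \<gamma> \<epsilon> (u)\<close> is inserted into the equation. Its derivative lies between \<open>wt\<close> and
  \<open>(1 + \<gamma>) * wt\<close>, so Young's inequality with parameter \<open>\<alpha> / 4\<close> for each of the two terms on the right
  leaves half of the coercive term on the left.\<close>

lemma energy_inequality:
  fixes p :: "'n::finite \<Rightarrow> real" and u :: "real^'n \<Rightarrow> real"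
  assumes \<Omega>: "open \<Omega>" and p: "\<And>i. 1 < p i" and \<alpha>: "0 < \<alpha>" and \<gamma>: "0 \<le> \<gamma>" and \<epsilon>: "0 < \<epsilon>" "\<epsilon> \<le> 1"
    and app: "dominated_approx p \<Omega> u Du \<phi> H" and Du: "has_weak_gradient \<Omega> u Du"
    and A: "structure_A \<Omega> p \<alpha> \<beta> A" and B: "\<And>i. caratheodory \<Omega> (B i)"
    and BI: "\<And>i. integrable (lebesgue_on \<Omega>) (\<lambda>x. \<bar>B i x (u x)\<bar> powr conj_exponent (p i))"
    and F: "\<And>i. F i \<in> Lp_space (p i) \<Omega>" and sol: "weak_solution \<Omega> p A B F u"
  defines "K \<equiv> (\<Sum>i\<in>UNIV. (\<alpha> / 4) powr (- (conj_exponent (p i) / p i)))"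
  shows "\<alpha> / 2 * energy p \<Omega> \<gamma> \<epsilon> u Du
    \<le> K * (1 + \<gamma>) * ((\<Sum>i\<in>UNIV. \<integral>x. \<bar>F i x\<bar> powr p i * wt \<gamma> \<epsilon> (u x) \<partial>lebesgue_on \<Omega>)
       + (\<Sum>i\<in>UNIV. \<integral>x. \<bar>B i x (u x)\<bar> powr conj_exponent (p i) * wt \<gamma> \<epsilon> (u x) \<partial>lebesgue_on \<Omega>))"
proof -
  let ?M = "lebesgue_on \<Omega>"
  have \<Omega>l: "\<Omega> \<in> sets lebesgue" using \<Omega> by simp
  note um [measurable] = approx_measurable[OF p \<Omega>l app \<gamma> \<epsilon>]
  note [measurable] = wt_measurable[OF \<gamma> \<epsilon>] dwt_measurable[OF \<gamma> \<epsilon>]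
  have \<phi>: "\<phi> k \<in> test_functions \<Omega>" for k using app by (simp add: dominated_approx_def)
  define w where "w x = wt \<gamma> \<epsilon> (u x)" for x
  define v where "v x = dwt \<gamma> \<epsilon> (u x)" for x
  have wv: "0 \<le> w x" "w x \<le> v x" "v x \<le> (1 + \<gamma>) * w x" "0 \<le> v x" for x
    unfolding w_def v_def using wt_pos(2)[OF \<gamma> \<epsilon>] dwt_bounds[OF \<gamma> \<epsilon>] by auto
  have wC: "w x \<le> (1 / \<epsilon>) powr (\<gamma> / 2)" for x unfolding w_def by (rule wt_le[OF \<gamma> \<epsilon>])
  have [measurable]: "w \<in> borel_measurable ?M" "v \<in> borel_measurable ?M" unfolding w_def v_def by measurable
  define a where "a i x = A i x (Du x)" for i x
  define b where "b i x = B i x (u x)" for i x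
  define f where "f i x = \<bar>F i x\<bar> powr (p i - 2) * F i x" for i x
  have Acar: "caratheodory \<Omega> (A i)" for i using A by (simp add: structure_A_def)
  have am [measurable]: "a i \<in> borel_measurable ?M" for i
    unfolding a_def by (rule caratheodory_comp[OF \<Omega>l Acar]) measurable
  have bm [measurable]: "b i \<in> borel_measurable ?M" for i
    unfolding b_def by (rule caratheodory_comp[OF \<Omega>l B]) measurable
  have [measurable]: "F i \<in> borel_measurable ?M" for i using F by (simp add: Lp_space_def)
  have fm [measurable]: "f i \<in> borel_measurable ?M" for i unfolding f_def by measurable
  have DuI: "integrable ?M (\<lambda>x. \<bar>Du x $ i\<bar> powr p i)" for i
    using app by (auto simp: dominated_approx_def Lp_space_def)
  have aI: "integrable ?M (\<lambda>x. \<bar>a i x\<bar> powr conj_exponent (p i))" for i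
  proof (rule Bochner_Integration.integrable_bound)
    show "integrable ?M (\<lambda>x. \<beta> i powr conj_exponent (p i) * \<bar>Du x $ i\<bar> powr p i)" using DuI by simp
    have "AE x in ?M. \<forall>\<xi>. \<bar>A i x \<xi>\<bar> \<le> \<beta> i * \<bar>\<xi> $ i\<bar> powr (p i - 1)"
      using A by (simp add: structure_A_def)
    then show "AE x in ?M. norm (\<bar>a i x\<bar> powr conj_exponent (p i)) \<le> norm (\<beta> i powr conj_exponent (p i) * \<bar>Du x $ i\<bar> powr p i)"
    proof eventually_elim
      case (elim x)
      then have "\<bar>a i x\<bar> powr conj_exponent (p i) \<le> (\<beta> i * \<bar>Du x $ i\<bar> powr (p i - 1)) powr conj_exponent (p i)"
        unfolding a_def using conj_exponent_gt_1[OF p[of i]] by (intro powr_mono2) auto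
      also have "\<dots> = \<beta> i powr conj_exponent (p i) * \<bar>Du x $ i\<bar> powr p i"
        by (simp only: powr_mult abs_flux_powr(1)[OF p])
      finally show ?case by simp
    qed
  qed measurable
  have bI: "integrable ?M (\<lambda>x. \<bar>b i x\<bar> powr conj_exponent (p i))" for i unfolding b_def by (rule BI)
  have ff: "\<bar>f i x\<bar> powr conj_exponent (p i) = \<bar>F i x\<bar> powr p i" for i x
    unfolding f_def abs_flux_powr(2)[OF p] by (rule abs_flux_powr(1)[OF p])
  have FI: "integrable ?M (\<lambda>x. \<bar>F i x\<bar> powr p i)" for i using F by (simp add: Lp_space_def)
  have fI: "integrable ?M (\<lambda>x. \<bar>f i x\<bar> powr conj_exponent (p i))" for i unfolding ff by (rule FI)
  note flux = flux_integrable[OF p \<Omega>l app \<gamma> \<epsilon>]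
  \<comment> \<open>The truncation of \<open>u\<close> is not smooth; those of the approximating functions are admissible and converge.\<close>
  obtain Du' where Du': "has_weak_gradient \<Omega> u Du'" and eqn: "\<And>\<psi>. \<psi> \<in> test_functions \<Omega> \<Longrightarrow>
      (\<Sum>i\<in>UNIV. \<integral>x. (A i x (Du' x) + B i x (u x)) * partial_deriv i \<psi> x \<partial>?M) =
      (\<Sum>i\<in>UNIV. \<integral>x. \<bar>F i x\<bar> powr (p i - 2) * F i x * partial_deriv i \<psi> x \<partial>?M)"
    using sol unfolding weak_solution_def by blast
  have DD: "AE x in ?M. Du x = Du' x" by (rule weak_gradient_unique[OF \<Omega> Du Du'])
  have [measurable]: "Du' \<in> borel_measurable ?M" by (rule measurable_lebesgue_on_AE[OF \<Omega>l um(3) DD])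
  have a'm [measurable]: "(\<lambda>x. A i x (Du' x)) \<in> borel_measurable ?M" for i
    by (rule caratheodory_comp[OF \<Omega>l Acar]) measurable
  let ?g = "\<lambda>k i x. dwt \<gamma> \<epsilon> (\<phi> k x) * partial_deriv i (\<phi> k) x"
  have eqk: "(\<Sum>i\<in>UNIV. (\<integral>x. a i x * ?g k i x \<partial>?M) + (\<integral>x. b i x * ?g k i x \<partial>?M)) = (\<Sum>i\<in>UNIV. \<integral>x. f i x * ?g k i x \<partial>?M)" for k
  proof -
    define \<psi> where "\<psi> x = \<phi> k x * wt \<gamma> \<epsilon> (\<phi> k x)" for x
    have \<psi>: "\<psi> \<in> test_functions \<Omega>" "\<And>i x. partial_deriv i \<psi> x = ?g k i x"
      unfolding \<psi>_def[abs_def] by (rule truncation_test_function[OF \<gamma> \<epsilon> \<phi>])+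
    have "(\<integral>x. a i x * ?g k i x \<partial>?M) + (\<integral>x. b i x * ?g k i x \<partial>?M)
        = (\<integral>x. (A i x (Du' x) + B i x (u x)) * partial_deriv i \<psi> x \<partial>?M)" for i
    proof -
      have "(\<integral>x. a i x * ?g k i x \<partial>?M) + (\<integral>x. b i x * ?g k i x \<partial>?M) = (\<integral>x. (a i x + b i x) * ?g k i x \<partial>?M)"
        unfolding distrib_right
        by (rule Bochner_Integration.integral_add[symmetric]) (rule flux(2)[OF am aI], rule flux(2)[OF bm bI])
      also have "\<dots> = (\<integral>x. (A i x (Du' x) + b i x) * ?g k i x \<partial>?M)"
      proof (rule integral_cong_AE)
        show "AE x in ?M. (a i x + b i x) * ?g k i x = (A i x (Du' x) + b i x) * ?g k i x"
          using DD by eventually_elim (simp add: a_def)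
      qed measurable
      finally show ?thesis by (simp add: \<psi>(2) b_def)
    qed
    then show ?thesis using eqn[OF \<psi>(1)] by (simp add: \<psi>(2) f_def)
  qed
  let ?G = "\<lambda>i x. v x * Du x $ i"
  have "(\<lambda>k. \<Sum>i\<in>UNIV. (\<integral>x. a i x * ?g k i x \<partial>?M) + (\<integral>x. b i x * ?g k i x \<partial>?M))
      \<longlonglongrightarrow> (\<Sum>i\<in>UNIV. (\<integral>x. a i x * ?G i x \<partial>?M) + (\<integral>x. b i x * ?G i x \<partial>?M))"
    unfolding v_def by (intro tendsto_sum tendsto_add flux(3) am bm aI bI)
  moreover have "(\<lambda>k. \<Sum>i\<in>UNIV. \<integral>x. f i x * ?g k i x \<partial>?M) \<longlonglongrightarrow> (\<Sum>i\<in>UNIV. \<integral>x. f i x * ?G i x \<partial>?M)"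
    unfolding v_def by (intro tendsto_sum flux(3) fm fI)
  ultimately have id: "(\<Sum>i\<in>UNIV. (\<integral>x. a i x * ?G i x \<partial>?M) + (\<integral>x. b i x * ?G i x \<partial>?M)) = (\<Sum>i\<in>UNIV. \<integral>x. f i x * ?G i x \<partial>?M)"
    unfolding eqk by (rule LIMSEQ_unique)
  have intG: "integrable ?M (\<lambda>x. a i x * ?G i x)" "integrable ?M (\<lambda>x. b i x * ?G i x)" "integrable ?M (\<lambda>x. f i x * ?G i x)" for i
    unfolding v_def by (intro flux(1) am bm fm aI bI fI)+
  have wI: "integrable ?M (\<lambda>x. w x * \<bar>Du x $ i\<bar> powr p i)" for i
    unfolding w_def by (rule energy_integrable[OF p \<Omega>l app \<gamma> \<epsilon>])
  have vI: "integrable ?M (\<lambda>x. v x * \<bar>Du x $ i\<bar> powr p i)" for i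
  proof (rule Bochner_Integration.integrable_bound)
    show "integrable ?M (\<lambda>x. (1 + \<gamma>) * (w x * \<bar>Du x $ i\<bar> powr p i))" using wI by simp
    show "AE x in ?M. norm (v x * \<bar>Du x $ i\<bar> powr p i) \<le> norm ((1 + \<gamma>) * (w x * \<bar>Du x $ i\<bar> powr p i))"
    proof (rule AE_I2)
      fix x
      have "v x * \<bar>Du x $ i\<bar> powr p i \<le> (1 + \<gamma>) * w x * \<bar>Du x $ i\<bar> powr p i" using wv by (intro mult_right_mono) auto
      then show "norm (v x * \<bar>Du x $ i\<bar> powr p i) \<le> norm ((1 + \<gamma>) * (w x * \<bar>Du x $ i\<bar> powr p i))"
        using wv[of x] \<gamma> by (simp add: abs_mult mult.assoc)
    qed
  qed measurable
  have gwI: "integrable ?M (\<lambda>x. g x * w x)" if gI: "integrable ?M g" and g0: "\<And>x. 0 \<le> g x" for g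
  proof (rule Bochner_Integration.integrable_bound)
    have [measurable]: "g \<in> borel_measurable ?M" using gI by simp
    show "integrable ?M (\<lambda>x. (1 / \<epsilon>) powr (\<gamma> / 2) * g x)" using gI by simp
    show "(\<lambda>x. g x * w x) \<in> borel_measurable ?M" by measurable
    show "AE x in ?M. norm (g x * w x) \<le> norm ((1 / \<epsilon>) powr (\<gamma> / 2) * g x)"
    proof (rule AE_I2)
      fix x
      have "g x * w x \<le> g x * (1 / \<epsilon>) powr (\<gamma> / 2)" using g0 wC by (intro mult_left_mono)
      then show "norm (g x * w x) \<le> norm ((1 / \<epsilon>) powr (\<gamma> / 2) * g x)"
        using wv(1)[of x] g0[of x] by (simp add: abs_mult mult.commute)
    qed
  qed
  have FwI: "integrable ?M (\<lambda>x. \<bar>F i x\<bar> powr p i * w x)" for i by (intro gwI FI) simp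
  have bwI: "integrable ?M (\<lambda>x. \<bar>b i x\<bar> powr conj_exponent (p i) * w x)" for i by (intro gwI bI) simp
  define X where "X = (\<Sum>i\<in>UNIV. \<integral>x. v x * \<bar>Du x $ i\<bar> powr p i \<partial>?M)"
  define R where "R = (\<Sum>i\<in>UNIV. \<integral>x. \<bar>F i x\<bar> powr p i * w x \<partial>?M) + (\<Sum>i\<in>UNIV. \<integral>x. \<bar>b i x\<bar> powr conj_exponent (p i) * w x \<partial>?M)"
  have K0: "(\<alpha> / 4) powr (- (conj_exponent (p i) / p i)) \<le> K" "0 \<le> K" for i
    unfolding K_def by (intro member_le_sum, auto intro!: sum_nonneg)
  have "\<alpha> * X = (\<integral>x. \<alpha> * (\<Sum>i\<in>UNIV. v x * \<bar>Du x $ i\<bar> powr p i) \<partial>?M)"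
    unfolding X_def using vI by simp
  also have "\<dots> \<le> (\<integral>x. (\<Sum>i\<in>UNIV. a i x * ?G i x) \<partial>?M)"
  proof (rule integral_mono_AE)
    have "AE x in ?M. \<forall>\<xi>. \<alpha> * (\<Sum>i\<in>UNIV. \<bar>\<xi> $ i\<bar> powr p i) \<le> (\<Sum>i\<in>UNIV. A i x \<xi> * \<xi> $ i)"
      using A by (simp add: structure_A_def)
    then show "AE x in ?M. \<alpha> * (\<Sum>i\<in>UNIV. v x * \<bar>Du x $ i\<bar> powr p i) \<le> (\<Sum>i\<in>UNIV. a i x * ?G i x)"
    proof eventually_elim
      case (elim x)
      have "v x * (\<alpha> * (\<Sum>i\<in>UNIV. \<bar>Du x $ i\<bar> powr p i)) \<le> v x * (\<Sum>i\<in>UNIV. a i x * Du x $ i)"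
        unfolding a_def using elim wv by (intro mult_left_mono) auto
      then show ?case by (simp add: sum_distrib_left mult_ac)
    qed
  qed (use vI intG in auto)
  also have "\<dots> = (\<Sum>i\<in>UNIV. \<integral>x. a i x * ?G i x \<partial>?M)" using intG by simp
  also have "\<dots> = (\<Sum>i\<in>UNIV. (\<integral>x. f i x * ?G i x \<partial>?M) - (\<integral>x. b i x * ?G i x \<partial>?M))"
    using id by (simp add: sum.distrib sum_subtractf)
  also have "\<dots> \<le> (\<Sum>i\<in>UNIV. \<alpha> / 2 * (\<integral>x. v x * \<bar>Du x $ i\<bar> powr p i \<partial>?M) +
      K * (1 + \<gamma>) * ((\<integral>x. \<bar>F i x\<bar> powr p i * w x \<partial>?M) + (\<integral>x. \<bar>b i x\<bar> powr conj_exponent (p i) * w x \<partial>?M)))"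
  proof (rule sum_mono)
    fix i
    let ?r = "\<lambda>x. \<alpha> / 2 * (v x * \<bar>Du x $ i\<bar> powr p i) +
      K * (1 + \<gamma>) * (\<bar>F i x\<bar> powr p i * w x + \<bar>b i x\<bar> powr conj_exponent (p i) * w x)"
    have "(\<integral>x. f i x * ?G i x \<partial>?M) - (\<integral>x. b i x * ?G i x \<partial>?M) = (\<integral>x. f i x * ?G i x - b i x * ?G i x \<partial>?M)"
      by (rule Bochner_Integration.integral_diff[symmetric]) (rule intG)+
    also have "\<dots> \<le> (\<integral>x. ?r x \<partial>?M)"
    proof (rule integral_mono)
      show "integrable ?M (\<lambda>x. f i x * ?G i x - b i x * ?G i x)" by (intro Bochner_Integration.integrable_diff intG)
      show "integrable ?M ?r" using vI FwI bwI by simp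
      fix x
      let ?K = "(\<alpha> / 4) powr (- (conj_exponent (p i) / p i))"
      have Y: "\<bar>g\<bar> * \<bar>Du x $ i\<bar> \<le> \<alpha> / 4 * \<bar>Du x $ i\<bar> powr p i + K * \<bar>g\<bar> powr conj_exponent (p i)" for g :: real
      proof -
        have "\<bar>g\<bar> * \<bar>Du x $ i\<bar> \<le> \<alpha> / 4 * \<bar>Du x $ i\<bar> powr p i + ?K * \<bar>g\<bar> powr conj_exponent (p i)"
          using \<alpha> by (intro Young_scaled p) auto
        moreover have "?K * \<bar>g\<bar> powr conj_exponent (p i) \<le> K * \<bar>g\<bar> powr conj_exponent (p i)"
          using K0 by (intro mult_right_mono) auto
        ultimately show ?thesis by linarith
      qed
      have "f i x * ?G i x - b i x * ?G i x \<le> \<bar>f i x * ?G i x\<bar> + \<bar>b i x * ?G i x\<bar>" by linarith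
      also have "\<dots> = v x * (\<bar>f i x\<bar> * \<bar>Du x $ i\<bar> + \<bar>b i x\<bar> * \<bar>Du x $ i\<bar>)"
        using wv(4)[of x] by (simp add: abs_mult distrib_left mult_ac)
      also have "\<dots> \<le> v x * (\<alpha> / 2 * \<bar>Du x $ i\<bar> powr p i + K * (\<bar>F i x\<bar> powr p i + \<bar>b i x\<bar> powr conj_exponent (p i)))"
        using Y[of "f i x"] Y[of "b i x"] wv(4)[of x]
        by (intro mult_left_mono) (auto simp: ff distrib_left)
      also have "\<dots> = \<alpha> / 2 * (v x * \<bar>Du x $ i\<bar> powr p i) + v x * (K * (\<bar>F i x\<bar> powr p i + \<bar>b i x\<bar> powr conj_exponent (p i)))"
        by (simp add: algebra_simps)
      also have "\<dots> \<le> \<alpha> / 2 * (v x * \<bar>Du x $ i\<bar> powr p i) + ((1 + \<gamma>) * w x) * (K * (\<bar>F i x\<bar> powr p i + \<bar>b i x\<bar> powr conj_exponent (p i)))"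
        using wv K0 by (intro add_left_mono mult_right_mono) auto
      also have "\<dots> = ?r x" by (simp add: algebra_simps)
      finally show "f i x * ?G i x - b i x * ?G i x \<le> ?r x" .
    qed
    also have "\<dots> = \<alpha> / 2 * (\<integral>x. v x * \<bar>Du x $ i\<bar> powr p i \<partial>?M) +
      K * (1 + \<gamma>) * ((\<integral>x. \<bar>F i x\<bar> powr p i * w x \<partial>?M) + (\<integral>x. \<bar>b i x\<bar> powr conj_exponent (p i) * w x \<partial>?M))"
      using vI FwI bwI by simp
    finally show "(\<integral>x. f i x * ?G i x \<partial>?M) - (\<integral>x. b i x * ?G i x \<partial>?M) \<le> \<alpha> / 2 * (\<integral>x. v x * \<bar>Du x $ i\<bar> powr p i \<partial>?M) +
      K * (1 + \<gamma>) * ((\<integral>x. \<bar>F i x\<bar> powr p i * w x \<partial>?M) + (\<integral>x. \<bar>b i x\<bar> powr conj_exponent (p i) * w x \<partial>?M))" .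
  qed
  also have "\<dots> = \<alpha> / 2 * X + K * (1 + \<gamma>) * R"
    unfolding X_def R_def by (simp add: sum.distrib sum_distrib_left distrib_left)
  finally have "\<alpha> / 2 * X \<le> K * (1 + \<gamma>) * R" by linarith
  moreover have "(\<Sum>i\<in>UNIV. \<integral>x. w x * \<bar>Du x $ i\<bar> powr p i \<partial>?M) \<le> X"
    unfolding X_def using wv by (intro sum_mono integral_mono wI vI mult_right_mono) auto
  then have "\<alpha> / 2 * (\<Sum>i\<in>UNIV. \<integral>x. w x * \<bar>Du x $ i\<bar> powr p i \<partial>?M) \<le> \<alpha> / 2 * X"
    using \<alpha> by (intro mult_left_mono) auto
  ultimately show ?thesis unfolding R_def w_def b_def by linarith
qed

lemma integral_le_of_nn_integral:
  fixes f :: "'a \<Rightarrow> real"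
  assumes [measurable]: "f \<in> borel_measurable M" and f: "\<And>x. 0 \<le> f x"
    and le: "(\<integral>\<^sup>+x. ennreal (f x) \<partial>M) \<le> ennreal c" and c: "0 \<le> c"
  shows "integrable M f" "(\<integral>x. f x \<partial>M) \<le> c"
proof -
  show "integrable M f"
    by (rule integrableI_bounded) (use f le in \<open>auto simp: le_less_trans\<close>)
  have "(\<integral>x. f x \<partial>M) = enn2real (\<integral>\<^sup>+x. ennreal (f x) \<partial>M)" using f by (intro integral_eq_nn_integral) auto
  also have "\<dots> \<le> enn2real (ennreal c)" using le by (intro enn2real_mono) auto
  finally show "(\<integral>x. f x \<partial>M) \<le> c" using c by simp
qed

lemma abs_powr_le_sq:
  fixes t q :: real
  assumes "0 \<le> q" shows "\<bar>t\<bar> powr q \<le> (1 + t\<^sup>2) powr (q / 2)"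
proof (cases "t = 0")
  case False
  then have "\<bar>t\<bar> powr q = (\<bar>t\<bar> powr 2) powr (q / 2)" unfolding powr_powr by simp
  also have "\<bar>t\<bar> powr 2 = t\<^sup>2" using False by simp
  also have "t\<^sup>2 powr (q / 2) \<le> (1 + t\<^sup>2) powr (q / 2)" using assms by (intro powr_mono2) auto
  finally show ?thesis .
qed simp

lemma wt_le_sq:
  assumes "0 \<le> \<gamma>" "0 < \<epsilon>" "\<epsilon> \<le> 1" shows "wt \<gamma> \<epsilon> t \<le> (1 + t\<^sup>2) powr (\<gamma> / 2)"
  unfolding wt_def using wt_base(2,4)[OF assms(2,3), of t] assms(1) by (intro powr_mono2) auto

text \<open>The coefficient is split into its small part, the bounded part on a set where \<open>u\<close> is large and
  which is therefore small, and the bounded part where \<open>u\<close> is bounded.\<close>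

lemma lower_order_bound:
  fixes u b g f :: "real^'n::finite \<Rightarrow> real"
  assumes \<Omega>: "bounded \<Omega>" "\<Omega> \<in> sets lebesgue" and \<gamma>: "0 \<le> \<gamma>" and \<epsilon>: "0 < \<epsilon>" "\<epsilon> \<le> 1"
    and r: "0 < r" and q: "0 \<le> q" and nn: "0 \<le> C" "0 \<le> D" "0 \<le> M"
    and [measurable]: "u \<in> borel_measurable (lebesgue_on \<Omega>)" "f \<in> borel_measurable (lebesgue_on \<Omega>)"
      "b \<in> borel_measurable (lebesgue_on \<Omega>)" "g \<in> borel_measurable (lebesgue_on \<Omega>)"
    and Hardy: "\<And>V \<kappa>. Morrey_weight \<Omega> \<theta> \<kappa> V \<Longrightarrow>
      (\<integral>\<^sup>+x. V x * ennreal ((1 + (u x)\<^sup>2) powr (q / 2) * wt \<gamma> \<epsilon> (u x)) \<partial>lebesgue_on \<Omega>) \<le> ennreal (C * \<kappa> * D)"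
    and f: "AE x in lebesgue_on \<Omega>. \<bar>f x\<bar> \<le> b x * \<bar>u x\<bar> powr (q / r)"
    and g: "AE x in lebesgue_on \<Omega>. \<bar>g x\<bar> \<le> M"
    and V1: "Morrey_weight \<Omega> \<theta> \<kappa>1 (\<lambda>x. ennreal (\<bar>b x - g x\<bar> powr r))"
    and V2: "Morrey_weight \<Omega> \<theta> \<kappa>2 (\<lambda>x. ennreal (M powr r) * indicator {x\<in>\<Omega>. n < \<bar>u x\<bar>} x)"
  defines "c \<equiv> 2 powr r * (C * (\<kappa>1 + \<kappa>2) * D) + 2 powr r * M powr r * (1 + n\<^sup>2) powr ((q + \<gamma>) / 2) * measure lebesgue \<Omega>"
  shows "integrable (lebesgue_on \<Omega>) (\<lambda>x. \<bar>f x\<bar> powr r)"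
    "(\<integral>x. \<bar>f x\<bar> powr r * wt \<gamma> \<epsilon> (u x) \<partial>lebesgue_on \<Omega>) \<le> c"
proof -
  let ?M = "lebesgue_on \<Omega>"
  note [measurable] = wt_measurable[OF \<gamma> \<epsilon>]
  have w: "0 \<le> wt \<gamma> \<epsilon> t" "1 \<le> wt \<gamma> \<epsilon> t" for t by (rule wt_pos[OF \<gamma> \<epsilon>], rule wt_ge_1[OF \<gamma> \<epsilon>])
  have \<kappa>: "0 \<le> \<kappa>1" "0 \<le> \<kappa>2" using V1 V2 unfolding Morrey_weight_def by blast+
  have c0: "0 \<le> c" unfolding c_def using nn \<kappa> by (intro add_nonneg_nonneg mult_nonneg_nonneg) auto
  let ?W = "\<lambda>x. ennreal (\<bar>b x - g x\<bar> powr r) + ennreal (M powr r) * indicator {x\<in>\<Omega>. n < \<bar>u x\<bar>} x"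
  let ?h = "\<lambda>x. (1 + (u x)\<^sup>2) powr (q / 2) * wt \<gamma> \<epsilon> (u x)"
  let ?k = "2 powr r * M powr r * (1 + n\<^sup>2) powr ((q + \<gamma>) / 2)"
  have W: "Morrey_weight \<Omega> \<theta> (\<kappa>1 + \<kappa>2) ?W" by (rule Morrey_weight_add[OF V1 V2 \<Omega>(2)])
  then have Wm: "?W \<in> borel_measurable ?M" unfolding Morrey_weight_def by blast
  have pt: "AE x in ?M. ennreal (\<bar>f x\<bar> powr r * wt \<gamma> \<epsilon> (u x)) \<le> ennreal (2 powr r) * (?W x * ennreal (?h x)) + ennreal ?k"
    using f g AE_space
  proof eventually_elim
    case (elim x)
    then have x: "x \<in> \<Omega>" by simp
    have h0: "0 \<le> ?h x" using w by simp
    have "\<bar>f x\<bar> powr r \<le> (\<bar>b x\<bar> * \<bar>u x\<bar> powr (q / r)) powr r"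
      using order_trans[OF elim(1) mult_right_mono[OF abs_ge_self powr_ge_zero]] r by (intro powr_mono2) auto
    also have "\<dots> = \<bar>b x\<bar> powr r * \<bar>u x\<bar> powr q" using r by (simp add: powr_mult powr_powr)
    also have "\<dots> \<le> \<bar>b x\<bar> powr r * (1 + (u x)\<^sup>2) powr (q / 2)" by (intro mult_left_mono abs_powr_le_sq q) auto
    finally have 1: "\<bar>f x\<bar> powr r * wt \<gamma> \<epsilon> (u x) \<le> \<bar>b x\<bar> powr r * ?h x"
      using w by (simp add: mult.assoc[symmetric] mult_right_mono)
    have "\<bar>b x\<bar> powr r \<le> 2 powr r * (\<bar>b x - g x\<bar> powr r + \<bar>g x\<bar> powr r)"
      using abs_powr_add_le[OF r, of "b x - g x" "g x"] by simp
    also have "\<dots> \<le> 2 powr r * (\<bar>b x - g x\<bar> powr r + M powr r)"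
      using elim r by (intro mult_left_mono add_left_mono powr_mono2) auto
    finally have "\<bar>b x\<bar> powr r * ?h x \<le> 2 powr r * (\<bar>b x - g x\<bar> powr r + M powr r) * ?h x"
      using h0 by (rule mult_right_mono)
    with 1 have 2: "\<bar>f x\<bar> powr r * wt \<gamma> \<epsilon> (u x) \<le> 2 powr r * (\<bar>b x - g x\<bar> powr r + M powr r) * ?h x" by linarith
    show ?case
    proof (cases "n < \<bar>u x\<bar>")
      case True
      have "ennreal (\<bar>f x\<bar> powr r * wt \<gamma> \<epsilon> (u x)) \<le> ennreal (2 powr r * (\<bar>b x - g x\<bar> powr r + M powr r) * ?h x)"
        by (rule ennreal_leI[OF 2])
      also have "\<dots> = ennreal (2 powr r) * (ennreal (\<bar>b x - g x\<bar> powr r + M powr r) * ennreal (?h x))"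
        using h0 by (simp only: ennreal_mult'[symmetric] ennreal_mult''[symmetric] mult.assoc powr_ge_zero add_nonneg_nonneg)
      also have "ennreal (\<bar>b x - g x\<bar> powr r + M powr r) = ?W x" using True x by (simp add: ennreal_plus)
      finally show ?thesis by (rule order_trans) simp
    next
      case False
      have n0: "0 \<le> n" using False abs_ge_zero[of "u x"] by linarith
      have un: "(u x)\<^sup>2 \<le> n\<^sup>2" using False n0 by (simp add: abs_le_square_iff[symmetric])
      have "?h x \<le> (1 + (u x)\<^sup>2) powr (q / 2) * (1 + (u x)\<^sup>2) powr (\<gamma> / 2)"
        by (intro mult_left_mono wt_le_sq \<gamma> \<epsilon>) auto
      also have "\<dots> = (1 + (u x)\<^sup>2) powr ((q + \<gamma>) / 2)" by (simp add: powr_add[symmetric] add_divide_distrib)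
      also have "\<dots> \<le> (1 + n\<^sup>2) powr ((q + \<gamma>) / 2)" using un q \<gamma> by (intro powr_mono2) auto
      finally have 3: "2 powr r * M powr r * ?h x \<le> ?k" by (intro mult_left_mono) auto
      have "2 powr r * (\<bar>b x - g x\<bar> powr r + M powr r) * ?h x
          = 2 powr r * (\<bar>b x - g x\<bar> powr r * ?h x) + 2 powr r * M powr r * ?h x" by (simp add: algebra_simps)
      with 2 3 have "\<bar>f x\<bar> powr r * wt \<gamma> \<epsilon> (u x) \<le> 2 powr r * (\<bar>b x - g x\<bar> powr r * ?h x) + ?k" by linarith
      then have "ennreal (\<bar>f x\<bar> powr r * wt \<gamma> \<epsilon> (u x)) \<le> ennreal (2 powr r * (\<bar>b x - g x\<bar> powr r * ?h x) + ?k)"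
        by (rule ennreal_leI)
      also have "\<dots> = ennreal (2 powr r * (\<bar>b x - g x\<bar> powr r * ?h x)) + ennreal ?k"
      proof (rule ennreal_plus)
        show "0 \<le> 2 powr r * (\<bar>b x - g x\<bar> powr r * ?h x)"
          using w by (intro mult_nonneg_nonneg) (simp_all only: powr_ge_zero)
      qed simp
      also have "ennreal (2 powr r * (\<bar>b x - g x\<bar> powr r * ?h x)) = ennreal (2 powr r) * (ennreal (\<bar>b x - g x\<bar> powr r) * ennreal (?h x))"
        by (simp only: ennreal_mult'[OF powr_ge_zero])
      also have "ennreal (\<bar>b x - g x\<bar> powr r) = ?W x" using False by simp
      finally show ?thesis .
    qed
  qed
  define Z where "Z x = ?W x * ennreal (?h x)" for x
  have Zm [measurable]: "Z \<in> borel_measurable ?M"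
  proof -
    have "(\<lambda>x. ennreal (?h x)) \<in> borel_measurable ?M" by measurable
    with Wm show ?thesis unfolding Z_def[abs_def] by (rule borel_measurable_times_ennreal)
  qed
  have "(\<integral>\<^sup>+x. ennreal (\<bar>f x\<bar> powr r * wt \<gamma> \<epsilon> (u x)) \<partial>?M) \<le> (\<integral>\<^sup>+x. ennreal (2 powr r) * Z x + ennreal ?k \<partial>?M)"
    unfolding Z_def by (rule nn_integral_mono_AE[OF pt])
  also have "\<dots> = ennreal (2 powr r) * (\<integral>\<^sup>+x. Z x \<partial>?M) + ennreal ?k * emeasure ?M \<Omega>"
    by (subst nn_integral_add) (simp_all add: nn_integral_cmult)
  also have "\<dots> \<le> ennreal (2 powr r) * ennreal (C * (\<kappa>1 + \<kappa>2) * D) + ennreal ?k * ennreal (measure lebesgue \<Omega>)"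
  proof (intro add_mono mult_left_mono)
    show "(\<integral>\<^sup>+x. Z x \<partial>?M) \<le> ennreal (C * (\<kappa>1 + \<kappa>2) * D)" unfolding Z_def by (rule Hardy[OF W])
    show "emeasure ?M \<Omega> \<le> ennreal (measure lebesgue \<Omega>)"
      using finite_emeasure_subset(1)[OF \<Omega>, of \<Omega>] \<Omega> by (simp add: emeasure_restrict_space)
  qed auto
  also have "\<dots> = ennreal c"
    unfolding c_def using nn \<kappa> by (subst ennreal_plus) (auto simp: ennreal_mult)
  finally have le: "(\<integral>\<^sup>+x. ennreal (\<bar>f x\<bar> powr r * wt \<gamma> \<epsilon> (u x)) \<partial>?M) \<le> ennreal c" .
  show "(\<integral>x. \<bar>f x\<bar> powr r * wt \<gamma> \<epsilon> (u x) \<partial>?M) \<le> c"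
    using w le c0 by (intro integral_le_of_nn_integral) auto
  have "(\<integral>\<^sup>+x. ennreal (\<bar>f x\<bar> powr r) \<partial>?M) \<le> (\<integral>\<^sup>+x. ennreal (\<bar>f x\<bar> powr r * wt \<gamma> \<epsilon> (u x)) \<partial>?M)"
  proof (intro nn_integral_mono ennreal_leI)
    show "\<bar>f x\<bar> powr r \<le> \<bar>f x\<bar> powr r * wt \<gamma> \<epsilon> (u x)" for x
      using mult_left_mono[OF w(2), of "\<bar>f x\<bar> powr r" "u x"] by simp
  qed
  then show "integrable ?M (\<lambda>x. \<bar>f x\<bar> powr r)"
    using le c0 by (intro integral_le_of_nn_integral(1)[of _ _ c]) auto
qed

text \<open>The distance \<open>d\<close> is admissible if the lower order terms can be absorbed for every problem with
  the given \<open>p\<close> and \<open>\<alpha>\<close>; in the energy bound \<open>C\<close> may depend on the problem, but not on \<open>\<epsilon>\<close>.\<close>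

definition energy_distance :: "('n::finite \<Rightarrow> real) \<Rightarrow> real \<Rightarrow> real \<Rightarrow> real \<Rightarrow> bool" where
  "energy_distance p \<alpha> \<gamma> d \<longleftrightarrow> (\<forall>(\<Omega> :: (real^'n) set) \<beta> A B b F u Du \<phi> H. open \<Omega> \<longrightarrow> bounded \<Omega> \<longrightarrow>
    structure_A \<Omega> p \<alpha> \<beta> A \<longrightarrow> structure_B \<Omega> p b B \<longrightarrow>
    (\<forall>i. dist_to_Linf (real CARD('n) * conj_exponent (p i) / harmonic_mean p) \<Omega> (b i) < ennreal d) \<longrightarrow>
    (\<forall>i. F i \<in> Lp_space (p i) \<Omega>) \<longrightarrow> weak_solution \<Omega> p A B F u \<longrightarrow>
    has_weak_gradient \<Omega> u Du \<longrightarrow> dominated_approx p \<Omega> u Du \<phi> H \<longrightarrow>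
    (\<exists>C\<ge>0. \<forall>\<epsilon>. 0 < \<epsilon> \<longrightarrow> \<epsilon> \<le> 1 \<longrightarrow> energy p \<Omega> \<gamma> \<epsilon> u Du
       \<le> C + C * (\<Sum>i\<in>UNIV. \<integral>x. \<bar>F i x\<bar> powr p i * wt \<gamma> \<epsilon> (u x) \<partial>lebesgue_on \<Omega>)))"

lemma energy_distanceD:
  fixes p :: "'n::finite \<Rightarrow> real"
  assumes "energy_distance p \<alpha> \<gamma> d" "open \<Omega>" "bounded \<Omega>" "structure_A \<Omega> p \<alpha> \<beta> A" "structure_B \<Omega> p b B"
    "\<forall>i. dist_to_Linf (real CARD('n) * conj_exponent (p i) / harmonic_mean p) \<Omega> (b i) < ennreal d"
    "\<forall>i. F i \<in> Lp_space (p i) \<Omega>" "weak_solution \<Omega> p A B F u"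
    "has_weak_gradient \<Omega> u Du" "dominated_approx p \<Omega> u Du \<phi> H"
  obtains C where "0 \<le> C" "\<And>\<epsilon>. 0 < \<epsilon> \<Longrightarrow> \<epsilon> \<le> 1 \<Longrightarrow> energy p \<Omega> \<gamma> \<epsilon> u Du
       \<le> C + C * (\<Sum>i\<in>UNIV. \<integral>x. \<bar>F i x\<bar> powr p i * wt \<gamma> \<epsilon> (u x) \<partial>lebesgue_on \<Omega>)"
  using assms(1)[unfolded energy_distance_def, rule_format, OF assms(2-5) assms(6)[rule_format] assms(7)[rule_format] assms(8-10)]
  by blast

text \<open>Smallness is needed twice: \<open>d\<close> makes the contribution of what remains of \<open>b i\<close> after subtracting
  a bounded function at most \<open>\<alpha> / 8\<close> times the energy, and then a height \<open>n\<close>, which depends on the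
  solution, does the same for the bounded function on the set \<open>\<bar>u\<bar> > n\<close>. The constant \<open>C\<close> depends on \<open>n\<close>,
  but not on \<open>\<epsilon>\<close>.\<close>

lemma energy_estimate:
  fixes p :: "'n::finite \<Rightarrow> real"
  assumes N: "CARD('n) > 1" and p: "\<And>i. 1 < p i" and \<alpha>: "0 < \<alpha>" and \<gamma>: "0 \<le> \<gamma>"
  defines "q \<equiv> harmonic_mean p"
  assumes q: "1 < q" "q < real CARD('n)"
  shows "\<exists>d>0. energy_distance p \<alpha> \<gamma> d"
proof -
  define m where "m = real CARD('n) / q"
  define \<theta> where "\<theta> = 1 - q / real CARD('n)"
  have m: "1 < m" "1 - 1 / m = \<theta>" using q by (simp_all add: m_def \<theta>_def)
  have \<theta>: "0 \<le> \<theta>" "\<theta> < 1" using q by (simp_all add: \<theta>_def)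
  define pc where "pc i = conj_exponent (p i)" for i
  have pc: "1 < pc i" "0 < pc i" for i using conj_exponent_gt_1[OF p[of i]] by (simp_all add: pc_def)
  obtain C where C: "C > 0" and Hardy: "\<And>(\<Omega> :: (real^'n) set) u Du \<phi> H V \<kappa> \<epsilon>. open \<Omega> \<Longrightarrow> bounded \<Omega> \<Longrightarrow> 0 < \<epsilon> \<Longrightarrow> \<epsilon> \<le> 1 \<Longrightarrow>
     dominated_approx p \<Omega> u Du \<phi> H \<Longrightarrow> Morrey_weight \<Omega> \<theta> \<kappa> V \<Longrightarrow>
     (\<integral>\<^sup>+x. V x * ennreal ((1 + (u x)\<^sup>2) powr (q / 2) * wt \<gamma> \<epsilon> (u x)) \<partial>lebesgue_on \<Omega>)
      \<le> ennreal (C * \<kappa> * (measure lebesgue \<Omega> powr \<theta> + energy p \<Omega> \<gamma> \<epsilon> u Du))"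
    using Hardy_W0[OF N, of p \<gamma>] p q \<gamma> unfolding q_def \<theta>_def by blast
  obtain c where c: "c > 0" and weak: "\<And>(\<Omega> :: (real^'n) set) f d r. open \<Omega> \<Longrightarrow> bounded \<Omega> \<Longrightarrow>
    f \<in> borel_measurable (lebesgue_on \<Omega>) \<Longrightarrow> 0 < d \<Longrightarrow> 0 < r \<Longrightarrow> weak_Lp_norm (m * r) \<Omega> f < ennreal d \<Longrightarrow>
    Morrey_weight \<Omega> \<theta> (c * d powr r) (\<lambda>x. ennreal (\<bar>f x\<bar> powr r))"
    using Morrey_weight_Marcinkiewicz[OF m(1), where 'n = 'n] unfolding m(2) by blast
  define K where "K = (\<Sum>i\<in>UNIV. (\<alpha> / 4) powr (- (conj_exponent (p i) / p i))) * (1 + \<gamma>)"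
  have K: "0 < K" unfolding K_def using \<alpha> \<gamma> by (intro mult_pos_pos sum_pos) auto
  define S where "S = (\<Sum>i\<in>UNIV. 2 powr pc i)"
  have S: "0 < S" unfolding S_def by (intro sum_pos) auto
  define d where "d = min 1 (\<alpha> / (8 * K * S * C * c))"
  have d: "0 < d" "d \<le> 1" using \<alpha> K S C c by (simp_all add: d_def)
  have dK: "K * (S * (C * (c * d))) \<le> \<alpha> / 8"
  proof -
    have "d * (8 * K * S * C * c) \<le> \<alpha> / (8 * K * S * C * c) * (8 * K * S * C * c)"
      unfolding d_def using K S C c by (intro mult_right_mono) auto
    also have "\<dots> = \<alpha>" using K S C c by simp
    finally show ?thesis by (simp add: mult_ac)
  qed
  show ?thesis
    unfolding energy_distance_def q_def[symmetric]
  proof (rule exI[of _ d], intro conjI d(1) allI impI)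
    fix \<Omega> :: "(real^'n) set" and \<beta> A B b F u Du \<phi> H
    assume \<Omega>: "open \<Omega>" "bounded \<Omega>" and A: "structure_A \<Omega> p \<alpha> \<beta> A" and B: "structure_B \<Omega> p b B"
      and dist: "\<forall>i. dist_to_Linf (real CARD('n) * conj_exponent (p i) / q) \<Omega> (b i) < ennreal d"
      and F: "\<forall>i. F i \<in> Lp_space (p i) \<Omega>" and sol: "weak_solution \<Omega> p A B F u"
      and Du: "has_weak_gradient \<Omega> u Du" and app: "dominated_approx p \<Omega> u Du \<phi> H"
    have \<Omega>l: "\<Omega> \<in> sets lebesgue" using \<Omega> by simp
    let ?M = "lebesgue_on \<Omega>"
    have um [measurable]: "u \<in> borel_measurable ?M" using app by (simp add: dominated_approx_def)
    have Bcar: "caratheodory \<Omega> (B i)" and bm [measurable]: "b i \<in> borel_measurable ?M"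
      and Bb: "AE x in ?M. \<forall>s. \<bar>B i x s\<bar> \<le> b i x * \<bar>s\<bar> powr (q / pc i)" for i
      using B by (auto simp: structure_B_def weak_Lp_space_def q_def pc_def)
    have Bm [measurable]: "(\<lambda>x. B i x (u x)) \<in> borel_measurable ?M" for i
      by (rule caratheodory_comp[OF \<Omega>l Bcar um])
    have Bu: "AE x in ?M. \<bar>B i x (u x)\<bar> \<le> b i x * \<bar>u x\<bar> powr (q / pc i)" for i
      using Bb[of i] by eventually_elim blast
    have ex: "\<exists>g M. g \<in> borel_measurable ?M \<and> 0 \<le> M \<and> (AE x in ?M. \<bar>g x\<bar> \<le> M) \<and>
        weak_Lp_norm (m * pc i) \<Omega> (\<lambda>x. b i x - g x) < ennreal d" for i
    proof -
      have "real CARD('n) * conj_exponent (p i) / q = m * pc i" by (simp add: m_def pc_def)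
      then obtain g where g: "g \<in> Linf_space \<Omega>" "weak_Lp_norm (m * pc i) \<Omega> (\<lambda>x. b i x - g x) < ennreal d"
        using dist[rule_format, of i] unfolding dist_to_Linf_def by (auto simp: INF_less_iff)
      then obtain M where M: "AE x in ?M. \<bar>g x\<bar> \<le> M" unfolding Linf_space_def by blast
      have "AE x in ?M. \<bar>g x\<bar> \<le> max M 0" using M by eventually_elim simp
      moreover have "g \<in> borel_measurable ?M" using g(1) by (simp add: Linf_space_def)
      ultimately show ?thesis using g(2) max.cobounded2[of 0 M] by blast
    qed
    obtain g M where g [measurable]: "\<And>i. g i \<in> borel_measurable ?M" and M: "\<And>i. 0 \<le> M i"
      and gM: "\<And>i. AE x in ?M. \<bar>g i x\<bar> \<le> M i"
      and gb: "\<And>i. weak_Lp_norm (m * pc i) \<Omega> (\<lambda>x. b i x - g i x) < ennreal d"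
    proof -
      obtain g where "\<forall>i. \<exists>M. g i \<in> borel_measurable ?M \<and> 0 \<le> M \<and> (AE x in ?M. \<bar>g i x\<bar> \<le> M) \<and>
          weak_Lp_norm (m * pc i) \<Omega> (\<lambda>x. b i x - g i x) < ennreal d"
        using choice[of "\<lambda>i g. \<exists>M. g \<in> borel_measurable ?M \<and> 0 \<le> M \<and> (AE x in ?M. \<bar>g x\<bar> \<le> M) \<and>
          weak_Lp_norm (m * pc i) \<Omega> (\<lambda>x. b i x - g x) < ennreal d"] ex by blast
      from choice[OF this] show thesis using that by blast
    qed
    define l where "l n = measure lebesgue {x\<in>\<Omega>. real n < \<bar>u x\<bar>}" for n :: nat
    have "l \<longlonglongrightarrow> 0" unfolding l_def[abs_def] by (rule level_measure_tendsto_0[OF \<Omega>(2) \<Omega>l um])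
    then have "(\<lambda>n. l n powr (1 - \<theta>)) \<longlonglongrightarrow> 0"
      by (rule tendsto_zero_powrI[OF _ tendsto_const]) (use \<theta> in \<open>auto simp: l_def\<close>)
    then have "(\<lambda>n. K * (C * (\<Sum>i\<in>UNIV. 2 powr pc i * M i powr pc i) * l n powr (1 - \<theta>)))
        \<longlonglongrightarrow> K * (C * (\<Sum>i\<in>UNIV. 2 powr pc i * M i powr pc i) * 0)"
      by (intro tendsto_mult tendsto_const)
    then have "eventually (\<lambda>n. K * (C * (\<Sum>i\<in>UNIV. 2 powr pc i * M i powr pc i) * l n powr (1 - \<theta>)) < \<alpha> / 8) sequentially"
      using \<alpha> by (intro order_tendstoD(2)) auto
    then obtain n where n: "K * (C * (\<Sum>i\<in>UNIV. 2 powr pc i * M i powr pc i) * l n powr (1 - \<theta>)) < \<alpha> / 8"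
      using eventually_happens'[OF sequentially_bot] by blast
    define k1 where "k1 i = c * d powr pc i" for i
    define k2 where "k2 i = M i powr pc i * l n powr (1 - \<theta>)" for i
    have V1: "Morrey_weight \<Omega> \<theta> (k1 i) (\<lambda>x. ennreal (\<bar>b i x - g i x\<bar> powr pc i))" for i
      unfolding k1_def using gb d pc by (intro weak[OF \<Omega>]) auto
    have V2: "Morrey_weight \<Omega> \<theta> (k2 i) (\<lambda>x. ennreal (M i powr pc i) * indicator {x\<in>\<Omega>. real n < \<bar>u x\<bar>} x)" for i
      unfolding k2_def l_def using \<theta> by (intro Morrey_weight_level \<Omega>(2) \<Omega>l um) auto
    define D where "D \<epsilon> = energy p \<Omega> \<gamma> \<epsilon> u Du" for \<epsilon>
    define m\<Omega> where "m\<Omega> = measure lebesgue \<Omega> powr \<theta>"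
    define k3 where "k3 i = 2 powr pc i * M i powr pc i * (1 + (real n)\<^sup>2) powr ((q + \<gamma>) / 2) * measure lebesgue \<Omega>" for i
    have D0: "0 \<le> D \<epsilon>" if "0 < \<epsilon>" "\<epsilon> \<le> 1" for \<epsilon>
      unfolding D_def using wt_pos(2)[OF \<gamma> that] by (intro sum_nonneg integral_nonneg_AE) auto
    have m\<Omega>0: "0 \<le> m\<Omega>" by (simp add: m\<Omega>_def)
    have lower: "integrable ?M (\<lambda>x. \<bar>B i x (u x)\<bar> powr pc i)"
      "(\<integral>x. \<bar>B i x (u x)\<bar> powr pc i * wt \<gamma> \<epsilon> (u x) \<partial>?M) \<le> 2 powr pc i * (C * (k1 i + k2 i) * (m\<Omega> + D \<epsilon>)) + k3 i"
      if \<epsilon>: "0 < \<epsilon>" "\<epsilon> \<le> 1" for i \<epsilon>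
    proof -
      have H: "(\<integral>\<^sup>+x. V x * ennreal ((1 + (u x)\<^sup>2) powr (q / 2) * wt \<gamma> \<epsilon> (u x)) \<partial>?M) \<le> ennreal (C * \<kappa> * (m\<Omega> + D \<epsilon>))"
        if "Morrey_weight \<Omega> \<theta> \<kappa> V" for V \<kappa> unfolding m\<Omega>_def D_def by (rule Hardy[OF \<Omega> \<epsilon> app that])
      have s: "0 \<le> q" "0 \<le> C" "0 \<le> m\<Omega> + D \<epsilon>" using q C D0[OF \<epsilon>] m\<Omega>0 by auto
      note * = lower_order_bound[OF \<Omega>(2) \<Omega>l \<gamma> \<epsilon> pc(2) s(1,2,3) M um Bm bm g H Bu gM V1 V2]
      show "integrable ?M (\<lambda>x. \<bar>B i x (u x)\<bar> powr pc i)" by (rule *(1))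
      show "(\<integral>x. \<bar>B i x (u x)\<bar> powr pc i * wt \<gamma> \<epsilon> (u x) \<partial>?M) \<le> 2 powr pc i * (C * (k1 i + k2 i) * (m\<Omega> + D \<epsilon>)) + k3 i"
        using *(2) by (simp add: k3_def)
    qed
    have BI: "integrable ?M (\<lambda>x. \<bar>B i x (u x)\<bar> powr conj_exponent (p i))" for i
      using lower(1)[of 1 i] by (simp add: pc_def)
    have absorb: "K * (\<Sum>i\<in>UNIV. 2 powr pc i * (C * (k1 i + k2 i))) \<le> \<alpha> / 4"
    proof -
      have "(\<Sum>i\<in>UNIV. 2 powr pc i * (C * k1 i)) \<le> (\<Sum>i\<in>UNIV. 2 powr pc i * (C * (c * d)))"
      proof (intro sum_mono mult_left_mono)
        fix i
        have "d powr pc i \<le> d powr 1" using d pc[of i] by (intro powr_mono') auto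
        then show "k1 i \<le> c * d" unfolding k1_def using c d by (intro mult_left_mono) auto
      qed (use C in auto)
      also have "\<dots> = S * (C * (c * d))" by (simp add: S_def sum_distrib_right)
      finally have "K * (\<Sum>i\<in>UNIV. 2 powr pc i * (C * k1 i)) \<le> K * (S * (C * (c * d)))"
        using K by (intro mult_left_mono) auto
      then have 1: "K * (\<Sum>i\<in>UNIV. 2 powr pc i * (C * k1 i)) \<le> \<alpha> / 8" using dK by linarith
      have "(\<Sum>i\<in>UNIV. 2 powr pc i * (C * k2 i)) = C * (\<Sum>i\<in>UNIV. 2 powr pc i * M i powr pc i) * l n powr (1 - \<theta>)"
        by (simp add: k2_def sum_distrib_left sum_distrib_right mult_ac)
      then have 2: "K * (\<Sum>i\<in>UNIV. 2 powr pc i * (C * k2 i)) \<le> \<alpha> / 8" using n by simp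
      have "K * (\<Sum>i\<in>UNIV. 2 powr pc i * (C * (k1 i + k2 i)))
        = K * (\<Sum>i\<in>UNIV. 2 powr pc i * (C * k1 i)) + K * (\<Sum>i\<in>UNIV. 2 powr pc i * (C * k2 i))"
        by (simp add: distrib_left sum.distrib)
      then show ?thesis using 1 2 by linarith
    qed
    define C' where "C' = 4 / \<alpha> * (K + \<alpha> / 4 * m\<Omega> + K * (\<Sum>i\<in>UNIV. k3 i))"
    have k30: "0 \<le> (\<Sum>i\<in>UNIV. k3 i)" unfolding k3_def by (intro sum_nonneg mult_nonneg_nonneg) auto
    have C'0: "0 \<le> C'" unfolding C'_def using \<alpha> K m\<Omega>0 k30 by (intro mult_nonneg_nonneg add_nonneg_nonneg) auto
    show "\<exists>C\<ge>0. \<forall>\<epsilon>. 0 < \<epsilon> \<longrightarrow> \<epsilon> \<le> 1 \<longrightarrow>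
      energy p \<Omega> \<gamma> \<epsilon> u Du
       \<le> C + C * (\<Sum>i\<in>UNIV. \<integral>x. \<bar>F i x\<bar> powr p i * wt \<gamma> \<epsilon> (u x) \<partial>?M)"
    proof (intro exI[of _ C'] conjI C'0 allI impI)
      fix \<epsilon> :: real assume \<epsilon>: "0 < \<epsilon>" "\<epsilon> \<le> 1"
      define R where "R = (\<Sum>i\<in>UNIV. \<integral>x. \<bar>F i x\<bar> powr p i * wt \<gamma> \<epsilon> (u x) \<partial>?M)"
      have R0: "0 \<le> R" unfolding R_def using wt_pos(2)[OF \<gamma> \<epsilon>] by (intro sum_nonneg integral_nonneg_AE) auto
      have "\<alpha> / 2 * D \<epsilon> \<le> K * (R + (\<Sum>i\<in>UNIV. \<integral>x. \<bar>B i x (u x)\<bar> powr pc i * wt \<gamma> \<epsilon> (u x) \<partial>?M))"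
        unfolding D_def R_def K_def pc_def using F
        by (intro energy_inequality[OF \<Omega>(1) p \<alpha> \<gamma> \<epsilon> app Du A Bcar BI _ sol]) auto
      also have "\<dots> \<le> K * (R + (\<Sum>i\<in>UNIV. 2 powr pc i * (C * (k1 i + k2 i) * (m\<Omega> + D \<epsilon>)) + k3 i))"
        using K lower(2)[OF \<epsilon>] by (intro mult_left_mono add_left_mono sum_mono) auto
      also have "\<dots> = K * R + K * (\<Sum>i\<in>UNIV. 2 powr pc i * (C * (k1 i + k2 i))) * (m\<Omega> + D \<epsilon>) + K * (\<Sum>i\<in>UNIV. k3 i)"
        by (simp only: sum.distrib sum_distrib_right[symmetric] distrib_left mult.assoc[symmetric])
      also have "\<dots> \<le> K * R + \<alpha> / 4 * (m\<Omega> + D \<epsilon>) + K * (\<Sum>i\<in>UNIV. k3 i)"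
        using absorb D0[OF \<epsilon>] m\<Omega>0 by (intro add_right_mono add_left_mono mult_right_mono) auto
      finally have "\<alpha> / 4 * D \<epsilon> \<le> K * R + \<alpha> / 4 * m\<Omega> + K * (\<Sum>i\<in>UNIV. k3 i)" by (simp add: distrib_left)
      also have "\<dots> \<le> (K + \<alpha> / 4 * m\<Omega> + K * (\<Sum>i\<in>UNIV. k3 i)) * (1 + R)"
      proof -
        have "0 \<le> \<alpha> / 4 * m\<Omega> + K * (\<Sum>i\<in>UNIV. k3 i)"
          using \<alpha> K m\<Omega>0 k30 by (intro mult_nonneg_nonneg add_nonneg_nonneg) auto
        moreover have "K * R + E \<le> (K + E) * (1 + R)" if "0 \<le> E" for E
          using mult_nonneg_nonneg[OF that R0] K by (simp add: algebra_simps)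
        ultimately show ?thesis by (metis add.assoc)
      qed
      finally have "4 / \<alpha> * (\<alpha> / 4 * D \<epsilon>) \<le> 4 / \<alpha> * ((K + \<alpha> / 4 * m\<Omega> + K * (\<Sum>i\<in>UNIV. k3 i)) * (1 + R))"
        using \<alpha> by (intro mult_left_mono) auto
      moreover have "4 / \<alpha> * (\<alpha> / 4 * D \<epsilon>) = D \<epsilon>" using \<alpha> by simp
      ultimately have "D \<epsilon> \<le> C' * (1 + R)" unfolding C'_def by (simp only: mult.assoc)
      then show "energy p \<Omega> \<gamma> \<epsilon> u Du
         \<le> C' + C' * (\<Sum>i\<in>UNIV. \<integral>x. \<bar>F i x\<bar> powr p i * wt \<gamma> \<epsilon> (u x) \<partial>?M)"
        by (simp add: D_def R_def distrib_left)
    qed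
  qed
qed

section \<open>Poincare's inequality in one direction\<close>

lemma epowr_epowr: "a \<noteq> 0 \<Longrightarrow> epowr (epowr x (1 / a)) a = x"
  by (cases x) (auto simp: powr_powr)

lemma nn_integral_lborel_translate:
  fixes c :: "'a::euclidean_space"
  assumes [measurable]: "f \<in> borel_measurable borel"
  shows "(\<integral>\<^sup>+x. f (x + c) \<partial>lborel) = (\<integral>\<^sup>+x. f x \<partial>lborel)"
proof -
  have "(\<integral>\<^sup>+x. f x \<partial>lborel) = (\<integral>\<^sup>+x. f x \<partial>distr lborel borel ((+) c))" by (simp only: lborel_distr_plus)
  also have "\<dots> = (\<integral>\<^sup>+x. f (c + x) \<partial>lborel)" by (subst nn_integral_distr) auto
  finally show ?thesis by (simp add: add.commute)
qed

text \<open>A point of \<open>\<Omega>\<close> moved by \<open>2 * R\<close> along an axis leaves \<open>\<Omega>\<close>, so the value of \<open>\<psi>\<close> is an integral of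
  the derivative over an interval of this length. Integration over all points and translation
  invariance give the estimate without a decomposition of the space.\<close>

lemma Poincare_test:
  fixes \<psi> :: "real^'n::finite \<Rightarrow> real"
  assumes \<psi>: "\<psi> \<in> test_functions \<Omega>" and R: "\<And>x. x \<in> \<Omega> \<Longrightarrow> norm x < R" "0 < R" and P: "1 < P"
  shows "(\<integral>\<^sup>+x. ennreal (\<bar>\<psi> x\<bar> powr P) \<partial>lborel)
    \<le> ennreal ((2 * R) powr P) * (\<integral>\<^sup>+x. ennreal (\<bar>partial_deriv i \<psi> x\<bar> powr P) \<partial>lborel)"
proof -
  note [measurable] = test_function_measurable[OF \<psi>]
  define L where "L = 2 * R"
  have L: "0 < L" using R by (simp add: L_def)
  define e where "e = (axis i 1 :: real^'n)"
  define G where "G x = ennreal (\<bar>partial_deriv i \<psi> x\<bar> powr P)" for x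
  have G [measurable]: "G \<in> borel_measurable borel" unfolding G_def by measurable
  have pt: "ennreal (\<bar>\<psi> x\<bar> powr P) \<le> ennreal (L powr (P - 1)) * (\<integral>\<^sup>+t. indicator {0..L} t * G (x + t *\<^sub>R e) \<partial>lborel)" for x
  proof (cases "x \<in> \<Omega>")
    case False
    then show ?thesis using test_functionsD(6)[OF \<psi>] by simp
  next
    case True
    let ?h' = "\<lambda>t. partial_deriv i \<psi> (x + t *\<^sub>R e)"
    have "\<psi> (x + L *\<^sub>R e) = 0"
    proof (rule test_functionsD(6)[OF \<psi>], rule notI)
      assume "x + L *\<^sub>R e \<in> \<Omega>"
      then have "\<bar>(x + L *\<^sub>R e) $ i\<bar> < R" using R(1) component_le_norm_cart le_less_trans by blast
      moreover have "\<bar>x $ i\<bar> < R" using R(1)[OF True] component_le_norm_cart le_less_trans by blast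
      ultimately show False by (simp add: e_def L_def)
    qed
    moreover have der: "((\<lambda>t. \<psi> (x + t *\<^sub>R e)) has_real_derivative ?h' t) (at t)" for t
      using test_function_line_deriv[OF \<psi>, where x = x and i = i and t = "t + x $ i"]
      unfolding DERIV_shift by (simp add: upd_conv e_def)
    have cont: "continuous_on UNIV ?h'"
      using test_functionsD(2)[OF \<psi>] by (rule continuous_on_compose2) (auto intro!: continuous_intros)
    have "has_bochner_integral lborel (\<lambda>t. ?h' t * indicator {0..L} t) (\<psi> (x + L *\<^sub>R e) - \<psi> (x + 0 *\<^sub>R e))"
      using der cont L by (intro has_bochner_integral_FTC_Icc_real) (auto simp: continuous_on_eq_continuous_at)
    ultimately have "ennreal \<bar>\<psi> x\<bar> \<le> (\<integral>\<^sup>+t. ennreal (norm (?h' t * indicator {0..L} t)) \<partial>lborel)"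
      using integral_norm_bound_ennreal[of lborel "\<lambda>t. ?h' t * indicator {0..L} t"]
      by (simp add: has_bochner_integral_iff)
    also have "\<dots> = (\<integral>\<^sup>+t. epowr (indicator {0..L} t * G (x + t *\<^sub>R e)) (1 / P) * epowr (indicator {0..L} t) (1 - 1 / P) \<partial>lborel)"
      using P by (intro nn_integral_cong) (auto simp: indicator_def G_def powr_powr epowr_1)
    also have "\<dots> \<le> epowr (\<integral>\<^sup>+t. indicator {0..L} t * G (x + t *\<^sub>R e) \<partial>lborel) (1 / P) *
        epowr (\<integral>\<^sup>+t. indicator {0..L} t \<partial>lborel) (1 - 1 / P)"
      using P by (intro nn_integral_Holder_two) auto
    also have "(\<integral>\<^sup>+t. indicator {0..L} t \<partial>lborel) = ennreal L" using L by simp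
    finally have "epowr (ennreal \<bar>\<psi> x\<bar>) P \<le> epowr (epowr (\<integral>\<^sup>+t. indicator {0..L} t * G (x + t *\<^sub>R e) \<partial>lborel) (1 / P) *
        epowr (ennreal L) (1 - 1 / P)) P" using P by (intro epowr_mono) auto
    also have "\<dots> = (\<integral>\<^sup>+t. indicator {0..L} t * G (x + t *\<^sub>R e) \<partial>lborel) * ennreal (L powr (P - 1))"
      using P L by (simp add: epowr_mult epowr_epowr powr_powr left_diff_distrib)
    finally show ?thesis by (simp add: mult.commute)
  qed
  have "(\<integral>\<^sup>+x. ennreal (\<bar>\<psi> x\<bar> powr P) \<partial>lborel)
      \<le> (\<integral>\<^sup>+x. ennreal (L powr (P - 1)) * (\<integral>\<^sup>+t. indicator {0..L} t * G (x + t *\<^sub>R e) \<partial>lborel) \<partial>lborel)"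
    by (intro nn_integral_mono pt)
  also have "\<dots> = ennreal (L powr (P - 1)) * (\<integral>\<^sup>+x. (\<integral>\<^sup>+t. indicator {0..L} t * G (x + t *\<^sub>R e) \<partial>lborel) \<partial>lborel)"
    by (intro nn_integral_cmult) measurable
  also have "(\<integral>\<^sup>+x. (\<integral>\<^sup>+t. indicator {0..L} t * G (x + t *\<^sub>R e) \<partial>lborel) \<partial>lborel)
      = (\<integral>\<^sup>+t. (\<integral>\<^sup>+x. indicator {0..L} t * G (x + t *\<^sub>R e) \<partial>lborel) \<partial>lborel)"
    by (rule pair_sigma_finite.Fubini') (auto simp: pair_sigma_finite_def sigma_finite_lborel)
  also have "\<dots> = (\<integral>\<^sup>+t. indicator {0..L} t * (\<integral>\<^sup>+x. G x \<partial>lborel) \<partial>lborel)"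
    by (simp add: nn_integral_cmult nn_integral_lborel_translate[OF G])
  also have "\<dots> = ennreal L * (\<integral>\<^sup>+x. G x \<partial>lborel)"
    using L by (simp add: nn_integral_multc)
  also have "ennreal (L powr (P - 1)) * (ennreal L * (\<integral>\<^sup>+x. G x \<partial>lborel)) = ennreal (L powr P) * (\<integral>\<^sup>+x. G x \<partial>lborel)"
  proof -
    have "L powr (P - 1) * L = L powr P" using L by (simp add: powr_diff)
    then have "ennreal (L powr (P - 1)) * ennreal L = ennreal (L powr P)" using L by (simp add: ennreal_mult[symmetric])
    then show ?thesis by (simp only: mult.assoc[symmetric])
  qed
  finally show ?thesis by (simp add: L_def G_def)
qed

lemma nn_integral_lebesgue_on_eq:
  fixes f :: "'a::euclidean_space \<Rightarrow> ennreal"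
  assumes f: "f \<in> borel_measurable borel" and \<Omega>: "\<Omega> \<in> sets lebesgue" and 0: "\<And>x. x \<notin> \<Omega> \<Longrightarrow> f x = 0"
  shows "(\<integral>\<^sup>+x. f x \<partial>lebesgue_on \<Omega>) = (\<integral>\<^sup>+x. f x \<partial>lborel)"
proof -
  have "(\<integral>\<^sup>+x. f x \<partial>lebesgue_on \<Omega>) = (\<integral>\<^sup>+x. f x * indicator \<Omega> x \<partial>lebesgue)"
    using \<Omega> by (intro nn_integral_restrict_space) simp
  also have "\<dots> = (\<integral>\<^sup>+x. f x \<partial>lebesgue)" using 0 by (intro nn_integral_cong) (auto simp: indicator_def)
  also have "\<dots> = (\<integral>\<^sup>+x. f x \<partial>lborel)" using f by (simp add: nn_integral_completion)
  finally show ?thesis .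
qed

text \<open>The weight is absorbed into the test function \<open>\<phi> * w (\<phi>)\<close> with the exponent \<open>\<gamma> / p i\<close>.\<close>

lemma Poincare_weighted_test:
  fixes \<phi> :: "real^'n::finite \<Rightarrow> real" and p :: "'n \<Rightarrow> real"
  assumes \<phi>: "\<phi> \<in> test_functions \<Omega>" and \<Omega>: "open \<Omega>" and R: "\<And>x. x \<in> \<Omega> \<Longrightarrow> norm x < R" "0 < R"
    and p: "\<And>i. 1 < p i" and \<gamma>: "0 \<le> \<gamma>" and \<epsilon>: "0 < \<epsilon>" "\<epsilon> \<le> 1"
  shows "(\<integral>\<^sup>+x. ennreal (\<bar>\<phi> x\<bar> powr p i * wt \<gamma> \<epsilon> (\<phi> x)) \<partial>lebesgue_on \<Omega>)
    \<le> ennreal ((2 * R) powr p i * (1 + \<gamma> / p i) powr p i *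
        (\<integral>x. wt \<gamma> \<epsilon> (\<phi> x) * \<bar>partial_deriv i \<phi> x\<bar> powr p i \<partial>lebesgue_on \<Omega>))"
proof -
  let ?P = "p i" and ?\<gamma> = "\<gamma> / p i"
  have P: "1 < ?P" by (rule p)
  have \<gamma>': "0 \<le> ?\<gamma>" using \<gamma> P by simp
  have \<Omega>l: "\<Omega> \<in> sets lebesgue" using \<Omega> by simp
  note [measurable] = test_function_measurable[OF \<phi>] wt_measurable[OF \<gamma> \<epsilon>]
  have wP: "wt ?\<gamma> \<epsilon> t powr ?P = wt \<gamma> \<epsilon> t" for t using P by (simp add: wt_def powr_powr)
  define \<psi> where "\<psi> x = \<phi> x * wt ?\<gamma> \<epsilon> (\<phi> x)" for x
  have \<psi>: "\<psi> \<in> test_functions \<Omega>" and d\<psi>: "partial_deriv i \<psi> x = dwt ?\<gamma> \<epsilon> (\<phi> x) * partial_deriv i \<phi> x" for x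
    unfolding \<psi>_def[abs_def] by (rule truncation_test_function[OF \<gamma>' \<epsilon> \<phi>])+
  have w0: "0 \<le> wt g \<epsilon> t" if "0 \<le> g" for g t using wt_pos(2)[OF that \<epsilon>] .
  have \<psi>P: "\<bar>\<psi> x\<bar> powr ?P = \<bar>\<phi> x\<bar> powr ?P * wt \<gamma> \<epsilon> (\<phi> x)" for x
    using w0[OF \<gamma>'] by (simp add: \<psi>_def abs_mult powr_mult wP)
  have d\<psi>P: "\<bar>partial_deriv i \<psi> x\<bar> powr ?P \<le> (1 + ?\<gamma>) powr ?P * (wt \<gamma> \<epsilon> (\<phi> x) * \<bar>partial_deriv i \<phi> x\<bar> powr ?P)" for x
  proof -
    have "\<bar>partial_deriv i \<psi> x\<bar> powr ?P = dwt ?\<gamma> \<epsilon> (\<phi> x) powr ?P * \<bar>partial_deriv i \<phi> x\<bar> powr ?P"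
      using dwt_bounds(3)[OF \<gamma>' \<epsilon>] by (simp add: d\<psi> abs_mult powr_mult)
    also have "\<dots> \<le> ((1 + ?\<gamma>) * wt ?\<gamma> \<epsilon> (\<phi> x)) powr ?P * \<bar>partial_deriv i \<phi> x\<bar> powr ?P"
      using dwt_bounds(2,3)[OF \<gamma>' \<epsilon>] P by (intro mult_right_mono powr_mono2) auto
    also have "((1 + ?\<gamma>) * wt ?\<gamma> \<epsilon> (\<phi> x)) powr ?P = (1 + ?\<gamma>) powr ?P * wt \<gamma> \<epsilon> (\<phi> x)"
      using \<gamma>' w0[OF \<gamma>'] by (simp add: powr_mult wP)
    finally show ?thesis by (simp only: mult.assoc)
  qed
  have "(\<integral>\<^sup>+x. ennreal (\<bar>\<phi> x\<bar> powr ?P * wt \<gamma> \<epsilon> (\<phi> x)) \<partial>lebesgue_on \<Omega>) = (\<integral>\<^sup>+x. ennreal (\<bar>\<psi> x\<bar> powr ?P) \<partial>lborel)"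
    unfolding \<psi>P using test_functionsD(6)[OF \<phi>] by (intro nn_integral_lebesgue_on_eq \<Omega>l) auto
  also have "\<dots> \<le> ennreal ((2 * R) powr ?P) * (\<integral>\<^sup>+x. ennreal (\<bar>partial_deriv i \<psi> x\<bar> powr ?P) \<partial>lborel)"
    by (rule Poincare_test[OF \<psi> R P])
  also have "\<dots> \<le> ennreal ((2 * R) powr ?P) *
     (\<integral>\<^sup>+x. ennreal ((1 + ?\<gamma>) powr ?P) * ennreal (wt \<gamma> \<epsilon> (\<phi> x) * \<bar>partial_deriv i \<phi> x\<bar> powr ?P) \<partial>lborel)"
    using d\<psi>P by (intro mult_left_mono nn_integral_mono) (auto simp: ennreal_mult'[symmetric] intro!: ennreal_leI)
  also have "(\<integral>\<^sup>+x. ennreal ((1 + ?\<gamma>) powr ?P) * ennreal (wt \<gamma> \<epsilon> (\<phi> x) * \<bar>partial_deriv i \<phi> x\<bar> powr ?P) \<partial>lborel)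
     = ennreal ((1 + ?\<gamma>) powr ?P) * (\<integral>\<^sup>+x. ennreal (wt \<gamma> \<epsilon> (\<phi> x) * \<bar>partial_deriv i \<phi> x\<bar> powr ?P) \<partial>lborel)"
    by (intro nn_integral_cmult) measurable
  also have "(\<integral>\<^sup>+x. ennreal (wt \<gamma> \<epsilon> (\<phi> x) * \<bar>partial_deriv i \<phi> x\<bar> powr ?P) \<partial>lborel)
     = (\<integral>\<^sup>+x. ennreal (wt \<gamma> \<epsilon> (\<phi> x) * \<bar>partial_deriv i \<phi> x\<bar> powr ?P) \<partial>lebesgue_on \<Omega>)"
    using partial_deriv_outside'[OF \<phi>] by (intro nn_integral_lebesgue_on_eq[symmetric] \<Omega>l) auto
  also have "\<dots> = ennreal (\<integral>x. wt \<gamma> \<epsilon> (\<phi> x) * \<bar>partial_deriv i \<phi> x\<bar> powr ?P \<partial>lebesgue_on \<Omega>)"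
    using w0[OF \<gamma>] by (intro nn_integral_eq_integral slices_energy(1)[OF p \<phi> \<gamma> \<epsilon> \<Omega>l]) auto
  also have "ennreal ((2 * R) powr ?P) * (ennreal ((1 + ?\<gamma>) powr ?P) * ennreal (\<integral>x. wt \<gamma> \<epsilon> (\<phi> x) * \<bar>partial_deriv i \<phi> x\<bar> powr ?P \<partial>lebesgue_on \<Omega>))
    = ennreal ((2 * R) powr ?P * (1 + ?\<gamma>) powr ?P * (\<integral>x. wt \<gamma> \<epsilon> (\<phi> x) * \<bar>partial_deriv i \<phi> x\<bar> powr ?P \<partial>lebesgue_on \<Omega>))"
    by (simp only: ennreal_mult'[symmetric] powr_ge_zero mult.assoc)
  finally show ?thesis .
qed

lemma Poincare_weighted:
  fixes p :: "'n::finite \<Rightarrow> real" and u :: "real^'n \<Rightarrow> real"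
  assumes \<Omega>: "open \<Omega>" "bounded \<Omega>" and p: "\<And>i. 1 < p i" and app: "dominated_approx p \<Omega> u Du \<phi> H"
    and \<gamma>: "0 \<le> \<gamma>"
  shows "\<exists>C\<ge>0. \<forall>\<epsilon>. 0 < \<epsilon> \<longrightarrow> \<epsilon> \<le> 1 \<longrightarrow>
    (\<integral>\<^sup>+x. ennreal ((1 + (u x)\<^sup>2) powr (p i / 2) * wt \<gamma> \<epsilon> (u x)) \<partial>lebesgue_on \<Omega>)
     \<le> ennreal (C * (1 + (\<integral>x. wt \<gamma> \<epsilon> (u x) * \<bar>Du x $ i\<bar> powr p i \<partial>lebesgue_on \<Omega>)))"
proof -
  let ?P = "p i" and ?M = "lebesgue_on \<Omega>"
  have P: "1 < ?P" by (rule p)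
  have \<Omega>l: "\<Omega> \<in> sets lebesgue" using \<Omega> by simp
  have \<phi>: "\<phi> k \<in> test_functions \<Omega>" for k using app by (simp add: dominated_approx_def)
  obtain R where R: "\<And>x. x \<in> \<Omega> \<Longrightarrow> norm x < R" "0 < R"
  proof -
    obtain R where "\<And>x. x \<in> \<Omega> \<Longrightarrow> norm x \<le> R" using \<Omega>(2) by (auto simp: bounded_iff)
    then have "norm x < \<bar>R\<bar> + 1" if "x \<in> \<Omega>" for x using that by fastforce
    then show thesis by (intro that[of "\<bar>R\<bar> + 1"]) auto
  qed
  define k1 where "k1 = 2 powr (?P / 2) * 2 powr (\<gamma> / 2) * measure lebesgue \<Omega>"
  define k2 where "k2 = 2 powr (?P / 2) * ((2 * R) powr ?P * (1 + \<gamma> / ?P) powr ?P)"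
  have k: "0 \<le> k1" "0 \<le> k2" by (simp_all add: k1_def k2_def)
  show ?thesis
  proof (intro exI[of _ "k1 + k2"] conjI allI impI)
    show "0 \<le> k1 + k2" using k by simp
    fix \<epsilon> :: real assume \<epsilon>: "0 < \<epsilon>" "\<epsilon> \<le> 1"
    note [measurable] = approx_measurable[OF p \<Omega>l app \<gamma> \<epsilon>] wt_measurable[OF \<gamma> \<epsilon>]
    have w0: "0 \<le> wt \<gamma> \<epsilon> t" for t by (rule wt_pos[OF \<gamma> \<epsilon>])
    define I where "I k = (\<integral>x. wt \<gamma> \<epsilon> (\<phi> k x) * \<bar>partial_deriv i (\<phi> k) x\<bar> powr ?P \<partial>?M)" for k
    define J where "J = (\<integral>x. wt \<gamma> \<epsilon> (u x) * \<bar>Du x $ i\<bar> powr ?P \<partial>?M)"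
    have I0: "0 \<le> I k" for k unfolding I_def using w0 by (intro integral_nonneg_AE) auto
    have J0: "0 \<le> J" unfolding J_def using w0 by (intro integral_nonneg_AE) auto
    have pt: "(1 + t\<^sup>2) powr (?P / 2) * wt \<gamma> \<epsilon> t \<le> 2 powr (?P / 2) * 2 powr (\<gamma> / 2) + 2 powr (?P / 2) * (\<bar>t\<bar> powr ?P * wt \<gamma> \<epsilon> t)" for t
    proof (cases "\<bar>t\<bar> \<le> 1")
      case True
      then have "t\<^sup>2 \<le> 1" by (simp add: abs_square_le_1)
      then have "(1 + t\<^sup>2) powr (?P / 2) \<le> 2 powr (?P / 2)" using P by (intro powr_mono2) auto
      then have "(1 + t\<^sup>2) powr (?P / 2) * wt \<gamma> \<epsilon> t \<le> 2 powr (?P / 2) * 2 powr (\<gamma> / 2)"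
        using wt_small[OF \<gamma> \<epsilon> True] w0 by (intro mult_mono) auto
      moreover have "0 \<le> 2 powr (?P / 2) * (\<bar>t\<bar> powr ?P * wt \<gamma> \<epsilon> t)" using w0 by simp
      ultimately show ?thesis by linarith
    next
      case False
      then have "1 \<le> t\<^sup>2" using abs_le_square_iff[of 1 t] by simp
      then have "(1 + t\<^sup>2) powr (?P / 2) \<le> (2 * t\<^sup>2) powr (?P / 2)" using P by (intro powr_mono2) auto
      also have "\<dots> = 2 powr (?P / 2) * (\<bar>t\<bar> powr 2) powr (?P / 2)" using False by (simp add: powr_mult)
      also have "(\<bar>t\<bar> powr 2) powr (?P / 2) = \<bar>t\<bar> powr ?P" unfolding powr_powr by simp
      finally have "(1 + t\<^sup>2) powr (?P / 2) * wt \<gamma> \<epsilon> t \<le> 2 powr (?P / 2) * \<bar>t\<bar> powr ?P * wt \<gamma> \<epsilon> t"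
        using w0 by (rule mult_right_mono)
      moreover have "0 \<le> 2 powr (?P / 2) * 2 powr (\<gamma> / 2)" by simp
      ultimately show ?thesis by (simp only: mult.assoc)
    qed
    have "(\<integral>\<^sup>+x. 1 * ennreal ((1 + (u x)\<^sup>2) powr (?P / 2) * wt \<gamma> \<epsilon> (u x)) \<partial>?M) \<le> ennreal (k1 + k2 * J)"
    proof (rule Fatou_approx[OF p \<Omega>l app \<gamma> \<epsilon>, where f = "\<lambda>t. (1 + t\<^sup>2) powr (?P / 2) * wt \<gamma> \<epsilon> t"])
      have pos: "0 < 1 + t\<^sup>2" for t :: real by (simp add: add_pos_nonneg)
      then have "1 + t\<^sup>2 \<noteq> 0" for t :: real by (metis less_irrefl)
      then show "continuous_on UNIV (\<lambda>t. (1 + t\<^sup>2) powr (?P / 2) * wt \<gamma> \<epsilon> t)"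
        using wt_continuous[OF \<gamma> \<epsilon>] by (intro continuous_intros) auto
      show "0 < (1 + t\<^sup>2) powr (?P / 2) * wt \<gamma> \<epsilon> t" for t
        using wt_pos(1)[OF \<gamma> \<epsilon>, of t] pos[of t] by simp
      show "(\<lambda>k. k1 + k2 * I k) \<longlonglongrightarrow> k1 + k2 * J"
        unfolding I_def J_def by (intro tendsto_intros energy_tendsto[OF p \<Omega>l app \<gamma> \<epsilon>])
      fix k
      have "(\<integral>\<^sup>+x. 1 * ennreal ((1 + (\<phi> k x)\<^sup>2) powr (?P / 2) * wt \<gamma> \<epsilon> (\<phi> k x)) \<partial>?M)
         \<le> (\<integral>\<^sup>+x. ennreal (2 powr (?P / 2) * 2 powr (\<gamma> / 2)) + ennreal (2 powr (?P / 2)) * ennreal (\<bar>\<phi> k x\<bar> powr ?P * wt \<gamma> \<epsilon> (\<phi> k x)) \<partial>?M)"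
      proof (rule nn_integral_mono)
        fix x
        have "ennreal ((1 + (\<phi> k x)\<^sup>2) powr (?P / 2) * wt \<gamma> \<epsilon> (\<phi> k x))
          \<le> ennreal (2 powr (?P / 2) * 2 powr (\<gamma> / 2) + 2 powr (?P / 2) * (\<bar>\<phi> k x\<bar> powr ?P * wt \<gamma> \<epsilon> (\<phi> k x)))"
          by (rule ennreal_leI[OF pt])
        also have "\<dots> = ennreal (2 powr (?P / 2) * 2 powr (\<gamma> / 2)) + ennreal (2 powr (?P / 2) * (\<bar>\<phi> k x\<bar> powr ?P * wt \<gamma> \<epsilon> (\<phi> k x)))"
          using w0 by (intro ennreal_plus) auto
        finally show "1 * ennreal ((1 + (\<phi> k x)\<^sup>2) powr (?P / 2) * wt \<gamma> \<epsilon> (\<phi> k x))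
          \<le> ennreal (2 powr (?P / 2) * 2 powr (\<gamma> / 2)) + ennreal (2 powr (?P / 2)) * ennreal (\<bar>\<phi> k x\<bar> powr ?P * wt \<gamma> \<epsilon> (\<phi> k x))"
          by (simp only: ennreal_mult'[symmetric] powr_ge_zero mult_1_left)
      qed
      also have "\<dots> = ennreal (2 powr (?P / 2) * 2 powr (\<gamma> / 2)) * emeasure ?M \<Omega> +
          ennreal (2 powr (?P / 2)) * (\<integral>\<^sup>+x. ennreal (\<bar>\<phi> k x\<bar> powr ?P * wt \<gamma> \<epsilon> (\<phi> k x)) \<partial>?M)"
        by (subst nn_integral_add) (simp_all add: nn_integral_cmult)
      also have "emeasure ?M \<Omega> = ennreal (measure lebesgue \<Omega>)"
        using finite_emeasure_subset(1)[OF \<Omega>(2) \<Omega>l, of \<Omega>] \<Omega>l by (simp add: emeasure_restrict_space)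
      also have "ennreal (2 powr (?P / 2) * 2 powr (\<gamma> / 2)) * ennreal (measure lebesgue \<Omega>) +
          ennreal (2 powr (?P / 2)) * (\<integral>\<^sup>+x. ennreal (\<bar>\<phi> k x\<bar> powr ?P * wt \<gamma> \<epsilon> (\<phi> k x)) \<partial>?M)
        \<le> ennreal (2 powr (?P / 2) * 2 powr (\<gamma> / 2)) * ennreal (measure lebesgue \<Omega>) +
          ennreal (2 powr (?P / 2)) * ennreal ((2 * R) powr ?P * (1 + \<gamma> / ?P) powr ?P * I k)"
        unfolding I_def by (intro add_left_mono mult_left_mono Poincare_weighted_test[OF \<phi> \<Omega>(1) R p \<gamma> \<epsilon>]) auto
      also have "\<dots> = ennreal (k1 + k2 * I k)"
        using I0[of k] by (simp add: k1_def k2_def ennreal_mult mult.assoc)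
      finally show "(\<integral>\<^sup>+x. 1 * ennreal ((1 + (\<phi> k x)\<^sup>2) powr (?P / 2) * wt \<gamma> \<epsilon> (\<phi> k x)) \<partial>?M) \<le> ennreal (k1 + k2 * I k)" .
    qed simp
    also have "\<dots> \<le> ennreal ((k1 + k2) * (1 + J))"
      using k J0 by (intro ennreal_leI) (simp add: algebra_simps)
    finally show "(\<integral>\<^sup>+x. ennreal ((1 + (u x)\<^sup>2) powr (?P / 2) * wt \<gamma> \<epsilon> (u x)) \<partial>?M)
     \<le> ennreal ((k1 + k2) * (1 + (\<integral>x. wt \<gamma> \<epsilon> (u x) * \<bar>Du x $ i\<bar> powr ?P \<partial>?M)))"
      by (simp add: J_def)
  qed
qed

section \<open>Bootstrap and conclusion\<close>

lemma power_bootstrap: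
  fixes Y C a b :: real
  assumes Y: "0 \<le> Y" "Y powr a \<le> C * (1 + Y powr b)" and ab: "0 \<le> b" "b < a" and C: "0 \<le> C"
  shows "Y \<le> max 1 ((2 * C) powr (1 / (a - b)))"
proof (cases "Y \<le> 1")
  case False
  then have Yb: "1 \<le> Y powr b" using ab by (intro ge_one_powr_ge_zero) auto
  have "Y powr (a - b) * Y powr b = Y powr a" by (simp add: powr_add[symmetric])
  also have "\<dots> \<le> C * (2 * Y powr b)"
    using order_trans[OF Y(2) mult_left_mono[OF _ C, of "1 + Y powr b" "2 * Y powr b"]] Yb by simp
  also have "\<dots> = (2 * C) * Y powr b" by simp
  finally have "Y powr (a - b) * Y powr b \<le> (2 * C) * Y powr b" .
  then have "Y powr (a - b) \<le> 2 * C" by (rule mult_right_le_imp_le) (use Yb in linarith)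
  then have "(Y powr (a - b)) powr (1 / (a - b)) \<le> (2 * C) powr (1 / (a - b))"
    using ab by (intro powr_mono2) auto
  then show ?thesis using False ab by (simp add: powr_powr)
qed simp

lemma integral_Holder:
  fixes f g :: "'a \<Rightarrow> real"
  assumes m: "1 < m" and f: "\<And>x. 0 \<le> f x" "integrable M (\<lambda>x. f x powr m)"
    and g: "\<And>x. 0 \<le> g x" "integrable M (\<lambda>x. g x powr (m / (m - 1)))"
    and [measurable]: "f \<in> borel_measurable M" "g \<in> borel_measurable M"
  shows "(\<integral>x. f x * g x \<partial>M) \<le> (\<integral>x. f x powr m \<partial>M) powr (1 / m) * (\<integral>x. g x powr (m / (m - 1)) \<partial>M) powr (1 - 1 / m)"
proof (rule integral_le_of_nn_integral(2))
  have m': "0 < 1 / m" "0 < 1 - 1 / m" using m by auto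
  have e: "1 - 1 / m = (m - 1) / m" using m by (simp add: field_simps)
  have "(\<integral>\<^sup>+x. ennreal (f x * g x) \<partial>M) = (\<integral>\<^sup>+x. epowr (ennreal (f x powr m)) (1 / m) * epowr (ennreal (g x powr (m / (m - 1)))) (1 - 1 / m) \<partial>M)"
  proof (rule nn_integral_cong)
    fix x
    have "(f x powr m) powr (1 / m) = f x" "(g x powr (m / (m - 1))) powr (1 - 1 / m) = g x"
      unfolding e using m f(1)[of x] g(1)[of x] by (simp_all add: powr_powr)
    then show "ennreal (f x * g x) = epowr (ennreal (f x powr m)) (1 / m) * epowr (ennreal (g x powr (m / (m - 1)))) (1 - 1 / m)"
      using f(1)[of x] by (simp add: ennreal_mult')
  qed
  also have "\<dots> \<le> epowr (\<integral>\<^sup>+x. ennreal (f x powr m) \<partial>M) (1 / m) * epowr (\<integral>\<^sup>+x. ennreal (g x powr (m / (m - 1))) \<partial>M) (1 - 1 / m)"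
    using m' by (intro nn_integral_Holder_two) auto
  also have "\<dots> = ennreal ((\<integral>x. f x powr m \<partial>M) powr (1 / m) * (\<integral>x. g x powr (m / (m - 1)) \<partial>M) powr (1 - 1 / m))"
    using f g by (simp add: nn_integral_eq_integral integral_nonneg_AE ennreal_mult)
  finally show "(\<integral>\<^sup>+x. ennreal (f x * g x) \<partial>M) \<le> ennreal ((\<integral>x. f x powr m \<partial>M) powr (1 / m) * (\<integral>x. g x powr (m / (m - 1)) \<partial>M) powr (1 - 1 / m))" .
qed (use f g in auto)

lemma bounded_integrable_lebesgue_on:
  fixes f :: "'a::euclidean_space \<Rightarrow> real"
  assumes \<Omega>: "bounded \<Omega>" "\<Omega> \<in> sets lebesgue" and [measurable]: "f \<in> borel_measurable (lebesgue_on \<Omega>)" and "\<And>x. \<bar>f x\<bar> \<le> C"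
  shows "integrable (lebesgue_on \<Omega>) f"
proof -
  have "finite_measure (lebesgue_on \<Omega>)"
    using finite_emeasure_subset(2)[OF \<Omega>, of \<Omega>] \<Omega> by (intro finite_measureI) (simp add: emeasure_restrict_space)
  then show ?thesis by (rule finite_measure.integrable_const_bound[where B = C]) (use assms(4) in auto)
qed

text \<open>The function space \<open>L\<^sup>\<sigma>\<close> with \<open>\<sigma> = \<gamma> \<mu> / (\<mu> - 1)\<close> is the one for which the right-hand side of the
  energy estimate can be bounded by Hoelder's inequality with exponents \<open>\<mu>\<close> and \<open>\<mu> / (\<mu> - 1)\<close>. Any
  estimate of the same integral by the energy with a power larger than \<open>1 - 1 / \<mu>\<close> closes the circle.\<close>

lemma integrability_from_energy:
  fixes u :: "real^'n::finite \<Rightarrow> real" and f :: "'i::finite \<Rightarrow> real^'n \<Rightarrow> real"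
  assumes \<Omega>: "bounded \<Omega>" "\<Omega> \<in> sets lebesgue" and u [measurable]: "u \<in> borel_measurable (lebesgue_on \<Omega>)"
    and \<mu>: "1 < \<mu>" and \<gamma>: "0 < \<gamma>" and C: "0 \<le> C1" "0 \<le> C2" and a: "1 - 1 / \<mu> < a"
    and f: "\<And>i x. 0 \<le> f i x" and fm [measurable]: "\<And>i. f i \<in> borel_measurable (lebesgue_on \<Omega>)"
    and fI: "\<And>i. integrable (lebesgue_on \<Omega>) (\<lambda>x. f i x powr \<mu>)"
    and energy: "\<And>\<epsilon>. 0 < \<epsilon> \<Longrightarrow> \<epsilon> \<le> 1 \<Longrightarrow> D \<epsilon> \<le> C1 + C1 * (\<Sum>i\<in>UNIV. \<integral>x. f i x * wt \<gamma> \<epsilon> (u x) \<partial>lebesgue_on \<Omega>)"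
    and embed: "\<And>\<epsilon>. 0 < \<epsilon> \<Longrightarrow> \<epsilon> \<le> 1 \<Longrightarrow>
      (\<integral>x. wt \<gamma> \<epsilon> (u x) powr (\<mu> / (\<mu> - 1)) \<partial>lebesgue_on \<Omega>) powr a \<le> C2 * (1 + D \<epsilon>)"
  shows "u \<in> Lp_space (\<gamma> * \<mu> / (\<mu> - 1)) \<Omega>"
proof -
  let ?M = "lebesgue_on \<Omega>" and ?\<mu>' = "\<mu> / (\<mu> - 1)"
  have \<gamma>0: "0 \<le> \<gamma>" using \<gamma> by simp
  define L where "L = (\<Sum>i\<in>UNIV. (\<integral>x. f i x powr \<mu> \<partial>?M) powr (1 / \<mu>))"
  have L: "0 \<le> L" unfolding L_def by (intro sum_nonneg) auto
  define Y where "Y \<epsilon> = (\<integral>x. wt \<gamma> \<epsilon> (u x) powr ?\<mu>' \<partial>?M)" for \<epsilon>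
  define C3 where "C3 = C2 * (1 + C1 + C1 * L)"
  have C3: "0 \<le> C3" unfolding C3_def using C L by (intro mult_nonneg_nonneg add_nonneg_nonneg) auto
  define T where "T = max 1 ((2 * C3) powr (1 / (a - (1 - 1 / \<mu>))))"
  have wI: "integrable ?M (\<lambda>x. wt \<gamma> \<epsilon> (u x) powr ?\<mu>')" and YT: "Y \<epsilon> \<le> T" if \<epsilon>: "0 < \<epsilon>" "\<epsilon> \<le> 1" for \<epsilon>
  proof -
    note [measurable] = wt_measurable[OF \<gamma>0 \<epsilon>]
    have w0: "0 \<le> wt \<gamma> \<epsilon> t" for t by (rule wt_pos[OF \<gamma>0 \<epsilon>])
    show wI: "integrable ?M (\<lambda>x. wt \<gamma> \<epsilon> (u x) powr ?\<mu>')"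
    proof (rule bounded_integrable_lebesgue_on[OF \<Omega>])
      show "\<bar>wt \<gamma> \<epsilon> (u x) powr ?\<mu>'\<bar> \<le> ((1 / \<epsilon>) powr (\<gamma> / 2)) powr ?\<mu>'" for x
        using wt_le[OF \<gamma>0 \<epsilon>] w0 \<mu> by (simp add: powr_mono2)
    qed measurable
    have Y0: "0 \<le> Y \<epsilon>" unfolding Y_def by (intro integral_nonneg_AE) auto
    have "(\<Sum>i\<in>UNIV. \<integral>x. f i x * wt \<gamma> \<epsilon> (u x) \<partial>?M) \<le> (\<Sum>i\<in>UNIV. (\<integral>x. f i x powr \<mu> \<partial>?M) powr (1 / \<mu>) * Y \<epsilon> powr (1 - 1 / \<mu>))"
      unfolding Y_def by (intro sum_mono integral_Holder \<mu> f fI w0 wI) measurable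
    also have "\<dots> = L * Y \<epsilon> powr (1 - 1 / \<mu>)" by (simp add: L_def sum_distrib_right)
    finally have "C1 * (\<Sum>i\<in>UNIV. \<integral>x. f i x * wt \<gamma> \<epsilon> (u x) \<partial>?M) \<le> C1 * (L * Y \<epsilon> powr (1 - 1 / \<mu>))"
      using C by (intro mult_left_mono) auto
    then have "1 + D \<epsilon> \<le> 1 + (C1 + C1 * (L * Y \<epsilon> powr (1 - 1 / \<mu>)))" using energy[OF \<epsilon>] by linarith
    also have "\<dots> \<le> (1 + C1 + C1 * L) * (1 + Y \<epsilon> powr (1 - 1 / \<mu>))"
      using C L by (simp add: algebra_simps)
    finally have "C2 * (1 + D \<epsilon>) \<le> C2 * ((1 + C1 + C1 * L) * (1 + Y \<epsilon> powr (1 - 1 / \<mu>)))"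
      using C by (intro mult_left_mono) auto
    then have "Y \<epsilon> powr a \<le> C3 * (1 + Y \<epsilon> powr (1 - 1 / \<mu>))"
      using embed[OF \<epsilon>] unfolding Y_def[symmetric] C3_def by (simp only: mult.assoc)
    then show "Y \<epsilon> \<le> T" unfolding T_def using \<mu> a C3 Y0 by (intro power_bootstrap) auto
  qed
  define \<epsilon> where "\<epsilon> k = 1 / real (Suc k)" for k
  have \<epsilon>: "0 < \<epsilon> k" "\<epsilon> k \<le> 1" for k by (simp_all add: \<epsilon>_def)
  have \<epsilon>lim: "\<epsilon> \<longlonglongrightarrow> 0" unfolding \<epsilon>_def[abs_def] using LIMSEQ_inverse_real_of_nat by (simp add: inverse_eq_divide)
  let ?\<sigma> = "\<gamma> * \<mu> / (\<mu> - 1)"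
  have \<sigma>: "0 < ?\<sigma>" using \<mu> \<gamma> by simp
  have lim: "(\<lambda>k. wt \<gamma> (\<epsilon> k) t powr ?\<mu>') \<longlonglongrightarrow> (1 + t\<^sup>2) powr (?\<sigma> / 2)" for t
  proof -
    have pos: "0 < 1 + t\<^sup>2" by (simp add: add_pos_nonneg)
    have "(\<lambda>k. (1 + t\<^sup>2) / (1 + \<epsilon> k * t\<^sup>2)) \<longlonglongrightarrow> (1 + t\<^sup>2) / (1 + 0 * t\<^sup>2)"
      by (intro tendsto_intros \<epsilon>lim) simp
    then have "(\<lambda>k. ((1 + t\<^sup>2) / (1 + \<epsilon> k * t\<^sup>2)) powr (?\<sigma> / 2)) \<longlonglongrightarrow> (1 + t\<^sup>2) powr (?\<sigma> / 2)"
      using pos by (intro tendsto_powr) auto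
    moreover have "wt \<gamma> (\<epsilon> k) t powr ?\<mu>' = ((1 + t\<^sup>2) / (1 + \<epsilon> k * t\<^sup>2)) powr (?\<sigma> / 2)" for k
    proof -
      have "\<gamma> / 2 * (\<mu> / (\<mu> - 1)) = \<gamma> * \<mu> / (\<mu> - 1) / 2" by simp
      then show ?thesis by (simp only: wt_def powr_powr)
    qed
    ultimately show ?thesis by simp
  qed
  have T0: "0 \<le> T" by (simp add: T_def)
  have "(\<integral>\<^sup>+x. ennreal ((1 + (u x)\<^sup>2) powr (?\<sigma> / 2)) \<partial>?M) = (\<integral>\<^sup>+x. liminf (\<lambda>k. ennreal (wt \<gamma> (\<epsilon> k) (u x) powr ?\<mu>')) \<partial>?M)"
    by (intro nn_integral_cong lim_imp_Liminf[symmetric] tendsto_ennrealI lim) simp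
  also have "\<dots> \<le> liminf (\<lambda>k. \<integral>\<^sup>+x. ennreal (wt \<gamma> (\<epsilon> k) (u x) powr ?\<mu>') \<partial>?M)"
  proof (rule nn_integral_liminf)
    fix k
    note [measurable] = wt_measurable[OF \<gamma>0 \<epsilon>[of k]]
    show "(\<lambda>x. ennreal (wt \<gamma> (\<epsilon> k) (u x) powr ?\<mu>')) \<in> borel_measurable ?M" by measurable
  qed
  also have "\<dots> \<le> liminf (\<lambda>k. ennreal T)"
  proof (intro Liminf_mono always_eventually allI)
    fix k
    have "(\<integral>\<^sup>+x. ennreal (wt \<gamma> (\<epsilon> k) (u x) powr ?\<mu>') \<partial>?M) = ennreal (Y (\<epsilon> k))"
      unfolding Y_def by (intro nn_integral_eq_integral wI \<epsilon>) auto
    then show "(\<integral>\<^sup>+x. ennreal (wt \<gamma> (\<epsilon> k) (u x) powr ?\<mu>') \<partial>?M) \<le> ennreal T"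
      using YT[OF \<epsilon>[of k]] by (simp add: ennreal_leI)
  qed
  also have "\<dots> = ennreal T" by (simp add: Liminf_const)
  finally have bound: "(\<integral>\<^sup>+x. ennreal ((1 + (u x)\<^sup>2) powr (?\<sigma> / 2)) \<partial>?M) \<le> ennreal T" .
  have "(\<integral>\<^sup>+x. ennreal (\<bar>u x\<bar> powr ?\<sigma>) \<partial>?M) \<le> (\<integral>\<^sup>+x. ennreal ((1 + (u x)\<^sup>2) powr (?\<sigma> / 2)) \<partial>?M)"
    using \<sigma> by (intro nn_integral_mono ennreal_leI abs_powr_le_sq) simp
  then have "integrable ?M (\<lambda>x. \<bar>u x\<bar> powr ?\<sigma>)"
    using bound T0 by (intro integral_le_of_nn_integral(1)[of _ _ T]) auto
  then show ?thesis using u by (simp add: Lp_space_def)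
qed

lemma Morrey_weight_Lp:
  fixes v :: "real^'n::finite \<Rightarrow> real"
  assumes \<Omega>: "bounded \<Omega>" "\<Omega> \<in> sets lebesgue" and [measurable]: "v \<in> borel_measurable (lebesgue_on \<Omega>)"
    and v: "\<And>x. 0 \<le> v x" "integrable (lebesgue_on \<Omega>) (\<lambda>x. v x powr m)" and m: "1 < m"
  shows "Morrey_weight \<Omega> (1 - 1 / m) ((\<integral>x. v x powr m \<partial>lebesgue_on \<Omega>) powr (1 / m)) (\<lambda>x. ennreal (v x))"
  unfolding Morrey_weight_def
proof (intro conjI ballI impI)
  let ?M = "lebesgue_on \<Omega>" and ?Y = "\<integral>x. v x powr m \<partial>lebesgue_on \<Omega>"
  fix E assume E: "E \<in> sets lebesgue" "E \<subseteq> \<Omega>"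
  then have [measurable]: "E \<in> sets ?M" using \<Omega> by (simp add: sets_restrict_space_iff)
  have "(\<integral>\<^sup>+x. ennreal (v x) * indicator E x \<partial>?M) = (\<integral>\<^sup>+x. epowr (ennreal (v x powr m)) (1 / m) * epowr (indicator E x) (1 - 1 / m) \<partial>?M)"
    using m v by (intro nn_integral_cong) (auto simp: indicator_def powr_powr epowr_1)
  also have "\<dots> \<le> epowr (\<integral>\<^sup>+x. ennreal (v x powr m) \<partial>?M) (1 / m) * epowr (\<integral>\<^sup>+x. indicator E x \<partial>?M) (1 - 1 / m)"
    using m by (intro nn_integral_Holder_two) auto
  also have "(\<integral>\<^sup>+x. ennreal (v x powr m) \<partial>?M) = ennreal ?Y" using v by (intro nn_integral_eq_integral) auto
  also have "(\<integral>\<^sup>+x. indicator E x \<partial>?M) = ennreal (measure lebesgue E)"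
    using nn_integral_lebesgue_on_indicator[OF \<Omega>(2) E] finite_emeasure_subset(1)[OF \<Omega> E(2)] by simp
  also have "epowr (ennreal ?Y) (1 / m) * epowr (ennreal (measure lebesgue E)) (1 - 1 / m)
      = ennreal (?Y powr (1 / m) * measure lebesgue E powr (1 - 1 / m))"
    by (simp add: ennreal_mult integral_nonneg_AE)
  finally show "(\<integral>\<^sup>+x. ennreal (v x) * indicator E x \<partial>?M) \<le> ennreal (?Y powr (1 / m) * measure lebesgue E powr (1 - 1 / m))" .
qed auto

text \<open>Instead of a second summation over slices, the Hardy inequality is applied with a power of
  \<open>wt \<gamma> \<epsilon> (u)\<close> itself as \<open>V\<close>: then both sides contain the same integral \<open>Y\<close>, with powers 1 and \<open>q / N\<close>.\<close>

lemma Sobolev_weighted: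
  fixes p :: "'n::finite \<Rightarrow> real" and u :: "real^'n \<Rightarrow> real"
  assumes N: "CARD('n) > 1" and p: "\<And>i. 1 < p i"
  defines "q \<equiv> harmonic_mean p"
  assumes q: "1 < q" "q < real CARD('n)" and \<Omega>: "open \<Omega>" "bounded \<Omega>"
    and app: "dominated_approx p \<Omega> u Du \<phi> H" and \<mu>: "1 < \<mu>" "\<mu> < real CARD('n) / q"
  defines "\<gamma> \<equiv> q * real CARD('n) * (\<mu> - 1) / (real CARD('n) - \<mu> * q)"
  shows "\<exists>C\<ge>0. \<forall>\<epsilon>. 0 < \<epsilon> \<longrightarrow> \<epsilon> \<le> 1 \<longrightarrow>
    (\<integral>x. wt \<gamma> \<epsilon> (u x) powr (\<mu> / (\<mu> - 1)) \<partial>lebesgue_on \<Omega>) powr (1 - q / real CARD('n))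
      \<le> C * (1 + energy p \<Omega> \<gamma> \<epsilon> u Du)"
proof -
  let ?M = "lebesgue_on \<Omega>" and ?\<mu>' = "\<mu> / (\<mu> - 1)"
  define n where "n = real CARD('n)"
  have n: "0 < n" "1 < n / q" "\<mu> * q < n" using q \<mu> by (auto simp: n_def field_simps)
  have \<gamma>: "0 < \<gamma>" unfolding \<gamma>_def n_def[symmetric] using n q \<mu> by (intro divide_pos_pos mult_pos_pos) auto
  then have \<gamma>0: "0 \<le> \<gamma>" by simp
  define \<theta> where "\<theta> = 1 - q / n"
  have \<Omega>l: "\<Omega> \<in> sets lebesgue" using \<Omega> by simp
  have um [measurable]: "u \<in> borel_measurable ?M" using app by (simp add: dominated_approx_def)
  obtain C where C: "C > 0" and Hardy_all: "\<And>(\<Omega> :: (real^'n) set) u Du \<phi> H V \<kappa> \<epsilon>. open \<Omega> \<Longrightarrow> bounded \<Omega> \<Longrightarrow> 0 < \<epsilon> \<Longrightarrow> \<epsilon> \<le> 1 \<Longrightarrow>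
     dominated_approx p \<Omega> u Du \<phi> H \<Longrightarrow> Morrey_weight \<Omega> \<theta> \<kappa> V \<Longrightarrow>
     (\<integral>\<^sup>+x. V x * ennreal ((1 + (u x)\<^sup>2) powr (q / 2) * wt \<gamma> \<epsilon> (u x)) \<partial>lebesgue_on \<Omega>)
      \<le> ennreal (C * \<kappa> * (measure lebesgue \<Omega> powr \<theta> + energy p \<Omega> \<gamma> \<epsilon> u Du))"
    using Hardy_W0[OF N, of p \<gamma>] p q \<gamma>0 unfolding q_def \<theta>_def n_def by blast
  note Hardy = Hardy_all[OF \<Omega> _ _ app]
  define C' where "C' = C * (1 + measure lebesgue \<Omega> powr \<theta>)"
  show ?thesis
  proof (rule exI[of _ C'], intro conjI allI impI)
    show C'0: "0 \<le> C'" using C by (simp add: C'_def add_nonneg_nonneg)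
    fix \<epsilon> :: real assume \<epsilon>: "0 < \<epsilon>" "\<epsilon> \<le> 1"
    note [measurable] = wt_measurable[OF \<gamma>0 \<epsilon>]
    have w0: "0 \<le> wt \<gamma> \<epsilon> t" for t by (rule wt_pos[OF \<gamma>0 \<epsilon>])
    define Y where "Y = (\<integral>x. wt \<gamma> \<epsilon> (u x) powr ?\<mu>' \<partial>?M)"
    define D where "D = energy p \<Omega> \<gamma> \<epsilon> u Du"
    have Y0: "0 \<le> Y" unfolding Y_def by (intro integral_nonneg_AE) auto
    have D0: "0 \<le> D" unfolding D_def using w0 by (intro sum_nonneg integral_nonneg_AE) auto
    have wI: "integrable ?M (\<lambda>x. wt \<gamma> \<epsilon> (u x) powr ?\<mu>')"
    proof (rule bounded_integrable_lebesgue_on[OF \<Omega>(2) \<Omega>l])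
      show "\<bar>wt \<gamma> \<epsilon> (u x) powr ?\<mu>'\<bar> \<le> ((1 / \<epsilon>) powr (\<gamma> / 2)) powr ?\<mu>'" for x
        using wt_le[OF \<gamma>0 \<epsilon>] w0 \<mu> by (simp add: powr_mono2)
    qed measurable
    define v where "v x = wt \<gamma> \<epsilon> (u x) powr (?\<mu>' * (q / n))" for x
    have vm: "v x powr (n / q) = wt \<gamma> \<epsilon> (u x) powr ?\<mu>'" for x
      unfolding v_def powr_powr using q n by simp
    have [measurable]: "v \<in> borel_measurable ?M" unfolding v_def by measurable
    have "Morrey_weight \<Omega> (1 - 1 / (n / q)) ((\<integral>x. v x powr (n / q) \<partial>?M) powr (1 / (n / q))) (\<lambda>x. ennreal (v x))"
      using n wI by (intro Morrey_weight_Lp \<Omega>(2) \<Omega>l) (simp_all add: vm, simp add: v_def)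
    then have V: "Morrey_weight \<Omega> \<theta> (Y powr (q / n)) (\<lambda>x. ennreal (v x))"
      by (simp add: vm Y_def \<theta>_def)
    have e1: "?\<mu>' * \<gamma> = q * n * \<mu> / (n - \<mu> * q)" using \<mu> by (simp add: \<gamma>_def n_def)
    have e2: "q + \<gamma> = q * \<mu> * (n - q) / (n - \<mu> * q)" unfolding \<gamma>_def n_def[symmetric] using n by (simp add: field_simps)
    have e: "?\<mu>' * \<gamma> = ?\<mu>' * \<gamma> * (q / n) + (q + \<gamma>)"
    proof -
      have "q * n * \<mu> / (n - \<mu> * q) * (q / n) = q * \<mu> * q / (n - \<mu> * q)" using n by simp
      then show ?thesis unfolding e1 e2 using n(1) by (simp add: add_divide_distrib[symmetric] algebra_simps)
    qed
    have "ennreal Y = (\<integral>\<^sup>+x. ennreal (wt \<gamma> \<epsilon> (u x) powr ?\<mu>') \<partial>?M)"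
      unfolding Y_def by (intro nn_integral_eq_integral[symmetric] wI) auto
    also have "\<dots> \<le> (\<integral>\<^sup>+x. ennreal (v x) * ennreal ((1 + (u x)\<^sup>2) powr (q / 2) * wt \<gamma> \<epsilon> (u x)) \<partial>?M)"
    proof (rule nn_integral_mono)
      fix x
      let ?z = "(1 + (u x)\<^sup>2) / (1 + \<epsilon> * (u x)\<^sup>2)"
      have z: "1 \<le> ?z" "?z \<le> 1 + (u x)\<^sup>2" using wt_base(2,4)[OF \<epsilon>, of "u x"] by auto
      have "wt \<gamma> \<epsilon> (u x) powr ?\<mu>' = ?z powr (?\<mu>' * \<gamma> / 2)" by (simp add: wt_def powr_powr mult_ac)
      also have "\<dots> = ?z powr (?\<mu>' * \<gamma> * (q / n) / 2 + q / 2 + \<gamma> / 2)"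
        using arg_cong[OF e, of "\<lambda>s. ?z powr (s / 2)"] by (simp only: add_divide_distrib add.assoc)
      also have "\<dots> = v x * (?z powr (q / 2) * wt \<gamma> \<epsilon> (u x))"
        by (simp add: powr_add v_def wt_def powr_powr mult_ac)
      also have "\<dots> \<le> v x * ((1 + (u x)\<^sup>2) powr (q / 2) * wt \<gamma> \<epsilon> (u x))"
        using z q w0 by (intro mult_left_mono mult_right_mono powr_mono2) (auto simp: v_def)
      finally show "ennreal (wt \<gamma> \<epsilon> (u x) powr ?\<mu>') \<le> ennreal (v x) * ennreal ((1 + (u x)\<^sup>2) powr (q / 2) * wt \<gamma> \<epsilon> (u x))"
        by (simp add: ennreal_mult'[symmetric] v_def ennreal_leI)
    qed
    also have "\<dots> \<le> ennreal (C * Y powr (q / n) * (measure lebesgue \<Omega> powr \<theta> + D))"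
      unfolding D_def by (rule Hardy[OF \<epsilon> V])
    finally have "Y \<le> C * Y powr (q / n) * (measure lebesgue \<Omega> powr \<theta> + D)"
      using C D0 by (subst (asm) ennreal_le_iff) (auto intro!: mult_nonneg_nonneg add_nonneg_nonneg)
    also have "\<dots> \<le> C * Y powr (q / n) * ((1 + measure lebesgue \<Omega> powr \<theta>) * (1 + D))"
      using C D0 by (intro mult_left_mono) (auto simp: algebra_simps)
    finally have main: "Y \<le> Y powr (q / n) * (C' * (1 + D))" by (simp add: C'_def mult_ac)
    have "Y powr (1 - q / n) \<le> C' * (1 + D)"
    proof (cases "Y = 0")
      case True then show ?thesis using C'0 D0 by simp
    next
      case False
      then have "Y powr (1 - q / n) = Y / Y powr (q / n)" using Y0 by (simp add: powr_diff)
      also have "\<dots> \<le> C' * (1 + D)" using main False Y0 by (simp add: divide_le_eq mult.commute)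
      finally show ?thesis .
    qed
    then show "(\<integral>x. wt \<gamma> \<epsilon> (u x) powr ?\<mu>' \<partial>?M) powr (1 - q / real CARD('n))
      \<le> C' * (1 + energy p \<Omega> \<gamma> \<epsilon> u Du)"
      by (simp add: Y_def D_def n_def)
  qed
qed

lemma Lp_space_mono:
  assumes \<Omega>: "bounded \<Omega>" "\<Omega> \<in> sets lebesgue" and v: "v \<in> Lp_space r \<Omega>" and q: "0 \<le> q" "q \<le> r"
  shows "v \<in> Lp_space q \<Omega>"
proof -
  have [measurable]: "v \<in> borel_measurable (lebesgue_on \<Omega>)" and vI: "integrable (lebesgue_on \<Omega>) (\<lambda>x. \<bar>v x\<bar> powr r)"
    using v by (auto simp: Lp_space_def)
  have "integrable (lebesgue_on \<Omega>) (\<lambda>x. 1 + \<bar>v x\<bar> powr r)"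
    using vI bounded_integrable_lebesgue_on[OF \<Omega>, of "\<lambda>_. 1" 1] by simp
  then have "integrable (lebesgue_on \<Omega>) (\<lambda>x. \<bar>v x\<bar> powr q)"
  proof (rule Bochner_Integration.integrable_bound)
    have "\<bar>t\<bar> powr q \<le> 1 + \<bar>t\<bar> powr r" for t :: real
    proof (cases "\<bar>t\<bar> \<le> 1")
      case True
      then have "\<bar>t\<bar> powr q \<le> 1 powr q" using q by (intro powr_mono2) auto
      then show ?thesis by (simp add: add_increasing2)
    next
      case False
      then have "\<bar>t\<bar> powr q \<le> \<bar>t\<bar> powr r" using q by (intro powr_mono) auto
      then show ?thesis by simp
    qed
    then show "AE x in lebesgue_on \<Omega>. norm (\<bar>v x\<bar> powr q) \<le> norm (1 + \<bar>v x\<bar> powr r)"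
      by (intro AE_I2) (simp add: add_nonneg_nonneg)
  qed measurable
  then show ?thesis using v by (simp add: Lp_space_def)
qed

theorem mainTheorem4:
  fixes p r :: "'n::finite \<Rightarrow> real" and \<alpha> \<mu> s :: real
  assumes "CARD('n) > 2"
    and "\<And>i. 1 < p i"
    and "0 < \<alpha>"
    and "1 < harmonic_mean p" and "harmonic_mean p < real CARD('n)"
    and "\<mu> = (MIN i. r i / p i)"
    and "1 < \<mu>" and "\<mu> < real CARD('n) / harmonic_mean p"
    and "s = max (sobolev_exponent CARD('n) (\<mu> * harmonic_mean p)) (\<mu> * (MAX i. p i))"
  shows "\<exists>d>0. \<forall>(\<Omega> :: (real^'n) set) \<beta> A B b F u.
           open \<Omega> \<longrightarrow> bounded \<Omega> \<longrightarrow> lipschitz_boundary \<Omega> \<longrightarrow>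
           structure_A \<Omega> p \<alpha> \<beta> A \<longrightarrow> structure_B \<Omega> p b B \<longrightarrow>
           (MAX i. dist_to_Linf (real CARD('n) * conj_exponent (p i) / harmonic_mean p) \<Omega> (b i))
             < ennreal d \<longrightarrow>
           (\<forall>i. F i \<in> Lp_space (r i) \<Omega>) \<longrightarrow>
           weak_solution \<Omega> p A B F u \<longrightarrow>
           u \<in> Lp_space s \<Omega>"
proof -
  let ?q = "harmonic_mean p" and ?n = "real CARD('n)"
  have N: "CARD('n) > 1" using assms(1) by simp
  note p = assms(2) and \<alpha> = assms(3) and q = assms(4,5) and \<mu> = assms(7,8)
  have nq: "\<mu> * ?q < ?n" using \<mu> q by (simp add: field_simps)
  obtain j where j: "(MAX i. p i) = p j"
  proof -
    have "Max (range p) \<in> range p" by (rule Max_in) auto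
    then show thesis using that by blast
  qed
  \<comment> \<open>The values of \<open>\<gamma>\<close> for which \<open>\<gamma> * \<mu> / (\<mu> - 1)\<close> is the exponent reached by the Sobolev or by the
     Poincare inequality for \<open>wt\<close>.\<close>
  define \<gamma>1 where "\<gamma>1 = ?q * ?n * (\<mu> - 1) / (?n - \<mu> * ?q)"
  define \<gamma>2 where "\<gamma>2 = p j * (\<mu> - 1)"
  have \<gamma>: "0 < \<gamma>1" "0 < \<gamma>2" using \<mu> q nq p[of j] by (simp_all add: \<gamma>1_def \<gamma>2_def)
  have \<sigma>: "\<gamma>1 * \<mu> / (\<mu> - 1) = sobolev_exponent CARD('n) (\<mu> * ?q)" "\<gamma>2 * \<mu> / (\<mu> - 1) = \<mu> * (MAX i. p i)"
    using \<mu> by (simp_all add: \<gamma>1_def \<gamma>2_def sobolev_exponent_def j)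
  obtain d1 where d1: "d1 > 0" "energy_distance p \<alpha> \<gamma>1 d1"
    using energy_estimate[OF N p \<alpha> less_imp_le[OF \<gamma>(1)] q] by blast
  obtain d2 where d2: "d2 > 0" "energy_distance p \<alpha> \<gamma>2 d2"
    using energy_estimate[OF N p \<alpha> less_imp_le[OF \<gamma>(2)] q] by blast
  show ?thesis
  proof (intro exI[of _ "min d1 d2"] conjI allI impI)
    show "0 < min d1 d2" using d1 d2 by simp
    fix \<Omega> :: "(real^'n) set" and \<beta> A B b F u
    assume \<Omega>: "open \<Omega>" "bounded \<Omega>" and A: "structure_A \<Omega> p \<alpha> \<beta> A" and B: "structure_B \<Omega> p b B"
      and dist: "(MAX i. dist_to_Linf (?n * conj_exponent (p i) / ?q) \<Omega> (b i)) < ennreal (min d1 d2)"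
      and F: "\<forall>i. F i \<in> Lp_space (r i) \<Omega>" and sol: "weak_solution \<Omega> p A B F u"
    let ?M = "lebesgue_on \<Omega>"
    have \<Omega>l: "\<Omega> \<in> sets lebesgue" using \<Omega> by simp
    have di: "dist_to_Linf (?n * conj_exponent (p i) / ?q) \<Omega> (b i) < ennreal (min d1 d2)" for i
      using dist by (subst (asm) Max_less_iff) auto
    have dist1: "\<forall>i. dist_to_Linf (?n * conj_exponent (p i) / ?q) \<Omega> (b i) < ennreal d1"
      and dist2: "\<forall>i. dist_to_Linf (?n * conj_exponent (p i) / ?q) \<Omega> (b i) < ennreal d2"
      using less_le_trans[OF di ennreal_leI[OF min.cobounded1]] less_le_trans[OF di ennreal_leI[OF min.cobounded2]]
      by blast+
    have rp: "p i * \<mu> \<le> r i" for i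
    proof -
      have "\<mu> \<le> r i / p i" unfolding assms(6) by (intro Min_le) auto
      then show ?thesis using p[of i] by (simp add: le_divide_eq mult.commute)
    qed
    have F\<mu>: "F i \<in> Lp_space (p i * \<mu>) \<Omega>" for i
    proof (rule Lp_space_mono[OF \<Omega>(2) \<Omega>l _ _ rp])
      show "F i \<in> Lp_space (r i) \<Omega>" using F by blast
      show "0 \<le> p i * \<mu>" using p[of i] \<mu> by simp
    qed
    have Fp: "\<forall>i. F i \<in> Lp_space (p i) \<Omega>"
    proof
      fix i show "F i \<in> Lp_space (p i) \<Omega>"
        using p[of i] \<mu> by (intro Lp_space_mono[OF \<Omega>(2) \<Omega>l F\<mu>]) auto
    qed
    have W0: "u \<in> W0_space p \<Omega>" using sol unfolding weak_solution_def by blast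
    obtain Du \<phi> H where Du: "has_weak_gradient \<Omega> u Du" and app: "dominated_approx p \<Omega> u Du \<phi> H"
      by (rule W0_dominated_approximation[OF W0 p \<Omega>l])
    have um: "u \<in> borel_measurable ?M" using app by (simp add: dominated_approx_def)
    have Fm: "(\<lambda>x. \<bar>F i x\<bar> powr p i) \<in> borel_measurable ?M" for i
    proof -
      have [measurable]: "F i \<in> borel_measurable ?M" using F by (simp add: Lp_space_def)
      show ?thesis by measurable
    qed
    have FI: "integrable ?M (\<lambda>x. (\<bar>F i x\<bar> powr p i) powr \<mu>)" for i
      unfolding powr_powr using F\<mu> by (simp add: Lp_space_def)
    obtain C1 where C1: "C1 \<ge> 0" and C1E: "\<And>\<epsilon>. 0 < \<epsilon> \<Longrightarrow> \<epsilon> \<le> 1 \<Longrightarrow> energy p \<Omega> \<gamma>1 \<epsilon> u Du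
       \<le> C1 + C1 * (\<Sum>i\<in>UNIV. \<integral>x. \<bar>F i x\<bar> powr p i * wt \<gamma>1 \<epsilon> (u x) \<partial>?M)"
      by (rule energy_distanceD[OF d1(2) \<Omega> A B dist1 Fp sol Du app]) blast
    obtain C2 where C2: "C2 \<ge> 0" and C2E: "\<And>\<epsilon>. 0 < \<epsilon> \<Longrightarrow> \<epsilon> \<le> 1 \<Longrightarrow> energy p \<Omega> \<gamma>2 \<epsilon> u Du
       \<le> C2 + C2 * (\<Sum>i\<in>UNIV. \<integral>x. \<bar>F i x\<bar> powr p i * wt \<gamma>2 \<epsilon> (u x) \<partial>?M)"
      by (rule energy_distanceD[OF d2(2) \<Omega> A B dist2 Fp sol Du app]) blast
    \<comment> \<open>The bootstrap closes because \<open>\<mu> < N / q\<close> makes \<open>1 - 1 / \<mu>\<close> smaller than \<open>1 - q / N\<close>.\<close>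
    obtain S where S: "S \<ge> 0" and SE: "\<And>\<epsilon>. 0 < \<epsilon> \<Longrightarrow> \<epsilon> \<le> 1 \<Longrightarrow>
      (\<integral>x. wt \<gamma>1 \<epsilon> (u x) powr (\<mu> / (\<mu> - 1)) \<partial>?M) powr (1 - ?q / ?n)
        \<le> S * (1 + energy p \<Omega> \<gamma>1 \<epsilon> u Du)"
      using Sobolev_weighted[OF N p q \<Omega> app \<mu>] unfolding \<gamma>1_def by blast
    have a1: "1 - 1 / \<mu> < 1 - ?q / ?n" using nq \<mu> q by (simp add: field_simps)
    have s1: "u \<in> Lp_space (\<gamma>1 * \<mu> / (\<mu> - 1)) \<Omega>"
      by (rule integrability_from_energy[OF \<Omega>(2) \<Omega>l um \<mu>(1) \<gamma>(1) C1 S a1 _ Fm FI C1E SE]) auto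
    \<comment> \<open>For the direction \<open>j\<close> with the largest exponent Poincare's inequality has the power 1, which exceeds
       \<open>1 - 1 / \<mu>\<close> for every \<open>\<mu>\<close>.\<close>
    obtain T where T: "T \<ge> 0" and TE: "\<And>\<epsilon>. 0 < \<epsilon> \<Longrightarrow> \<epsilon> \<le> 1 \<Longrightarrow>
      (\<integral>\<^sup>+x. ennreal ((1 + (u x)\<^sup>2) powr (p j / 2) * wt \<gamma>2 \<epsilon> (u x)) \<partial>?M)
       \<le> ennreal (T * (1 + (\<integral>x. wt \<gamma>2 \<epsilon> (u x) * \<bar>Du x $ j\<bar> powr p j \<partial>?M)))"
      using Poincare_weighted[OF \<Omega> p app less_imp_le[OF \<gamma>(2)], of j] by blast
    have TE': "(\<integral>x. wt \<gamma>2 \<epsilon> (u x) powr (\<mu> / (\<mu> - 1)) \<partial>?M) powr 1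
        \<le> T * (1 + energy p \<Omega> \<gamma>2 \<epsilon> u Du)" if \<epsilon>: "0 < \<epsilon>" "\<epsilon> \<le> 1" for \<epsilon>
    proof -
      note [measurable] = um wt_measurable[OF less_imp_le[OF \<gamma>(2)] \<epsilon>]
      have w0: "0 \<le> wt \<gamma>2 \<epsilon> t" for t by (rule wt_pos[OF less_imp_le[OF \<gamma>(2)] \<epsilon>])
      let ?J = "\<integral>x. wt \<gamma>2 \<epsilon> (u x) * \<bar>Du x $ j\<bar> powr p j \<partial>?M"
      have J0: "0 \<le> ?J" using w0 by (intro integral_nonneg_AE) auto
      have pt: "wt \<gamma>2 \<epsilon> t powr (\<mu> / (\<mu> - 1)) \<le> (1 + t\<^sup>2) powr (p j / 2) * wt \<gamma>2 \<epsilon> t" for t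
      proof -
        let ?z = "(1 + t\<^sup>2) / (1 + \<epsilon> * t\<^sup>2)"
        have z: "1 \<le> ?z" "?z \<le> 1 + t\<^sup>2" using wt_base(2,4)[OF \<epsilon>, of t] by auto
        have e: "\<gamma>2 / 2 * (\<mu> / (\<mu> - 1)) = p j / 2 + \<gamma>2 / 2" using \<mu> by (simp add: \<gamma>2_def field_simps)
        have "wt \<gamma>2 \<epsilon> t powr (\<mu> / (\<mu> - 1)) = ?z powr (p j / 2) * wt \<gamma>2 \<epsilon> t"
          unfolding wt_def powr_powr e by (rule powr_add)
        also have "\<dots> \<le> (1 + t\<^sup>2) powr (p j / 2) * wt \<gamma>2 \<epsilon> t"
          using z p[of j] w0 by (intro mult_right_mono powr_mono2) auto
        finally show ?thesis .
      qed
      have "(\<integral>\<^sup>+x. ennreal (wt \<gamma>2 \<epsilon> (u x) powr (\<mu> / (\<mu> - 1))) \<partial>?M) \<le> ennreal (T * (1 + ?J))"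
        by (rule order_trans[OF nn_integral_mono TE[OF \<epsilon>]]) (intro ennreal_leI pt)
      then have "(\<integral>x. wt \<gamma>2 \<epsilon> (u x) powr (\<mu> / (\<mu> - 1)) \<partial>?M) \<le> T * (1 + ?J)"
        using T J0 by (intro integral_le_of_nn_integral(2)) auto
      also have "\<dots> \<le> T * (1 + energy p \<Omega> \<gamma>2 \<epsilon> u Du)"
      proof (intro mult_left_mono add_left_mono T)
        show "?J \<le> energy p \<Omega> \<gamma>2 \<epsilon> u Du"
          using w0 by (intro member_le_sum) (auto intro!: integral_nonneg_AE)
      qed
      finally show ?thesis by (simp add: integral_nonneg_AE)
    qed
    have a2: "1 - 1 / \<mu> < 1" using \<mu> by simp
    have s2: "u \<in> Lp_space (\<gamma>2 * \<mu> / (\<mu> - 1)) \<Omega>"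
      by (rule integrability_from_energy[OF \<Omega>(2) \<Omega>l um \<mu>(1) \<gamma>(2) C2 T a2 _ Fm FI C2E TE']) auto
    show "u \<in> Lp_space s \<Omega>"
      using s1 s2 unfolding assms(9) \<sigma> by (simp add: max_def)
  qed
qed

end
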